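(* Let $D\subset\mathbb C^2$ be either (a) the domain $D=\{z=(z_1,z_2)\in\mathbb C^2:\ |z_2|^2+x_1^2+y_1^4<1\}$, or (b) the domain $D=\{z=(z_1,z_2)\in\mathbb C^2:\ |z_2|^2+|x_1|^m+y_1^2<1\}$ with $3/2<m<2$, where $z_1=x_1+iy_1$. Then for any function $f$ of class $C^1$ on $bD$, the Cauchy-Leray integral $\mathbf C(f)(z)$, $z\in D$, extends to a continuous function on $\bar D$. Moreover, if one sets $\mathcal C(f)=\mathbf C(f)\big|_{bD}$ (the restriction of this continuous extension to $bD$), then the mapping $f\mapsto\mathcal C(f)$, defined on $C^1(bD)$, cannot be extended to a bounded operator on $L^p(bD,d\sigma)$ for any $p$ with $1\le p\le\infty$.
   Context: Here $d\sigma$ is the induced Lebesgue (surface) measure on $bD$. For a defining function $\rho$ of $D$ (for (a) one takes $\rho(w)=|w_2|^2+u_1^2+v_1^4-1$, for (b) $\rho(w)=|w_2|^2+|u_1|^m+v_1^2-1$, where $w_j=u_j+iv_j$), write $\Delta(w,z)=\langle\partial\rho(w),w-z\rangle=\sum_{j=1}^2\frac{\partial\rho}{\partial w_j}(w)(w_j-z_j)$. The Cauchy-Leray integral of $f$ is $$\mathbf C f(z)=\frac{1}{(2\pi i)^2}\int_{w\in bD} f(w)\,\frac{j^*(\partial\rho\wedge\bar\partial\partial\rho)(w)}{\Delta(w,z)^2},\qquad z\in D,$$ where $j^*$ denotes the pullback under the inclusion $j:bD\hookrightarrow\mathbb C^2$. *)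

theory Defs
  imports "HOL-Analysis.Analysis" "HOL-Probability.Essential_Supremum"
begin

text \<open>Points of C^2 are pairs (w1,w2); real coordinates (u1,v1,u2,v2) with w_j = u_j + i v_j,
  ordered so that the real basis below is positively oriented (complex orientation).\<close>

type_synonym c2 = "complex \<times> complex"

definition coord :: "nat \<Rightarrow> c2 \<Rightarrow> complex" where
  "coord j X = (if j = 0 then fst X else snd X)"

definition rbasis :: "nat \<Rightarrow> c2" where
  "rbasis i = (if i = 0 then (1, 0) else if i = 1 then (\<i>, 0) else if i = 2 then (0, 1) else (0, \<i>))"

definition dderiv :: "(c2 \<Rightarrow> 'a::real_normed_vector) \<Rightarrow> c2 \<Rightarrow> c2 \<Rightarrow> 'a" where
  "dderiv h w v = vector_derivative (\<lambda>t. h (w + t *\<^sub>R v)) (at 0)"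

definition pw :: "(c2 \<Rightarrow> complex) \<Rightarrow> c2 \<Rightarrow> nat \<Rightarrow> complex" where
  "pw h w j = (dderiv h w (rbasis (2*j)) - \<i> * dderiv h w (rbasis (2*j+1))) / 2"

definition pwbar :: "(c2 \<Rightarrow> complex) \<Rightarrow> c2 \<Rightarrow> nat \<Rightarrow> complex" where
  "pwbar h w k = (dderiv h w (rbasis (2*k)) + \<i> * dderiv h w (rbasis (2*k+1))) / 2"

definition rho :: "(real \<Rightarrow> real \<Rightarrow> real) \<Rightarrow> c2 \<Rightarrow> real" where
  "rho g w = (cmod (snd w))\<^sup>2 + g (Re (fst w)) (Im (fst w)) - 1"

definition dom :: "(real \<Rightarrow> real \<Rightarrow> real) \<Rightarrow> c2 set" where
  "dom g = {w. rho g w < 0}"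

definition g_a :: "real \<Rightarrow> real \<Rightarrow> real" where
  "g_a u v = u\<^sup>2 + v ^ 4"

definition g_b :: "real \<Rightarrow> real \<Rightarrow> real \<Rightarrow> real" where
  "g_b m u v = \<bar>u\<bar> powr m + v\<^sup>2"

text \<open>The (1,0)-form del rho, the (1,1)-form dbar del rho, and the 3-form del rho wedge dbar del rho,
  as alternating complex-valued multilinear forms on real tangent vectors
  (determinant convention for the wedge product).\<close>
definition del_rho :: "(real \<Rightarrow> real \<Rightarrow> real) \<Rightarrow> c2 \<Rightarrow> c2 \<Rightarrow> complex" where
  "del_rho g w X = (\<Sum>j<2. pw (\<lambda>x. complex_of_real (rho g x)) w j * coord j X)"

definition ddbar_rho :: "(real \<Rightarrow> real \<Rightarrow> real) \<Rightarrow> c2 \<Rightarrow> c2 \<Rightarrow> c2 \<Rightarrow> complex" where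
  "ddbar_rho g w X Y = (\<Sum>j<2. \<Sum>k<2.
      pwbar (\<lambda>x. pw (\<lambda>y. complex_of_real (rho g y)) x j) w k *
      (cnj (coord k X) * coord j Y - cnj (coord k Y) * coord j X))"

definition CL_form :: "(real \<Rightarrow> real \<Rightarrow> real) \<Rightarrow> c2 \<Rightarrow> c2 \<Rightarrow> c2 \<Rightarrow> c2 \<Rightarrow> complex" where
  "CL_form g w X Y Z =
     del_rho g w X * ddbar_rho g w Y Z - del_rho g w Y * ddbar_rho g w X Z
     + del_rho g w Z * ddbar_rho g w X Y"

definition Delta :: "(real \<Rightarrow> real \<Rightarrow> real) \<Rightarrow> c2 \<Rightarrow> c2 \<Rightarrow> complex" where
  "Delta g w z = (\<Sum>j<2. pw (\<lambda>x. complex_of_real (rho g x)) w j * (coord j w - coord j z))"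

definition normal :: "(real \<Rightarrow> real \<Rightarrow> real) \<Rightarrow> c2 \<Rightarrow> nat \<Rightarrow> real" where
  "normal g w i = dderiv (rho g) w (rbasis i) /
      sqrt (\<Sum>l<4. (dderiv (rho g) w (rbasis l))\<^sup>2)"

text \<open>For a 3-form alpha on C^2 = R^4 and the boundary orientation (outward normal first),
  j^* alpha = (pullback_density) d sigma, where the density is
  alpha(E1,E2,E3) for a positive orthonormal frame (N,E1,E2,E3), i.e.
  sum_i (-1)^i N_i alpha(e_0,..,omit e_i,..,e_3).\<close>
definition pullback_density ::
  "(c2 \<Rightarrow> nat \<Rightarrow> real) \<Rightarrow> (c2 \<Rightarrow> c2 \<Rightarrow> c2 \<Rightarrow> c2 \<Rightarrow> complex) \<Rightarrow> c2 \<Rightarrow> complex" where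
  "pullback_density N \<alpha> w =
       of_real (N w 0) * \<alpha> w (rbasis 1) (rbasis 2) (rbasis 3)
     - of_real (N w 1) * \<alpha> w (rbasis 0) (rbasis 2) (rbasis 3)
     + of_real (N w 2) * \<alpha> w (rbasis 0) (rbasis 1) (rbasis 3)
     - of_real (N w 3) * \<alpha> w (rbasis 0) (rbasis 1) (rbasis 2)"

text \<open>Surface measure via the area formula for a parametrisation Phi : U \<subseteq> R^3 \<rightarrow> C^2
  (density sqrt(det Gram) with respect to Lebesgue measure, pushed forward by Phi).\<close>
definition ppart :: "(real \<times> real \<times> real \<Rightarrow> c2) \<Rightarrow> real \<times> real \<times> real \<Rightarrow> nat \<Rightarrow> c2" where
  "ppart \<Phi> t k = vector_derivative (\<lambda>s. \<Phi> (t + s *\<^sub>R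
      (if k = 0 then (1, 0, 0) else if k = 1 then (0, 1, 0) else (0, 0, 1)))) (at 0)"

definition gram_det :: "(real \<times> real \<times> real \<Rightarrow> c2) \<Rightarrow> real \<times> real \<times> real \<Rightarrow> real" where
  "gram_det \<Phi> t =
     (let G = (\<lambda>k l. inner (ppart \<Phi> t k) (ppart \<Phi> t l)) in
        G 0 0 * (G 1 1 * G 2 2 - G 1 2 * G 2 1)
      - G 0 1 * (G 1 0 * G 2 2 - G 1 2 * G 2 0)
      + G 0 2 * (G 1 0 * G 2 1 - G 1 1 * G 2 0))"

definition surface_measure ::
  "(real \<times> real \<times> real \<Rightarrow> c2) \<Rightarrow> (real \<times> real \<times> real) set \<Rightarrow> c2 measure" where
  "surface_measure \<Phi> U =
     distr (density (lebesgue_on U) (\<lambda>t. ennreal (sqrt (gram_det \<Phi> t)))) borel \<Phi>"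

definition bparam :: "(real \<Rightarrow> real \<Rightarrow> real) \<Rightarrow> real \<times> real \<times> real \<Rightarrow> c2" where
  "bparam g t = (case t of (u, v, \<theta>) \<Rightarrow>
      (Complex u v, complex_of_real (sqrt (1 - g u v)) * cis \<theta>))"

definition bparam_dom :: "(real \<Rightarrow> real \<Rightarrow> real) \<Rightarrow> (real \<times> real \<times> real) set" where
  "bparam_dom g = {(u, v, \<theta>). g u v \<le> 1 \<and> 0 \<le> \<theta> \<and> \<theta> < 2 * pi}"

definition sigma :: "(real \<Rightarrow> real \<Rightarrow> real) \<Rightarrow> c2 measure" where
  "sigma g = surface_measure (bparam g) (bparam_dom g)"

definition cauchy_leray :: "(real \<Rightarrow> real \<Rightarrow> real) \<Rightarrow> (c2 \<Rightarrow> complex) \<Rightarrow> c2 \<Rightarrow> complex" where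
  "cauchy_leray g f z =
     1 / (2 * pi * \<i>)\<^sup>2 *
     (\<integral> w. f w * pullback_density (normal g) (CL_form g) w / (Delta g w z)\<^sup>2 \<partial>sigma g)"

definition cauchy_leray_bv :: "(real \<Rightarrow> real \<Rightarrow> real) \<Rightarrow> (c2 \<Rightarrow> complex) \<Rightarrow> c2 \<Rightarrow> complex" where
  "cauchy_leray_bv g f w = Lim (at w within dom g) (cauchy_leray g f)"

text \<open>C^1 functions on bD: restrictions of C^1 functions on C^2 = R^4.\<close>
definition C1_fun :: "(c2 \<Rightarrow> complex) \<Rightarrow> bool" where
  "C1_fun F \<longleftrightarrow> (\<exists>F'. (\<forall>x. (F has_derivative blinfun_apply (F' x)) (at x)) \<and> continuous_on UNIV F')"

definition Lp_norm :: "'a measure \<Rightarrow> real \<Rightarrow> ('a \<Rightarrow> complex) \<Rightarrow> ennreal" where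
  "Lp_norm M p h =
     (let I = (\<integral>\<^sup>+ x. ennreal (cmod (h x) powr p) \<partial>M) in
        if I = \<infinity> then \<infinity> else ennreal (enn2real I powr (1 / p)))"

definition Linf_norm :: "'a measure \<Rightarrow> ('a \<Rightarrow> complex) \<Rightarrow> ennreal" where
  "Linf_norm M h = esssup M (\<lambda>x. ennreal (cmod (h x)))"

definition CL_conclusion :: "(real \<Rightarrow> real \<Rightarrow> real) \<Rightarrow> bool" where
  "CL_conclusion g \<longleftrightarrow>
     (\<forall>f. C1_fun f \<longrightarrow>
        (\<exists>G. continuous_on (closure (dom g)) G \<and> (\<forall>z\<in>dom g. G z = cauchy_leray g f z))) \<and>
     (\<forall>p::real. 1 \<le> p \<longrightarrow>
        \<not> (\<exists>M::real. \<forall>f. C1_fun f \<longrightarrow>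
              Lp_norm (sigma g) p (cauchy_leray_bv g f) \<le> ennreal M * Lp_norm (sigma g) p f)) \<and>
     \<not> (\<exists>M::real. \<forall>f. C1_fun f \<longrightarrow>
           Linf_norm (sigma g) (cauchy_leray_bv g f) \<le> ennreal M * Linf_norm (sigma g) f)"

end

(* In both cases D is a model domain {|z2|^2 + g(z1) < 1} with g(u + iv) = |u|^m + v^n, 3/2 < m <= 2.
   In the boundary coordinates w = (u + iv, r e^(it)), r^2 = 1 - g(w1), the Cauchy-Leray form is N(w1) du dv dt
   and Delta(w,z) = A(w1,z1) - r z2 e^(-it), so that Delta_t = i(A - Delta).

   Continuity. Integration by parts in t trades Delta^-2 for 1/(A Delta), with f - i f_t in place of f.
   For f = 1 the integral is 2 pi N/A^2 integrated over {g < 1}; since dbar((1-g)/A) = -(w1-z1)N/(2A^2), the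
   Cauchy-Pompeiu formula shows that it does not depend on z1. What remains is an integral of
   N (f(w) - f(z) - i f_t(w))/(A Delta), whose kernel has a moment of order larger than 1 bounded uniformly in z;
   this uses m > 3/2.

   Unboundedness. For u much smaller than x, Delta(w,z) is dominated by its real part if Im w2 follows the
   rotation alpha'(u) v/2 of the complex tangent space, alpha = |u|^m. Hence a smooth bump supported in a
   box near u = U, |v| < dl, |Im w2 - alpha'(u) v/2| < dl^n has boundary values of size at least c lam on a
   box of comparable measure near x = X, |y| < dl/lam, |Im z2| < dl^n, where X^m = dl^n and U = X/lam. As lam is
   arbitrary and the two measures are comparable, no L^p bound can hold. *)
theory Submission
  imports Defs "HOL-Complex_Analysis.Cauchy_Integral_Formula" "HOL-Probability.Sinc_Integral"
begin

text \<open>The threshold 3/2 is an exponent count. N has size |u|^(m-2), the subtracted numerator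
  has size sqrt|A|, and integration over the circle turns |Delta|^-1, up to an arbitrarily small
  loss, into |A|^-1. As |A| is at least a multiple of |w1-z1|, there remains |u|^(m-2)
  |w1-z1|^(-3/2). Spending order 1 of the last factor on v-y leaves |u|^(m-2) |u-x|^(-1/2), for x =
  0 a singularity of order 5/2-m, which is integrable exactly for m > 3/2. The singularities move
  with z, so there is no dominating function at hand. The gain lam is a count as well. Put D = dl^n.
  On the support N/Delta^2 has size U^(m-2)/D^2 and the support has size U dl D, so the integral has
  size U^(m-1) dl/D: the number of units D by which the tilt alpha'(U) v/2 varies over the source
  box. Over the receiving box the tilt may vary by only one unit, hence |y| < dl/lam; equal areas
  then give U = X/lam, and X^m = D = U^(m-1) dl/lam forces X = dl lam^(-m). For lam > 1 this is
  solvable because m < n; for the ball, m = n = 2, it is not.\<close>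

lemma has_real_derivative_abs_powr:
  assumes "u \<noteq> 0"
  shows "((\<lambda>x::real. \<bar>x\<bar> powr c) has_real_derivative c * sgn u * \<bar>u\<bar> powr (c - 1)) (at u)"
proof (rule has_field_derivative_transform_within)
  show "((\<lambda>x. (sgn u * x) powr c) has_real_derivative c * sgn u * \<bar>u\<bar> powr (c - 1)) (at u)"
    using assms by (auto intro!: derivative_eq_intros simp: sgn_if abs_if powr_diff)
  show "0 < \<bar>u\<bar>" using assms by simp
  fix x assume "dist x u < \<bar>u\<bar>"
  then have "sgn u * x = \<bar>x\<bar>" by (auto simp: dist_real_def sgn_if split: if_splits)
  then show "(sgn u * x) powr c = \<bar>x\<bar> powr c" by simp
qed auto

lemma DERIV_shift_0:
  fixes h :: "real \<Rightarrow> real"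
  assumes "(h has_real_derivative d) (at x)"
  shows "((\<lambda>t. h (x + t)) has_real_derivative d) (at 0)"
  using DERIV_at_within_shift[of h d x 0 UNIV] assms by (simp add: add.commute)

lemma c2_measurable [measurable]:
  "(\<lambda>w::c2. Re (fst w)) \<in> borel_measurable borel" "(\<lambda>w::c2. Im (fst w)) \<in> borel_measurable borel"
  "(\<lambda>w::c2. Re (snd w)) \<in> borel_measurable borel" "(\<lambda>w::c2. Im (snd w)) \<in> borel_measurable borel"
  "(\<lambda>w::c2. fst w) \<in> borel_measurable borel" "(\<lambda>w::c2. snd w) \<in> borel_measurable borel"
  "(\<lambda>w::c2. cnj (snd w)) \<in> borel_measurable borel" "(\<lambda>w::c2. cmod (snd w)) \<in> borel_measurable borel"
  by (auto intro!: borel_measurable_continuous_onI continuous_intros)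

subsection \<open>Model domains and the Cauchy-Leray density\<close>

text \<open>Domain (a) is the instance m = 2, n = 4 and domain (b) the instance n = 2 with 3/2 < m <
  2. The strict inequality \<open>mn\<close> excludes the ball and makes n - m invertible in the
  choice of scales.\<close>

locale egg =
  fixes m :: real and n :: nat
  assumes m: "3/2 < m" "m \<le> 2" and n: "n = 2 \<or> n = 4" and mn: "m < real n"
begin

section \<open>The profile g(u,v) = |u|^m + v^n and its derivatives\<close>

definition gg :: "real \<Rightarrow> real \<Rightarrow> real" where "gg u v = \<bar>u\<bar> powr m + v ^ n"
definition da :: "real \<Rightarrow> real" where "da u = m * sgn u * \<bar>u\<bar> powr (m - 1)"
definition db :: "real \<Rightarrow> real" where "db v = real n * v ^ (n - 1)"
text \<open>For m < 2 the second derivative of |u|^m is infinite at u = 0. There \<open>dda\<close>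
  has the value 0, since 0 powr a = 0 (also for m = 2), so statements about it either assume u
  nonzero or hold almost everywhere.\<close>

definition dda :: "real \<Rightarrow> real" where "dda u = m * (m - 1) * \<bar>u\<bar> powr (m - 2)"
definition ddb :: "real \<Rightarrow> real" where "ddb v = real n * (real n - 1) * v ^ (n - 2)"

text \<open>At 0 the difference quotient is bounded by |h|^(m-1), which tends to 0 because m >
  1.\<close>

lemma pow_m_deriv: "((\<lambda>u. \<bar>u\<bar> powr m) has_real_derivative da u) (at u)"
proof (cases "u = 0")
  case False
  then show ?thesis unfolding da_def by (rule has_real_derivative_abs_powr)
next
  case True
  have "((\<lambda>h. \<bar>h\<bar> powr (m - 1)) \<longlongrightarrow> \<bar>0::real\<bar> powr (m - 1)) (at 0)"
    using m by (intro tendsto_intros) auto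
  then have "((\<lambda>h. \<bar>h\<bar> powr (m - 1)) \<longlongrightarrow> 0) (at 0)"
    using m by simp
  then have "((\<lambda>h. \<bar>h\<bar> powr m / h) \<longlongrightarrow> 0) (at 0)"
  proof (rule Lim_null_comparison[rotated])
    show "\<forall>\<^sub>F h in at 0. norm (\<bar>h\<bar> powr m / h) \<le> \<bar>h\<bar> powr (m - 1)"
      by (rule always_eventually) (auto simp: powr_diff abs_divide)
  qed
  then show ?thesis using m True unfolding has_field_derivative_iff by (simp add: da_def)
qed

lemma da_deriv: "u \<noteq> 0 \<Longrightarrow> (da has_real_derivative dda u) (at u)"
proof -
  assume u: "u \<noteq> 0"
  have "(da has_real_derivative m * sgn u * ((m - 1) * sgn u * \<bar>u\<bar> powr (m - 1 - 1))) (at u)"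
  proof (rule has_field_derivative_transform_within)
    show "((\<lambda>x. m * sgn u * \<bar>x\<bar> powr (m - 1)) has_real_derivative
      m * sgn u * ((m - 1) * sgn u * \<bar>u\<bar> powr (m - 1 - 1))) (at u)"
      by (rule DERIV_cmult[OF has_real_derivative_abs_powr[OF u]])
    show "0 < \<bar>u\<bar>" using u by simp
    fix x assume "dist x u < \<bar>u\<bar>"
    then have "sgn x = sgn u" by (auto simp: dist_real_def sgn_if split: if_splits)
    then show "m * sgn u * \<bar>x\<bar> powr (m - 1) = da x" by (simp add: da_def)
  qed auto
  moreover have "sgn u * sgn u = 1" using u by (simp add: sgn_if)
  ultimately show ?thesis by (simp add: dda_def mult_ac)
qed

lemma db_deriv: "(db has_real_derivative ddb v) (at v)"
  unfolding db_def[abs_def] ddb_def using n by (auto intro!: derivative_eq_intros simp: diff_diff_left)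

lemma pow_n_deriv: "((\<lambda>v. v ^ n) has_real_derivative db v) (at v)"
  unfolding db_def by (auto intro!: derivative_eq_intros)

lemma cont_da: "continuous_on UNIV da"
proof -
  have "isCont da u" for u
  proof (cases "u = 0")
    case False then show ?thesis using da_deriv DERIV_isCont by blast
  next
    case True
    have "((\<lambda>h. m * \<bar>h\<bar> powr (m - 1)) \<longlongrightarrow> m * \<bar>0::real\<bar> powr (m - 1)) (at 0)"
      using m by (intro tendsto_intros) auto
    then have "((\<lambda>h. m * \<bar>h\<bar> powr (m - 1)) \<longlongrightarrow> 0) (at 0)" using m by simp
    then have "(da \<longlongrightarrow> 0) (at 0)"
      by (rule Lim_null_comparison[rotated])
        (use m in \<open>auto intro!: always_eventually simp: da_def abs_mult abs_sgn_eq\<close>)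
    then show ?thesis using True by (simp add: isCont_def da_def)
  qed
  then show ?thesis by (simp add: continuous_at_imp_continuous_on)
qed

lemma cont_gg: "continuous_on UNIV (\<lambda>p. gg (fst p) (snd p))"
  unfolding gg_def using m by (intro continuous_intros continuous_on_powr') auto

lemma cont_db: "continuous_on UNIV db" unfolding db_def[abs_def] by (intro continuous_intros)

lemma measurable_facts [measurable]:
  "da \<in> borel_measurable borel" "db \<in> borel_measurable borel" "dda \<in> borel_measurable borel"
  "ddb \<in> borel_measurable borel"
  using cont_da cont_db by (auto intro: borel_measurable_continuous_onI simp: dda_def[abs_def] ddb_def[abs_def])

lemma measurable_gg [measurable (raw)]:
  assumes [measurable]: "f \<in> borel_measurable M" "h \<in> borel_measurable M"
  shows "(\<lambda>x. gg (f x) (h x)) \<in> borel_measurable M"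
  unfolding gg_def by measurable

section \<open>First derivatives of rho and the Cauchy-Leray form\<close>

definition p0 :: "c2 \<Rightarrow> complex" where
  "p0 w = (of_real (da (Re (fst w))) - \<i> * of_real (db (Im (fst w)))) / 2"

lemma dderivI: "((\<lambda>t. h (w + t *\<^sub>R v)) has_vector_derivative d) (at 0) \<Longrightarrow> dderiv h w v = d"
  unfolding dderiv_def by (rule vector_derivative_at)

lemma rho_line:
  "((\<lambda>t. rho gg (w + t *\<^sub>R rbasis 0)) has_real_derivative da (Re (fst w))) (at 0)"
  "((\<lambda>t. rho gg (w + t *\<^sub>R rbasis 1)) has_real_derivative db (Im (fst w))) (at 0)"
  "((\<lambda>t. rho gg (w + t *\<^sub>R rbasis 2)) has_real_derivative 2 * Re (snd w)) (at 0)"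
  "((\<lambda>t. rho gg (w + t *\<^sub>R rbasis 3)) has_real_derivative 2 * Im (snd w)) (at 0)"
proof -
  show "((\<lambda>t. rho gg (w + t *\<^sub>R rbasis 0)) has_real_derivative da (Re (fst w))) (at 0)"
    using DERIV_add[OF DERIV_shift_0[OF pow_m_deriv] DERIV_const, of "Re (fst w)" "(cmod (snd w))\<^sup>2 + Im (fst w) ^ n - 1"]
    by (simp add: rho_def rbasis_def gg_def algebra_simps)
  show "((\<lambda>t. rho gg (w + t *\<^sub>R rbasis 1)) has_real_derivative db (Im (fst w))) (at 0)"
    using DERIV_add[OF DERIV_shift_0[OF pow_n_deriv] DERIV_const, of "Im (fst w)" "(cmod (snd w))\<^sup>2 + \<bar>Re (fst w)\<bar> powr m - 1"]
    by (simp add: rho_def rbasis_def gg_def algebra_simps)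
  show "((\<lambda>t. rho gg (w + t *\<^sub>R rbasis 2)) has_real_derivative 2 * Re (snd w)) (at 0)"
    unfolding rho_def cmod_power2 by (auto simp: rbasis_def intro!: derivative_eq_intros)
  show "((\<lambda>t. rho gg (w + t *\<^sub>R rbasis 3)) has_real_derivative 2 * Im (snd w)) (at 0)"
    unfolding rho_def cmod_power2 by (auto simp: rbasis_def intro!: derivative_eq_intros)
qed

lemma dderiv_rho:
  "dderiv (rho gg) w (rbasis 0) = da (Re (fst w))" "dderiv (rho gg) w (rbasis 1) = db (Im (fst w))"
  "dderiv (rho gg) w (rbasis 2) = 2 * Re (snd w)" "dderiv (rho gg) w (rbasis 3) = 2 * Im (snd w)"
  using rho_line[of w] by (auto intro!: dderivI simp: has_real_derivative_iff_has_vector_derivative)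

lemma dderiv_crho:
  "dderiv (\<lambda>x. complex_of_real (rho gg x)) w (rbasis 0) = da (Re (fst w))"
  "dderiv (\<lambda>x. complex_of_real (rho gg x)) w (rbasis 1) = db (Im (fst w))"
  "dderiv (\<lambda>x. complex_of_real (rho gg x)) w (rbasis 2) = 2 * Re (snd w)"
  "dderiv (\<lambda>x. complex_of_real (rho gg x)) w (rbasis 3) = 2 * Im (snd w)"
  by (rule dderivI, use has_vector_derivative_of_real[OF rho_line(1)[of w]] in simp)
     (rule dderivI, use has_vector_derivative_of_real[OF rho_line(2)[of w]] in simp,
      rule dderivI, use has_vector_derivative_of_real[OF rho_line(3)[of w]] in simp,
      rule dderivI, use has_vector_derivative_of_real[OF rho_line(4)[of w]] in simp)

lemma pw_rho: "pw (\<lambda>x. complex_of_real (rho gg x)) w 0 = p0 w"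
   "pw (\<lambda>x. complex_of_real (rho gg x)) w 1 = cnj (snd w)"
   "pw (\<lambda>x. complex_of_real (rho gg x)) w (Suc 0) = cnj (snd w)"
  using dderiv_crho[of w] by (auto simp: pw_def p0_def complex_eq_iff numeral_3_eq_3 numeral_2_eq_2)

definition Lap :: "c2 \<Rightarrow> complex" where
  "Lap w = pwbar p0 w 0"

lemma pwbar_cnj: "pwbar (\<lambda>x. cnj (snd x)) w 0 = 0" "pwbar (\<lambda>x. cnj (snd x)) w (Suc 0) = 1" "pwbar p0 w (Suc 0) = 0"
proof -
  have [simp]: "dderiv (\<lambda>x. cnj (snd x)) w (rbasis 0) = 0" "dderiv (\<lambda>x. cnj (snd x)) w (rbasis 1) = 0"
     "dderiv (\<lambda>x. cnj (snd x)) w (rbasis (Suc 0)) = 0"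
     "dderiv (\<lambda>x. cnj (snd x)) w (rbasis 2) = 1" "dderiv (\<lambda>x. cnj (snd x)) w (rbasis 3) = - \<i>"
     "dderiv p0 w (rbasis 2) = 0" "dderiv p0 w (rbasis 3) = 0"
    by (rule dderivI; auto simp: rbasis_def p0_def scaleR_conv_of_real intro!: derivative_eq_intros)+
  show "pwbar (\<lambda>x. cnj (snd x)) w 0 = 0" "pwbar (\<lambda>x. cnj (snd x)) w (Suc 0) = 1" "pwbar p0 w (Suc 0) = 0"
    by (auto simp: pwbar_def)
qed

text \<open>Differentiability of h is not assumed: h and h + c have the same derivatives, so the
  choice made by \<open>vector_derivative\<close> agrees even where there is none. This covers
  \<open>da\<close> at u = 0.\<close>

lemma vector_derivative_add_const: "vector_derivative (\<lambda>t. h t + c) F = vector_derivative h F"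
  by (simp add: vector_derivative_def has_vector_derivative_def has_derivative_def)

text \<open>A quarter of the Laplacian of g. On u = 0 the derivative of \<open>da\<close> may fail
  to exist, but whatever value \<open>vector_derivative\<close> takes there is one constant
  independent of w, which is enough for measurability.\<close>

lemma Lap_eq: "Lap w = ((if Re (fst w) = 0 then 2 * vector_derivative (\<lambda>t. complex_of_real (da t) / 2) (at 0)
     else complex_of_real (dda (Re (fst w)))) + ddb (Im (fst w))) / 4"
proof -
  let ?u = "Re (fst w)" and ?v = "Im (fst w)"
  have "((\<lambda>t. db (?v + t)) has_real_derivative ddb ?v) (at 0)"
    by (rule DERIV_shift_0[OF db_deriv])
  then have v: "((\<lambda>t. complex_of_real (db (?v + t))) has_vector_derivative ddb ?v) (at 0)"
    by (intro has_vector_derivative_of_real)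
  have 1: "dderiv p0 w (rbasis 1) = - \<i> * ddb ?v / 2"
    by (rule dderivI) (auto simp: p0_def rbasis_def intro!: derivative_eq_intros v DERIV_shift_0[OF db_deriv])
  have 0: "dderiv p0 w (rbasis 0) = vector_derivative (\<lambda>t. complex_of_real (da (?u + t)) / 2) (at 0)"
    using vector_derivative_add_const[of "\<lambda>t. complex_of_real (da (?u + t)) / 2" "- \<i> * of_real (db ?v) / 2" "at 0"]
    by (simp add: dderiv_def p0_def rbasis_def diff_divide_distrib)
  have 2: "vector_derivative (\<lambda>t. complex_of_real (da (?u + t)) / 2) (at 0) = dda ?u / 2" if "?u \<noteq> 0"
  proof -
    have "((\<lambda>t. da (?u + t)) has_real_derivative dda ?u) (at 0)"
      by (rule DERIV_shift_0[OF da_deriv[OF that]])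
    then have "((\<lambda>t. complex_of_real (da (?u + t))) has_vector_derivative dda ?u) (at 0)"
      by (intro has_vector_derivative_of_real)
    then show ?thesis by (intro vector_derivative_at) (auto intro!: derivative_eq_intros DERIV_shift_0[OF da_deriv[OF that]])
  qed
  have "Lap w = (vector_derivative (\<lambda>t. complex_of_real (da (?u + t)) / 2) (at 0) + ddb ?v / 2) / 2"
    using 0 1 by (simp add: Lap_def pwbar_def)
  then show ?thesis using 2 by (cases "?u = 0") (simp_all add: add_divide_distrib)
qed

lemma Lap_measurable [measurable]: "Lap \<in> borel_measurable borel"
  unfolding Lap_eq[abs_def] by measurable

lemma Delta_eq: "Delta gg w z = p0 w * (fst w - fst z) + cnj (snd w) * (snd w - snd z)"
  by (simp add: Delta_def pw_rho numeral_2_eq_2 coord_def)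

definition gradn :: "c2 \<Rightarrow> real" where
  "gradn w = sqrt ((da (Re (fst w)))\<^sup>2 + (db (Im (fst w)))\<^sup>2 + (2 * Re (snd w))\<^sup>2 + (2 * Im (snd w))\<^sup>2)"

text \<open>The numerator is four times the Levi form of rho at the complex tangent vector (rho_2,
  -rho_1), that is |rho_1|^2 + |w_2|^2 \<open>Lap\<close>. There is no mixed term because rho is a
  sum of a function of w_1 and a function of w_2.\<close>

lemma pullback_eq: "pullback_density (normal gg) (CL_form gg) w =
   - (of_real ((da (Re (fst w)))\<^sup>2 + (db (Im (fst w)))\<^sup>2) + 4 * of_real ((cmod (snd w))\<^sup>2) * Lap w) / of_real (gradn w)"
proof -
  have four: "(\<Sum>l<4. f l) = f 0 + f (Suc 0) + f 2 + f (3::nat)" for f :: "nat \<Rightarrow> real"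
    by (simp add: numeral_eq_Suc)
  have nrm: "normal gg w 0 = da (Re (fst w)) / gradn w" "normal gg w 1 = db (Im (fst w)) / gradn w"
    "normal gg w 2 = 2 * Re (snd w) / gradn w" "normal gg w 3 = 2 * Im (snd w) / gradn w"
    using dderiv_rho[of w] by (auto simp: normal_def gradn_def four)
  have del: "del_rho gg w X = p0 w * fst X + cnj (snd w) * snd X" for X
    by (simp add: del_rho_def pw_rho numeral_2_eq_2 coord_def)
  have ddb: "ddbar_rho gg w X Y = Lap w * (cnj (fst X) * fst Y - cnj (fst Y) * fst X)
      + (cnj (snd X) * snd Y - cnj (snd Y) * snd X)" for X Y
    by (simp add: ddbar_rho_def pw_rho numeral_2_eq_2 coord_def pwbar_cnj Lap_def)
  have c: "CL_form gg w (rbasis 1) (rbasis 2) (rbasis 3) = - 2 * p0 w"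
     "CL_form gg w (rbasis 0) (rbasis 2) (rbasis 3) = 2 * \<i> * p0 w"
     "CL_form gg w (rbasis 0) (rbasis 1) (rbasis 3) = - 2 * cnj (snd w) * Lap w"
     "CL_form gg w (rbasis 0) (rbasis 1) (rbasis 2) = 2 * \<i> * cnj (snd w) * Lap w"
    by (simp_all add: CL_form_def del ddb rbasis_def algebra_simps)
  show ?thesis
    unfolding pullback_density_def nrm c cmod_power2
    by (cases "gradn w = 0") (simp_all add: p0_def complex_eq_iff power2_eq_square field_simps)
qed

lemma pullback_measurable [measurable]: "pullback_density (normal gg) (CL_form gg) \<in> borel_measurable borel"
  unfolding pullback_eq[abs_def] gradn_def by measurable

lemma Delta_measurable [measurable]: "(\<lambda>w. Delta gg w z) \<in> borel_measurable borel"
  unfolding Delta_eq p0_def by measurable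

end

text \<open>\<open>bparam\<close> takes its arguments as (u, (v, theta)), whereas Fubini is applied
  in the grouping ((u, v), theta), with the circle as the inner integral.\<close>

lemma lborel_assoc:
  "distr lborel borel (\<lambda>(u, v, \<theta>). ((u, v), \<theta>)) = (lborel :: ((real \<times> real) \<times> real) measure)" (is "?D = _")
proof (rule lborel_eqI[symmetric])
  have meas: "(\<lambda>(u, v, \<theta>). ((u::real, v::real), \<theta>::real)) \<in> borel_measurable borel"
    by (intro borel_measurable_continuous_onI) (auto simp: case_prod_beta intro!: continuous_intros)
  fix l u :: "(real \<times> real) \<times> real"
  assume le: "\<And>b. b \<in> Basis \<Longrightarrow> l \<bullet> b \<le> u \<bullet> b"
  obtain l1 l2 l3 where l: "l = ((l1, l2), l3)" by (metis surj_pair)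
  obtain u1 u2 u3 where u: "u = ((u1, u2), u3)" by (metis surj_pair)
  have le': "l1 \<le> u1" "l2 \<le> u2" "l3 \<le> u3"
    using le[of "((1, 0), 0)"] le[of "((0, 1), 0)"] le[of "((0, 0), 1)"] by (auto simp: l u Basis_prod_def zero_prod_def)
  have "(\<lambda>(u, v, \<theta>). ((u, v), \<theta>)) -` box l u \<inter> space lborel = box (l1, l2, l3) (u1, u2, u3)"
    by (auto simp: l u box_def Basis_prod_def)
  then have "emeasure ?D (box l u) = emeasure lborel (box (l1, l2, l3) (u1, u2, u3))"
    using meas by (subst emeasure_distr) auto
  also have "\<dots> = ennreal ((u3 - l3) * ((u2 - l2) * (u1 - l1)))"
    using le' by (subst emeasure_lborel_box) (auto simp: Basis_prod_def prod.union_disjoint prod.reindex inj_on_def ac_simps)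
  also have "\<dots> = (\<Prod>b\<in>Basis. (u - l) \<bullet> b)"
    by (auto simp: l u Basis_prod_def prod.union_disjoint prod.reindex inj_on_def)
  finally show "emeasure ?D (box l u) = (\<Prod>b\<in>Basis. (u - l) \<bullet> b)" .
qed simp

context egg
begin

section \<open>The surface measure in the coordinates u, v, theta\<close>

definition Phi :: "(real \<times> real) \<times> real \<Rightarrow> c2" where
  "Phi x = bparam gg (fst (fst x), snd (fst x), snd x)"
definition gp :: "real \<times> real \<Rightarrow> real" where "gp p = gg (fst p) (snd p)"
definition grd :: "real \<times> real \<Rightarrow> real" where "grd p = (da (fst p))\<^sup>2 + (db (snd p))\<^sup>2"
text \<open>The area factor of the parametrisation. It is half the length of the gradient of rho at
  the boundary point over p.\<close>

definition jac :: "real \<times> real \<Rightarrow> real" where "jac p = sqrt (1 - gp p + grd p / 4)"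
text \<open>Strict inequality, unlike in \<open>bparam_dom\<close>: the degenerate circles over g =
  1, where the radius is 0, are left out. They form a null set by
  \<open>gg_level_null\<close>.\<close>

definition Om :: "((real \<times> real) \<times> real) set" where
  "Om = {x. gp (fst x) < 1 \<and> 0 \<le> snd x \<and> snd x < 2 * pi}"

lemma gp_measurable [measurable]: "gp \<in> borel_measurable borel"
  unfolding gp_def[abs_def] by (rule borel_measurable_continuous_onI[OF cont_gg])

lemma grd_measurable [measurable]: "grd \<in> borel_measurable borel"
  unfolding grd_def[abs_def] borel_prod[symmetric] by measurable

lemma jac_measurable [measurable]: "jac \<in> borel_measurable borel"
  unfolding jac_def[abs_def] by measurable

lemma Om_measurable [measurable]: "Om \<in> sets borel"
proof -
  have "Measurable.pred (borel \<Otimes>\<^sub>M borel) (\<lambda>x. gp (fst x) < 1 \<and> 0 \<le> snd x \<and> snd x < 2 * pi)" by measurable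
  then show ?thesis unfolding Om_def borel_prod[symmetric] by (simp add: pred_def space_pair_measure)
qed

lemma cont_bparam: "continuous_on UNIV (bparam gg)"
proof -
  have 1: "continuous_on UNIV (\<lambda>t::real\<times>real\<times>real. gg (fst t) (fst (snd t)))"
  proof -
    have "continuous_on UNIV (\<lambda>t::real\<times>real\<times>real. (fst t, fst (snd t)))" by (intro continuous_intros)
    from continuous_on_compose2[OF cont_gg this] show ?thesis by simp
  qed
  show ?thesis unfolding bparam_def case_prod_beta
    by (intro continuous_intros 1)
qed

lemma cont_Phi: "continuous_on UNIV Phi"
  unfolding Phi_def[abs_def] by (rule continuous_on_compose2[OF cont_bparam]) (auto intro!: continuous_intros)

lemma Phi_measurable [measurable]: "Phi \<in> borel_measurable borel"
  by (rule borel_measurable_continuous_onI[OF cont_Phi])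

text \<open>For fixed u at most two values of v lie on the level set; Fubini in theta and then in u
  finishes.\<close>

lemma gg_level_null: "AE t in (lborel :: (real \<times> real \<times> real) measure). gg (fst t) (fst (snd t)) \<noteq> 1"
proof -
  have v0: "AE v in lborel. gg u v \<noteq> 1" for u
  proof -
    have "{v. gg u v = 1} \<subseteq> {root n (1 - \<bar>u\<bar> powr m), - root n (1 - \<bar>u\<bar> powr m)}"
    proof
      fix v assume "v \<in> {v. gg u v = 1}"
      then have "\<bar>v\<bar> ^ n = 1 - \<bar>u\<bar> powr m" using n by (auto simp: gg_def)
      then have "\<bar>v\<bar> = root n (1 - \<bar>u\<bar> powr m)" using n by (metis abs_ge_zero real_root_power_cancel zero_less_numeral)
      then show "v \<in> {root n (1 - \<bar>u\<bar> powr m), - root n (1 - \<bar>u\<bar> powr m)}" by auto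
    qed
    then have "{v. gg u v = 1} \<in> null_sets lborel"
      by (rule finite_imp_null_set_lborel[OF finite_subset]) auto
    from AE_not_in[OF this] show ?thesis by simp
  qed
  have ms: "{x. gg (fst x) (fst (snd x)) \<noteq> 1} \<in> sets (borel :: (real \<times> real \<times> real) measure)"
  proof -
    have "Measurable.pred (borel \<Otimes>\<^sub>M (borel \<Otimes>\<^sub>M borel)) (\<lambda>x. gg (fst x) (fst (snd x)) \<noteq> 1)" by measurable
    then show ?thesis unfolding borel_prod[symmetric] by (simp add: pred_def space_pair_measure)
  qed
  have ms2: "{x. gg u (fst x) \<noteq> 1} \<in> sets (borel :: (real \<times> real) measure)" for u
  proof -
    have "Measurable.pred (borel \<Otimes>\<^sub>M borel) (\<lambda>x. gg u (fst x) \<noteq> 1)" by measurable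
    then show ?thesis unfolding borel_prod[symmetric] by (simp add: pred_def space_pair_measure)
  qed
  have "AE p in lborel \<Otimes>\<^sub>M (lborel :: real measure). gg u (fst p) \<noteq> 1" for u
    
    by (rule lborel_pair.AE_pair_measure) (unfold lborel_prod, use ms2[of u] v0[of u] in auto)
  note u0 = this
  have "AE t in lborel \<Otimes>\<^sub>M (lborel :: (real \<times> real) measure). gg (fst t) (fst (snd t)) \<noteq> 1"
    
    by (rule lborel_pair.AE_pair_measure) (unfold lborel_prod, use ms u0[unfolded lborel_prod] in auto)
  then show ?thesis unfolding lborel_prod .
qed

text \<open>The circle direction is orthogonal to the other two tangent vectors, and these form the
  frame of a graph with radial slopes -da/(2r) and -db/(2r). Hence the Gram determinant is r^2 (1 +
  a^2 + b^2) with a and b these slopes.\<close>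

lemma gram_det_eq:
  assumes "gg u v < 1"
  shows "gram_det (bparam gg) (u, v, \<theta>) = (jac (u, v))\<^sup>2"
proof -
  define r where "r = sqrt (1 - gg u v)"
  have r: "r > 0" "r\<^sup>2 = 1 - gg u v" using assms by (auto simp: r_def)
  have sq: "((\<lambda>t. sqrt (h t)) has_real_derivative d / (2 * sqrt (h 0))) (at 0)"
    if "(h has_real_derivative d) (at 0)" "h 0 > 0" for h d
    using DERIV_chain2[OF DERIV_real_sqrt that(1)] that(2) by (simp add: field_simps)
  have du: "((\<lambda>t. sqrt (1 - gg (u + t) v)) has_real_derivative - da u / (2 * r)) (at 0)"
    using sq[OF DERIV_diff[OF DERIV_const DERIV_add[OF DERIV_shift_0[OF pow_m_deriv[of u]] DERIV_const[of "v ^ n"]], of 1]] assms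
    by (simp add: gg_def r_def)
  have dv: "((\<lambda>t. sqrt (1 - gg u (v + t))) has_real_derivative - db v / (2 * r)) (at 0)"
    using sq[OF DERIV_diff[OF DERIV_const DERIV_add[OF DERIV_const[of "\<bar>u\<bar> powr m"] DERIV_shift_0[OF pow_n_deriv[of v]]], of 1]] assms
    by (simp add: gg_def r_def)
  have scale: "((\<lambda>t. complex_of_real (f t) * c) has_vector_derivative of_real d * c) (at 0)"
    if "(f has_real_derivative d) (at 0)" for f d c
    using has_vector_derivative_mult_left[OF has_vector_derivative_of_real[OF that]] .
  have id: "((\<lambda>t. complex_of_real t) has_vector_derivative 1) (at 0)"
    using scale[of "\<lambda>t. t" 1 1] by simp
  have lin: "((\<lambda>t. c + complex_of_real t * d) has_vector_derivative d) (at 0)" for c d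
    using has_vector_derivative_add[OF has_vector_derivative_const has_vector_derivative_mult_left[OF id]] by simp
  have cis': "((\<lambda>t. cis (\<theta> + t)) has_vector_derivative \<i> * cis \<theta>) (at 0)"
    unfolding has_vector_derivative_def
    by (rule has_derivative_eq_rhs[OF has_derivative_cis[of _ "\<lambda>t. t"]]) (auto intro!: derivative_eq_intros)
  have p0: "ppart (bparam gg) (u, v, \<theta>) 0 = (1, of_real (- da u / (2 * r)) * cis \<theta>)"
    unfolding ppart_def
    by (rule vector_derivative_at)
      (use has_vector_derivative_Pair[OF lin[of "Complex u v" 1] scale[OF du, of "cis \<theta>"]] in
        \<open>simp add: bparam_def Complex_eq algebra_simps\<close>)
  have p1: "ppart (bparam gg) (u, v, \<theta>) 1 = (\<i>, of_real (- db v / (2 * r)) * cis \<theta>)"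
    unfolding ppart_def
    by (rule vector_derivative_at)
      (use has_vector_derivative_Pair[OF lin[of "Complex u v" \<i>] scale[OF dv, of "cis \<theta>"]] in
        \<open>simp add: bparam_def Complex_eq algebra_simps\<close>)
  have p2: "ppart (bparam gg) (u, v, \<theta>) 2 = (0, of_real r * (\<i> * cis \<theta>))"
    unfolding ppart_def
    by (rule vector_derivative_at)
      (use has_vector_derivative_Pair[OF has_vector_derivative_const[of "Complex u v"] has_vector_derivative_mult_right[OF cis', of "of_real r"]] in
        \<open>simp add: bparam_def r_def\<close>)
  have cis_inner: "inner (complex_of_real a * cis \<theta>) (of_real b * cis \<theta>) = a * b"
    "inner (complex_of_real a * cis \<theta>) (of_real b * (\<i> * cis \<theta>)) = 0"
    "inner (complex_of_real b * (\<i> * cis \<theta>)) (of_real a * cis \<theta>) = 0"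
    "inner (complex_of_real a * (\<i> * cis \<theta>)) (of_real b * (\<i> * cis \<theta>)) = a * b" for a b
  proof -
    have "a * cos \<theta> * (b * cos \<theta>) + a * sin \<theta> * (b * sin \<theta>) = a * b * ((cos \<theta>)\<^sup>2 + (sin \<theta>)\<^sup>2)"
      by (simp only: power2_eq_square) algebra
    then have *: "a * cos \<theta> * (b * cos \<theta>) + a * sin \<theta> * (b * sin \<theta>) = a * b" by simp
    show "inner (complex_of_real a * cis \<theta>) (of_real b * cis \<theta>) = a * b"
      "inner (complex_of_real a * (\<i> * cis \<theta>)) (of_real b * (\<i> * cis \<theta>)) = a * b"
      using * by (simp_all add: inner_complex_def)
    show "inner (complex_of_real a * cis \<theta>) (of_real b * (\<i> * cis \<theta>)) = 0"
    "inner (complex_of_real b * (\<i> * cis \<theta>)) (of_real a * cis \<theta>) = 0"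
      by (simp_all add: inner_complex_def)
  qed
  have one: "inner (1::complex) \<i> = 0" "inner \<i> (1::complex) = 0" "inner \<i> \<i> = 1"
    by (auto simp: inner_complex_def)
  have "gram_det (bparam gg) (u, v, \<theta>) = r\<^sup>2 * (1 + (da u / (2*r))\<^sup>2 + (db v / (2*r))\<^sup>2)"
  proof -
    have "gram_det (bparam gg) (u, v, \<theta>) = r\<^sup>2 * (1 + a\<^sup>2 + b\<^sup>2)"
      if "a = - da u / (2 * r)" "b = - db v / (2 * r)" for a b
      unfolding gram_det_def Let_def p0[folded that] p1[folded that] p2 inner_prod_def fst_conv snd_conv cis_inner one
      by (simp add: power2_eq_square algebra_simps)
    from this[OF refl refl] show ?thesis by simp
  qed
  also have "\<dots> = r\<^sup>2 + (da u)\<^sup>2 / 4 + (db v)\<^sup>2 / 4"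
    using r(1) by (simp add: field_simps)
  finally show ?thesis
    using r assms by (simp add: jac_def gp_def grd_def add_divide_distrib)
qed

lemma sigma_eq: "sigma gg = distr (density lborel (\<lambda>x. ennreal (indicator Om x * jac (fst x)))) borel Phi"
  (is "_ = ?R")
proof (rule measure_eqI)
  show "sets (sigma gg) = sets ?R" by (simp add: sigma_def surface_measure_def)
  fix B assume "B \<in> sets (sigma gg)"
  then have B [measurable]: "B \<in> sets borel" by (simp add: sigma_def surface_measure_def)
  let ?U = "bparam_dom gg" and ?J = "\<lambda>t. sqrt (gram_det (bparam gg) t)"
  let ?q = "\<lambda>(u, v, \<theta>). ((u::real, v::real), \<theta>::real)"
  have q [measurable]: "?q \<in> borel_measurable borel"
    by (intro borel_measurable_continuous_onI) (auto simp: case_prod_beta intro!: continuous_intros)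
  have bp [measurable]: "bparam gg \<in> borel_measurable borel"
    by (rule borel_measurable_continuous_onI[OF cont_bparam])
  have U [measurable]: "?U \<in> sets borel"
  proof -
    have "Measurable.pred (borel \<Otimes>\<^sub>M (borel \<Otimes>\<^sub>M borel)) (\<lambda>x. gg (fst x) (fst (snd x)) \<le> 1 \<and> 0 \<le> snd (snd x) \<and> snd (snd x) < 2 * pi)"
      by measurable
    moreover have "?U = {x. gg (fst x) (fst (snd x)) \<le> 1 \<and> 0 \<le> snd (snd x) \<and> snd (snd x) < 2 * pi}"
      by (auto simp: bparam_dom_def)
    ultimately show ?thesis unfolding borel_prod[symmetric] by (simp add: pred_def space_pair_measure)
  qed
  have U': "?U \<in> sets lebesgue" using U by auto
  let ?h = "\<lambda>x. indicator Om x * jac (fst x)"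
  have hm [measurable]: "?h \<in> borel_measurable borel"
  proof -
    have [measurable]: "Om \<in> sets (borel \<Otimes>\<^sub>M borel)" unfolding borel_prod by (rule Om_measurable)
    have "?h \<in> borel_measurable (borel \<Otimes>\<^sub>M borel)" by measurable
    then show ?thesis unfolding borel_prod .
  qed
  \<comment> \<open>At g = 1 the derivatives of the square root in \<open>bparam\<close> are not
    controlled, so the two densities are compared off this null set. Measurability of the original
    density is then inherited from the Borel one through the completion.\<close>
  have ae: "AE t in lebesgue. ?h (?q t) = indicator ?U t * ?J t"
  proof (rule AE_completion, use gg_level_null in eventually_elim)
    case (elim t)
    obtain u v \<theta> where t: "t = (u, v, \<theta>)" by (metis surj_pair)
    show ?case
    proof (cases "t \<in> ?U")
      case True
      then have "gg u v < 1" using elim by (auto simp: t bparam_dom_def)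
      then show ?thesis using True gram_det_eq[of u v \<theta>] 
        by (auto simp: t Om_def bparam_dom_def gp_def jac_def grd_def)
    qed (auto simp: t Om_def bparam_dom_def gp_def)
  qed
  have "(\<lambda>t. indicator ?U t * ?J t) \<in> borel_measurable lebesgue"
    by (rule borel_measurable_AE[OF _ ae], rule measurable_completion) measurable
  then have "(\<lambda>t. indicator ?U t * ?J t) \<in> borel_measurable (lebesgue_on ?U)"
    by (rule measurable_restrict_space1)
  then have J [measurable]: "?J \<in> borel_measurable (lebesgue_on ?U)"
    by (subst measurable_cong[where g="\<lambda>t. indicator ?U t * ?J t"]) auto
  have bp' [measurable]: "bparam gg \<in> lebesgue_on ?U \<rightarrow>\<^sub>M borel"
    by (intro measurable_restrict_space1 measurable_completion) measurable
  have "emeasure (sigma gg) B = emeasure (density (lebesgue_on ?U) (\<lambda>t. ennreal (?J t))) (bparam gg -` B \<inter> space (lebesgue_on ?U))"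
    unfolding sigma_def surface_measure_def by (subst emeasure_distr) auto
  also have "\<dots> = (\<integral>\<^sup>+ t. ennreal (?J t) * indicator (bparam gg -` B \<inter> space (lebesgue_on ?U)) t \<partial>lebesgue_on ?U)"
    by (rule emeasure_density) (use measurable_sets[OF bp' B] in \<open>simp_all\<close>)
  also have "\<dots> = (\<integral>\<^sup>+ t. ennreal (?J t) * indicator B (bparam gg t) \<partial>lebesgue_on ?U)"
    by (rule nn_integral_cong) (auto split: split_indicator)
  also have "\<dots> = (\<integral>\<^sup>+ t. ennreal (?J t) * indicator B (bparam gg t) * indicator ?U t \<partial>lebesgue)"
    by (rule nn_integral_restrict_space) (use U' in auto)
  also have "\<dots> = (\<integral>\<^sup>+ t. ennreal (?h (?q t)) * indicator B (Phi (?q t)) \<partial>lebesgue)"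
    by (rule nn_integral_cong_AE, use ae in eventually_elim) (auto simp: Phi_def split: split_indicator)
  also have "\<dots> = (\<integral>\<^sup>+ t. ennreal (?h (?q t)) * indicator B (Phi (?q t)) \<partial>lborel)"
    by (rule nn_integral_completion)
  also have "\<dots> = (\<integral>\<^sup>+ x. ennreal (?h x) * indicator B (Phi x) \<partial>distr lborel borel ?q)"
    by (subst nn_integral_distr) (auto intro!: borel_measurable_times_ennreal)
  also have "\<dots> = (\<integral>\<^sup>+ x. ennreal (?h x) * indicator (Phi -` B) x \<partial>lborel)"
    unfolding lborel_assoc by (auto intro!: nn_integral_cong split: split_indicator)
  also have "\<dots> = emeasure ?R B"
    by (subst emeasure_distr) (auto simp: emeasure_density measurable_sets_borel[OF Phi_measurable B])
  finally show "emeasure (sigma gg) B = emeasure ?R B" .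
qed

lemma Om_indicator_measurable [measurable]: "(\<lambda>x. indicator Om x :: real) \<in> borel_measurable borel"
  by measurable

lemma jac_fst_measurable [measurable]: "(\<lambda>x :: (real \<times> real) \<times> real. jac (fst x)) \<in> borel_measurable borel"
proof -
  have "(\<lambda>x. jac (fst x)) \<in> borel_measurable (borel \<Otimes>\<^sub>M (borel :: real measure))" by measurable
  then show ?thesis unfolding borel_prod .
qed

lemma jac_nonneg: "x \<in> Om \<Longrightarrow> 0 \<le> jac (fst x)"
  by (auto simp: jac_def Om_def grd_def)

lemma nn_integral_sigma:
  assumes [measurable]: "F \<in> borel_measurable borel"
  shows "(\<integral>\<^sup>+ w. F w \<partial>sigma gg) = (\<integral>\<^sup>+ x. ennreal (indicator Om x * jac (fst x)) * F (Phi x) \<partial>lborel)"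
  unfolding sigma_eq by (subst nn_integral_distr) (auto simp: nn_integral_density)

lemma integral_sigma:
  fixes F :: "c2 \<Rightarrow> complex"
  assumes [measurable]: "F \<in> borel_measurable borel"
  shows "(\<integral> w. F w \<partial>sigma gg) = (\<integral> x. (indicator Om x * jac (fst x)) *\<^sub>R F (Phi x) \<partial>lborel)"
proof -
  have "(\<integral> w. F w \<partial>sigma gg) = (\<integral> x. F (Phi x) \<partial>density lborel (\<lambda>x. ennreal (indicator Om x * jac (fst x))))"
    unfolding sigma_eq by (subst integral_distr) auto
  also have "\<dots> = (\<integral> x. (indicator Om x * jac (fst x)) *\<^sub>R F (Phi x) \<partial>lborel)"
    by (subst integral_density) (auto intro!: AE_I2 jac_nonneg split: split_indicator)
  finally show ?thesis .
qed

text \<open>Minus the product of the pullback density and \<open>jac\<close>: twice the Levi form of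
  \<open>pullback_eq\<close>, with |w_2|^2 = 1 - g and the Laplacian written out.\<close>

definition NN :: "real \<times> real \<Rightarrow> real" where
  "NN p = grd p / 2 + (1 - gp p) * (dda (fst p) + ddb (snd p)) / 2"

lemma NN_measurable [measurable]: "NN \<in> borel_measurable borel"
proof -
  have "(\<lambda>p. dda (fst p) + ddb (snd p)) \<in> borel_measurable (borel \<Otimes>\<^sub>M borel)" by measurable
  then have [measurable]: "(\<lambda>p. dda (fst p) + ddb (snd p)) \<in> borel_measurable borel" unfolding borel_prod .
  show ?thesis unfolding NN_def[abs_def] by measurable
qed

lemma NN_fst_measurable [measurable]: "(\<lambda>x :: (real \<times> real) \<times> real. NN (fst x)) \<in> borel_measurable borel"
proof -
  have "(\<lambda>x. NN (fst x)) \<in> borel_measurable (borel \<Otimes>\<^sub>M (borel :: real measure))" by measurable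
  then show ?thesis unfolding borel_prod .
qed

lemma Phi_comp_measurable [measurable]:
  "(\<lambda>x. Delta gg (Phi x) z) \<in> borel_measurable borel"
  "(\<lambda>x. pullback_density (normal gg) (CL_form gg) (Phi x)) \<in> borel_measurable borel"
  by (auto intro: measurable_compose[OF Phi_measurable])

lemma Phi_simps: "fst (Phi x) = Complex (fst (fst x)) (snd (fst x))"
  "snd (Phi x) = complex_of_real (sqrt (1 - gp (fst x))) * cis (snd x)"
  by (simp_all add: Phi_def bparam_def gp_def)

lemma AE_fst_nz: "AE x in (lborel :: ((real \<times> real) \<times> real) measure). fst (fst x) \<noteq> 0"
proof -
  have 1: "{p. fst p \<noteq> 0} \<in> sets (borel :: (real \<times> real) measure)"
    by (intro borel_open open_Collect_neq continuous_intros)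
  have 2: "{x. fst (fst x) \<noteq> 0} \<in> sets (borel :: ((real \<times> real) \<times> real) measure)"
    by (intro borel_open open_Collect_neq continuous_intros)
  have "AE p in lborel \<Otimes>\<^sub>M (lborel :: real measure). fst p \<noteq> (0::real)"
    by (rule lborel_pair.AE_pair_measure)
      (unfold lborel_prod, use 1 AE_lborel_singleton[of "0::real"] in auto)
  then have 3: "AE p in (lborel :: (real \<times> real) measure). fst p \<noteq> 0" unfolding lborel_prod .
  have "AE x in (lborel :: (real \<times> real) measure) \<Otimes>\<^sub>M (lborel :: real measure). fst (fst x) \<noteq> 0"
    by (rule lborel_pair.AE_pair_measure) (unfold lborel_prod, use 2 3 in auto)
  then show ?thesis unfolding lborel_prod .
qed

text \<open>Off the null set u = 0 the Jacobian of the parametrisation cancels the norm of the gradient in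
  the definition of the unit normal.\<close>
lemma cauchy_leray_eq:
  assumes [measurable]: "f \<in> borel_measurable borel"
  shows "cauchy_leray gg f z = 1 / (4 * pi\<^sup>2) *
     (\<integral> x. indicator Om x * of_real (NN (fst x)) * f (Phi x) / (Delta gg (Phi x) z)\<^sup>2 \<partial>lborel)"
proof -
  let ?F = "\<lambda>w. f w * pullback_density (normal gg) (CL_form gg) w / (Delta gg w z)\<^sup>2"
  have [measurable]: "(\<lambda>x. f (Phi x)) \<in> borel_measurable borel"
    by (rule measurable_compose[OF Phi_measurable assms])
  have "AE x in lborel. (indicator Om x * jac (fst x)) *\<^sub>R ?F (Phi x) =
     - (indicator Om x * of_real (NN (fst x)) * f (Phi x) / (Delta gg (Phi x) z)\<^sup>2)"
    using AE_fst_nz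
  proof eventually_elim
    case (elim x)
    obtain u v \<theta> where x: "x = ((u, v), \<theta>)" by (metis surj_pair)
    show ?case
    proof (cases "x \<in> Om")
      case True
      then have g1: "gg u v < 1" by (simp add: Om_def x gp_def)
      have jpos: "jac (u, v) > 0" using g1 by (auto simp: jac_def gp_def grd_def intro!: add_pos_nonneg)
      have r2: "(cmod (snd (Phi x)))\<^sup>2 = 1 - gg u v" using g1
        by (simp add: Phi_simps x norm_mult gp_def)
      then have r2': "(Re (snd (Phi x)))\<^sup>2 + (Im (snd (Phi x)))\<^sup>2 = 1 - gg u v" by (simp add: cmod_power2)
      have "gradn (Phi x) = sqrt (4 * (1 - gg u v + grd (u, v) / 4))"
        unfolding gradn_def r2'[symmetric] by (simp add: Phi_simps(1) x grd_def power_mult_distrib algebra_simps)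
      then have gr: "gradn (Phi x) = 2 * jac (u, v)"
        using real_sqrt_mult[of 4 "1 - gg u v + grd (u, v) / 4"] by (simp add: jac_def gp_def)
      have L: "Lap (Phi x) = of_real ((dda u + ddb v) / 4)"
        using elim by (simp add: Lap_eq Phi_simps(1) x)
      have "pullback_density (normal gg) (CL_form gg) (Phi x) = - of_real (NN (u, v)) / of_real (jac (u, v))"
        unfolding pullback_eq gr L r2 using jpos
        by (simp add: Phi_simps(1) x NN_def grd_def gp_def field_simps)
      then show ?thesis using True jpos by (simp add: x scaleR_conv_of_real)
    qed simp
  qed
  then have "(\<integral> x. (indicator Om x * jac (fst x)) *\<^sub>R ?F (Phi x) \<partial>lborel) =
    (\<integral> x. - (indicator Om x * of_real (NN (fst x)) * f (Phi x) / (Delta gg (Phi x) z)\<^sup>2) \<partial>lborel)"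
    by (intro integral_cong_AE) (simp_all, measurable)
  moreover have "?F \<in> borel_measurable borel" by measurable
  \<comment> \<open>The minus sign of the density cancels the sign of (2 pi i)^2.\<close>
  ultimately show ?thesis
    by (simp add: cauchy_leray_def integral_sigma power_mult_distrib)
qed

end

subsection \<open>Integration over circles and geometric estimates\<close>

text \<open>Because D' = i (A - D), the derivative of F/D is -i A times the difference of the two
  integrands, and it integrates to 0 over a period.\<close>

lemma periodic_ibp:
  fixes F F' D :: "real \<Rightarrow> complex"
  assumes F: "\<And>t. (F has_vector_derivative F' t) (at t)" and F': "continuous_on UNIV F'"
    and D: "\<And>t. (D has_vector_derivative \<i> * (A - D t)) (at t)"
    and nz: "\<And>t. D t \<noteq> 0" "A \<noteq> 0" and per: "F 0 = F (2 * pi)" "D 0 = D (2 * pi)"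
  shows "integral {0..2*pi} (\<lambda>t. F t / (D t)\<^sup>2) = integral {0..2*pi} (\<lambda>t. (F t - \<i> * F' t) / (A * D t))"
proof -
  have cF: "continuous_on {0..2*pi} F" "continuous_on {0..2*pi} D" "continuous_on {0..2*pi} F'"
    using F D has_vector_derivative_continuous continuous_on_subset[OF F']
    by (blast intro: continuous_at_imp_continuous_on)+
  have "((\<lambda>t. F t * inverse (D t)) has_vector_derivative
      (F t * (\<i> * (A - D t) * (- (inverse (D t))\<^sup>2)) + F' t * inverse (D t))) (at t)" for t
    using has_vector_derivative_mult[OF F field_vector_diff_chain_at[OF D[of t] DERIV_inverse[OF nz(1)]]]
    by (simp add: o_def power2_eq_square numeral_2_eq_2)
  then have "((\<lambda>t. F t * (\<i> * (A - D t) * (- (inverse (D t))\<^sup>2)) + F' t * inverse (D t)) has_integral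
      (F (2*pi) * inverse (D (2*pi)) - F 0 * inverse (D 0))) {0..2*pi}"
    by (intro fundamental_theorem_of_calculus) (auto intro: has_vector_derivative_at_within)
  moreover have "F t * (\<i> * (A - D t) * (- (inverse (D t))\<^sup>2)) + F' t * inverse (D t)
    = - \<i> * A * (F t / (D t)\<^sup>2 - (F t - \<i> * F' t) / (A * D t))" for t
    using nz by (simp add: divide_simps power2_eq_square) (simp add: algebra_simps)
  ultimately have "((\<lambda>t. - \<i> * A * (F t / (D t)\<^sup>2 - (F t - \<i> * F' t) / (A * D t))) has_integral 0) {0..2*pi}"
    using per by simp
  from has_integral_mult_right[OF this, of "\<i> / A"]
  have "((\<lambda>t. F t / (D t)\<^sup>2 - (F t - \<i> * F' t) / (A * D t)) has_integral 0) {0..2*pi}"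
    using nz(2) by (simp add: mult.assoc[symmetric])
  then have "integral {0..2*pi} (\<lambda>t. F t / (D t)\<^sup>2 - (F t - \<i> * F' t) / (A * D t)) = 0"
    by (rule integral_unique)
  moreover have "(\<lambda>t. F t / (D t)\<^sup>2) integrable_on {0..2*pi}" "(\<lambda>t. (F t - \<i> * F' t) / (A * D t)) integrable_on {0..2*pi}"
    using nz by (auto intro!: integrable_continuous_interval continuous_intros cF)
  ultimately show ?thesis
    by (simp add: Henstock_Kurzweil_Integration.integral_diff)
qed

text \<open>With s = cis t the integral becomes that of 1/(i A (s - B/A)) over the unit circle,
  whose pole B/A lies inside; Cauchy's formula for the constant 1 gives the value.\<close>

lemma integral_circle_inverse:
  fixes A B :: complex
  assumes "cmod B < cmod A"
  shows "integral {0..2*pi} (\<lambda>t. 1 / (A - B * cis (- t))) = 2 * pi / A"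
proof -
  have A: "A \<noteq> 0" using assms by auto
  have q: "cmod (B / A - 0) < 1" using assms A by (simp add: norm_divide)
  have "((\<lambda>u. 1 / (u - B / A)) has_contour_integral 2 * of_real pi * \<i> * 1) (circlepath 0 1)"
    by (rule Cauchy_integral_circlepath[OF _ _ q]) auto
  then have "contour_integral (part_circlepath 0 1 0 (2*pi)) (\<lambda>u. 1 / (u - B / A)) = 2 * of_real pi * \<i>"
    by (simp add: contour_integral_unique circlepath_def)
  then have "integral {0..2*pi} (\<lambda>t. 1 / (cis t - B / A) * \<i> * cis t) = 2 * of_real pi * \<i>"
    by (subst (asm) contour_integral_part_circlepath_eq) auto
  moreover have "1 / (cis t - B / A) * \<i> * cis t = \<i> * A * (1 / (A - B * cis (- t)))" for t
  proof -
    have c: "cis t * cis (- t) = 1" by (simp add: cis_mult)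
    have e: "cis t * (A - B * cis (- t)) = A * (cis t - B / A)"
      using A c by (simp add: algebra_simps)
    have nz: "A - B * cis (- t) \<noteq> 0"
    proof
      assume "A - B * cis (- t) = 0"
      then have "cmod A = cmod (B * cis (- t))" by simp
      then show False using assms by (simp add: norm_mult)
    qed
    have nz2: "cis t - B / A \<noteq> 0"
    proof
      assume "cis t - B / A = 0"
      then have "cis t * (A - B * cis (- t)) = 0" using e by simp
      then show False using nz by simp
    qed
    have "1 / (cis t - B / A) * cis t = A * (1 / (A - B * cis (- t)))"
      using nz nz2 e by (simp add: divide_simps mult_ac)
    from arg_cong[OF this, of "\<lambda>x. \<i> * x"] show ?thesis by (simp add: mult_ac)
  qed
  ultimately have "integral {0..2*pi} (\<lambda>t. \<i> * A * (1 / (A - B * cis (- t)))) = 2 * of_real pi * \<i>"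
    by simp
  then have "\<i> * A * integral {0..2*pi} (\<lambda>t. 1 / (A - B * cis (- t))) = 2 * of_real pi * \<i>"
    by (simp only: integral_mult_right)
  then show ?thesis using A by (simp add: field_simps)
qed

context egg
begin

section \<open>Convexity of g and lower bounds for A and Delta\<close>

lemma m_bounds: "1 < m" "0 < m" "m - 1 > 0" "m - 1 \<le> 1" using m by auto

text \<open>The derivative of |u|^m - m (m-1) u^2 / 2. It increases on [-1, 1] because |u|^(m-2) >=
  1 there, which is the strong convexity used in \<open>alpha_conv\<close>. The monotonicity is
  proved on [0, 1] and extended by oddness, so that the singular point 0 is never interior.\<close>

definition hh :: "real \<Rightarrow> real" where "hh u = da u - m * (m - 1) * u"

lemma hh_mono_nonneg: "0 \<le> s \<Longrightarrow> s \<le> t \<Longrightarrow> t \<le> 1 \<Longrightarrow> hh s \<le> hh t"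
proof -
  assume st: "0 \<le> s" "s \<le> t" "t \<le> 1"
  have c: "continuous_on UNIV hh" unfolding hh_def[abs_def] by (intro continuous_intros cont_da)
  show ?thesis
  proof (rule DERIV_nonneg_imp_increasing_open[OF st(2)])
    fix x assume x: "s < x" "x < t"
    then have x0: "0 < x" "x < 1" using st by auto
    have "(hh has_real_derivative dda x - m * (m - 1)) (at x)"
      unfolding hh_def[abs_def] using da_deriv[of x] x0 by (auto intro!: derivative_eq_intros)
    moreover have "1 \<le> \<bar>x\<bar> powr (m - 2)"
      using x0 m powr_mono'[of "m - 2" 0 "\<bar>x\<bar>"] by simp
    then have "0 \<le> dda x - m * (m - 1)" using m_bounds by (simp add: dda_def)
    ultimately show "\<exists>y. DERIV hh x :> y \<and> 0 \<le> y" by blast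
  qed (rule continuous_on_subset[OF c], simp)
qed

lemma hh_odd: "hh (- u) = - hh u" by (simp add: hh_def da_def)

lemma hh_mono: "\<bar>s\<bar> \<le> 1 \<Longrightarrow> \<bar>t\<bar> \<le> 1 \<Longrightarrow> s \<le> t \<Longrightarrow> hh s \<le> hh t"
proof -
  assume a: "\<bar>s\<bar> \<le> 1" "\<bar>t\<bar> \<le> 1" "s \<le> t"
  have h0: "hh 0 = 0" by (simp add: hh_def da_def)
  consider "0 \<le> s" | "t \<le> 0" | "s < 0" "0 < t" by linarith
  then show ?thesis
  proof cases
    case 1 then show ?thesis using a hh_mono_nonneg by simp
  next
    case 2 then show ?thesis using a hh_mono_nonneg[of "-t" "-s"] by (simp add: hh_odd)
  next
    case 3 then show ?thesis using a hh_mono_nonneg[of 0 t] hh_mono_nonneg[of 0 "-s"] h0 by (simp add: hh_odd)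
  qed
qed

text \<open>The tangent line inequality for the convex function H, obtained from the mean value
  theorem and the monotonicity of H' = \<open>hh\<close>.\<close>

lemma alpha_conv:
  assumes "\<bar>x\<bar> \<le> 1" "\<bar>u\<bar> \<le> 1"
  shows "m * (m - 1) / 2 * (x - u)\<^sup>2 \<le> \<bar>x\<bar> powr m - \<bar>u\<bar> powr m - da u * (x - u)"
proof -
  define H where "H t = \<bar>t\<bar> powr m - m * (m - 1) / 2 * t\<^sup>2" for t :: real
  have H: "(H has_real_derivative hh t) (at t)" for t
    unfolding H_def[abs_def] hh_def
    using DERIV_diff[OF pow_m_deriv[of t] DERIV_cmult[OF DERIV_pow[of 2 t], of "m * (m - 1) / 2"]] by (simp add: mult.assoc)
  have "H x - H u \<ge> hh u * (x - u)"
  proof (cases x u rule: linorder_cases)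
    case less
    then obtain t where "x < t" "t < u" "H u - H x = (u - x) * hh t" using MVT2[OF less H] by blast
    moreover have "(u - x) * hh t \<le> (u - x) * hh u"
      using calculation assms less by (intro mult_left_mono hh_mono) auto
    ultimately show ?thesis by (simp add: algebra_simps)
  next
    case greater
    then obtain t where "u < t" "t < x" "H x - H u = (x - u) * hh t" using MVT2[OF greater H] by blast
    moreover have "(x - u) * hh u \<le> (x - u) * hh t"
      using calculation assms greater by (intro mult_left_mono hh_mono) auto
    ultimately show ?thesis by (simp add: algebra_simps)
  qed simp
  then show ?thesis by (simp add: H_def hh_def power2_eq_square algebra_simps diff_divide_distrib add_divide_distrib) 
qed

text \<open>For n = 2 the remainder is (y-v)^2. For n = 4 it factors as (y-v)^2 ((y+v)^2 + 2 v^2),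
  and completing a square shows that the second factor is at least (y-v)^2 / 4.\<close>

lemma beta_conv: "(y - v) ^ n / 4 \<le> y ^ n - v ^ n - db v * (y - v)"
proof (cases "n = 2")
  case True
  have "y ^ 2 - v ^ 2 - 2 * v * (y - v) = (y - v)\<^sup>2" by (simp add: power2_eq_square algebra_simps)
  then show ?thesis using True zero_le_power2[of "y - v"] unfolding db_def by simp
next
  case False
  then have n4: "n = 4" using n by simp
  have "(y - v)\<^sup>2 \<le> 4 * ((y + v)\<^sup>2 + 2 * v\<^sup>2)"
  proof -
    have "4 * ((y + v)\<^sup>2 + 2 * v\<^sup>2) - (y - v)\<^sup>2 = 3 * y\<^sup>2 + 10 * y * v + 11 * v\<^sup>2"
      by (simp add: power2_eq_square algebra_simps)
    also have "\<dots> = 3 * (y + 5 / 3 * v)\<^sup>2 + 8 / 3 * v\<^sup>2" by (simp add: power2_eq_square algebra_simps)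
    also have "0 \<le> \<dots>" by simp
    finally show ?thesis by simp
  qed
  then have "(y - v)\<^sup>2 * (y - v)\<^sup>2 \<le> (y - v)\<^sup>2 * (4 * ((y + v)\<^sup>2 + 2 * v\<^sup>2))" by (rule mult_left_mono) simp
  moreover have "y ^ 4 - v ^ 4 - 4 * v ^ 3 * (y - v) = (y - v)\<^sup>2 * ((y + v)\<^sup>2 + 2 * v\<^sup>2)"
    by (simp add: power2_eq_square power4_eq_xxxx power3_eq_cube algebra_simps)
  moreover have "(y - v) ^ 4 = (y - v)\<^sup>2 * (y - v)\<^sup>2" by (simp add: power2_eq_square power4_eq_xxxx)
  moreover have "db v = 4 * v ^ 3" unfolding db_def by (simp add: n4)
  moreover have quarter: "a / 4 \<le> b" if "a \<le> c * (4 * d)" "b = c * d" for a b c d :: real using that by simp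
  ultimately show ?thesis unfolding n4 by (metis quarter)
qed

definition af :: "real \<times> real \<Rightarrow> complex" where
  "af p = (of_real (da (fst p)) - \<i> * of_real (db (snd p))) / 2"
definition rr :: "real \<times> real \<Rightarrow> real" where "rr p = sqrt (1 - gp p)"
definition tau :: "real \<times> real \<Rightarrow> complex \<Rightarrow> complex" where "tau p z = Complex (fst p) (snd p) - z"
definition AA :: "real \<times> real \<Rightarrow> complex \<Rightarrow> complex" where
  "AA p z = af p * tau p z + of_real (1 - gp p)"
definition Gz :: "complex \<Rightarrow> real" where "Gz z = gg (Re z) (Im z)"
text \<open>Half the gap between g at z and the tangent plane of g at p, nonnegative by convexity.
  It is the part of Re A and Re Delta that remains when both points lie on the boundary.\<close>

definition conv :: "real \<times> real \<Rightarrow> complex \<Rightarrow> real" where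
  "conv p z = (Gz z - gp p - da (fst p) * (Re z - fst p) - db (snd p) * (Im z - snd p)) / 2"

lemma gg_le_1: assumes "gg u v \<le> 1" shows "\<bar>u\<bar> \<le> 1" "\<bar>v\<bar> \<le> 1"
proof -
  have v: "0 \<le> v ^ n" using n by auto
  have u: "0 \<le> \<bar>u\<bar> powr m" by simp
  have 1: "\<bar>u\<bar> powr m \<le> 1" "v ^ n \<le> 1" using assms u v unfolding gg_def by linarith+
  show "\<bar>u\<bar> \<le> 1"
  proof (rule ccontr)
    assume "\<not> \<bar>u\<bar> \<le> 1"
    then have "1 < \<bar>u\<bar> powr m" using m_bounds by (intro gr_one_powr) auto
    then show False using 1 by simp
  qed
  have "\<bar>v\<bar> ^ n \<le> 1" using 1 n by auto
  moreover have "0 < n" using n by auto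
  ultimately show "\<bar>v\<bar> \<le> 1" using one_less_power[of "\<bar>v\<bar>" n] by linarith
qed

lemma da_db_le:
  assumes "\<bar>u\<bar> \<le> 1" "\<bar>v\<bar> \<le> 1" shows "\<bar>da u\<bar> \<le> 2" "\<bar>db v\<bar> \<le> 4"
proof -
  have "\<bar>da u\<bar> \<le> 2 * 1"
  proof (cases "u = 0")
    case False
    then show ?thesis unfolding da_def abs_mult using m assms powr_mono'[of 0 "m - 1" "\<bar>u\<bar>"]
      by (intro mult_mono) (auto simp: abs_sgn_eq)
  qed (simp add: da_def)
  then show "\<bar>da u\<bar> \<le> 2" by simp
  have "\<bar>db v\<bar> \<le> 4 * 1" unfolding db_def abs_mult power_abs using n assms
    by (intro mult_mono power_le_one) auto
  then show "\<bar>db v\<bar> \<le> 4" by simp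
qed

text \<open>The gap controls a^2 in the u direction and b^n in the v direction. On the bounded
  domain both dominate the fourth power, the order of the flattest direction, so |tau|^4 serves as a
  common lower bound.\<close>

lemma conv_lower:
  assumes "gp p \<le> 1" "Gz z \<le> 1"
  shows "cmod (tau p z) ^ 4 / 64 \<le> conv p z" "0 \<le> conv p z"
proof -
  obtain u v where p: "p = (u, v)" by (metis surj_pair)
  define a where "a = Re z - u"
  define b where "b = Im z - v"
  have le: "\<bar>u\<bar> \<le> 1" "\<bar>v\<bar> \<le> 1" "\<bar>Re z\<bar> \<le> 1" "\<bar>Im z\<bar> \<le> 1"
    using gg_le_1[of u v] gg_le_1[of "Re z" "Im z"] assms by (auto simp: p gp_def Gz_def)
  have ab: "\<bar>a\<bar> \<le> 2" "\<bar>b\<bar> \<le> 2" using le by (auto simp: a_def b_def)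
  then have sq: "a\<^sup>2 \<le> 4" "b\<^sup>2 \<le> 4" using power_mono[of "\<bar>a\<bar>" 2 2] power_mono[of "\<bar>b\<bar>" 2 2] by auto
  have "3 / 4 \<le> m * (m - 1)" using m mult_mono[of "3/2" m "1/2" "m - 1"] by simp
  then have "3 / 8 * a\<^sup>2 \<le> m * (m - 1) / 2 * a\<^sup>2" by (intro mult_right_mono) auto
  then have 1: "3 / 8 * a\<^sup>2 \<le> \<bar>Re z\<bar> powr m - \<bar>u\<bar> powr m - da u * (Re z - u)"
    using alpha_conv[of "Re z" u] le by (simp add: a_def)
  have 2: "b ^ n / 4 \<le> Im z ^ n - v ^ n - db v * (Im z - v)" using beta_conv by (simp add: b_def)
  have a4: "a ^ 4 \<le> 4 * a\<^sup>2" "b ^ 4 \<le> 4 * b\<^sup>2"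
    using mult_right_mono[OF sq(1), of "a\<^sup>2"] mult_right_mono[OF sq(2), of "b\<^sup>2"] by (simp_all add: power2_eq_square power4_eq_xxxx)
  then have bn: "b ^ 4 / 4 \<le> b ^ n" using n zero_le_even_power[of 4 b] by auto
  have a40: "0 \<le> a ^ 4" by (simp add: zero_le_even_power)
  have t: "cmod (tau p z) ^ 4 = (a\<^sup>2 + b\<^sup>2)\<^sup>2"
  proof -
    have "(cmod (tau p z))\<^sup>2 = a\<^sup>2 + b\<^sup>2" by (simp add: tau_def p cmod_power2 a_def b_def power2_commute)
    moreover have "cmod (tau p z) ^ 4 = ((cmod (tau p z))\<^sup>2)\<^sup>2" by (simp add: power2_eq_square power4_eq_xxxx)
    ultimately show ?thesis by simp
  qed
  have "(a\<^sup>2 + b\<^sup>2)\<^sup>2 \<le> 2 * (a ^ 4 + b ^ 4)"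
    using zero_le_power2[of "a\<^sup>2 - b\<^sup>2"] by (simp add: power2_eq_square power4_eq_xxxx algebra_simps)
  moreover have "conv p z \<ge> (3 / 8 * a\<^sup>2 + b ^ n / 4) / 2"
    using 1 2 by (simp add: conv_def p Gz_def gp_def gg_def)
  moreover have "S / 64 \<le> c" if "S \<le> 2 * (A + B)" "(3 / 8 * X + Y / 4) / 2 \<le> c" "A \<le> 4 * X" "B / 4 \<le> Y" "0 \<le> A"
    for S A B X Y c :: real using that by (simp add: field_simps)
  ultimately show "cmod (tau p z) ^ 4 / 64 \<le> conv p z"
    unfolding t using a4(1) bn a40 by blast
  moreover have "0 \<le> cmod (tau p z) ^ 4 / 64" by simp
  ultimately show "0 \<le> conv p z" by (rule order_trans[rotated])
qed

text \<open>The real part of \<open>af\<close> times \<open>tau\<close> is half the linear part of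
  the Taylor expansion of g at p, taken with a minus sign; it completes 1 - g(p) to the convexity
  gap.\<close>

lemma Re_AA: "Re (AA p z) = ((1 - gp p) + (1 - Gz z)) / 2 + conv p z"
  by (simp add: AA_def af_def tau_def conv_def field_simps)

lemma rr_sq: "gp p \<le> 1 \<Longrightarrow> (rr p)\<^sup>2 = 1 - gp p" by (simp add: rr_def)

lemma Delta_AA:
  assumes "gp (fst x) \<le> 1"
  shows "Delta gg (Phi x) z = AA (fst x) (fst z) - of_real (rr (fst x)) * snd z * cis (- snd x)"
proof -
  have "cis (- snd x) * cis (snd x) = 1" by (simp add: cis_mult)
  then have *: "cnj (cis (snd x)) * cis (snd x) = 1" by (simp add: cis_cnj)
  have "cnj (snd (Phi x)) * (snd (Phi x)) = of_real (rr (fst x) * rr (fst x)) * (cnj (cis (snd x)) * cis (snd x))"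
    by (simp only: Phi_simps rr_def complex_cnj_mult complex_cnj_complex_of_real of_real_mult mult_ac)
  also have "\<dots> = of_real (1 - gp (fst x))" using * rr_sq[OF assms] by (simp add: power2_eq_square)
  finally have "cnj (snd (Phi x)) * (snd (Phi x)) = of_real (1 - gp (fst x))" .
  then show ?thesis
    by (simp add: Delta_eq AA_def af_def tau_def p0_def Phi_simps(1) right_diff_distrib)
       (simp add: Phi_simps rr_def cis_cnj)
qed

lemma dom_facts:
  "z \<in> dom gg \<Longrightarrow> (cmod (snd z))\<^sup>2 < 1 - Gz (fst z)"
  "rho gg z \<le> 0 \<Longrightarrow> (cmod (snd z))\<^sup>2 \<le> 1 - Gz (fst z)"
  by (auto simp: dom_def rho_def Gz_def)

text \<open>The oscillating term r z_2 e^(-it) is at most (r^2 + |z_2|^2)/2 in modulus, and this is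
  absorbed by the two halves (1-g)/2 of Re A since r^2 = 1 - g(p) and |z_2|^2 <= 1 - g(z_1).\<close>

lemma Re_Delta:
  assumes "gp (fst x) \<le> 1" "rho gg z \<le> 0"
  shows "conv (fst x) (fst z) \<le> Re (Delta gg (Phi x) z)"
    "(1 - Gz (fst z) - (cmod (snd z))\<^sup>2) / 2 \<le> Re (Delta gg (Phi x) z)"
proof -
  let ?r = "rr (fst x)"
  have r0: "0 \<le> ?r" using assms by (simp add: rr_def)
  have G: "Gz (fst z) \<le> 1" using dom_facts(2)[OF assms(2)] zero_le_power2[of "cmod (snd z)"] by linarith
  have "Re (of_real ?r * snd z * cis (- snd x)) \<le> cmod (of_real ?r * snd z * cis (- snd x))" by (rule complex_Re_le_cmod)
  also have "\<dots> = ?r * cmod (snd z)" using r0 by (simp add: norm_mult)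
  finally have 1: "Re (Delta gg (Phi x) z) \<ge> ((1 - gp (fst x)) + (1 - Gz (fst z))) / 2 + conv (fst x) (fst z) - ?r * cmod (snd z)"
    unfolding Delta_AA[OF assms(1)] by (simp add: Re_AA)
  have 2: "?r * cmod (snd z) \<le> (?r\<^sup>2 + (cmod (snd z))\<^sup>2) / 2"
    using zero_le_power2[of "?r - cmod (snd z)"] by (simp add: power2_eq_square algebra_simps)
  show "conv (fst x) (fst z) \<le> Re (Delta gg (Phi x) z)"
    "(1 - Gz (fst z) - (cmod (snd z))\<^sup>2) / 2 \<le> Re (Delta gg (Phi x) z)"
    using 1 2 dom_facts(2)[OF assms(2)] rr_sq[OF assms(1)] conv_lower(2)[OF assms(1) G] by (simp_all add: field_simps)
qed

text \<open>The last bound is linear in |tau|, much better than the fourth power available for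
  Delta. If g(p) <= 1/2, then 1 - g(p) is large and |tau| is bounded. Otherwise the gradient of g at
  p is bounded below, and \<open>af\<close> times \<open>tau\<close>, which differs from A by 1 -
  g(p) <= 2|A|, is at most 3|A|.\<close>

lemma AA_lower:
  assumes "gp p \<le> 1" "Gz z \<le> 1"
  shows "(1 - gp p) / 2 \<le> cmod (AA p z)" "(1 - Gz z) / 2 \<le> cmod (AA p z)" "cmod (tau p z) / 16 \<le> cmod (AA p z)"
proof -
  have R: "Re (AA p z) \<le> cmod (AA p z)" by (rule complex_Re_le_cmod)
  then have R': "((1 - gp p) + (1 - Gz z)) / 2 + conv p z \<le> cmod (AA p z)" unfolding Re_AA .
  have 11: "(1 - gp p) / 2 \<le> cmod (AA p z)" using R' conv_lower(2)[OF assms] assms by (simp add: field_simps)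
  have 12: "(1 - Gz z) / 2 \<le> cmod (AA p z)" using R' conv_lower(2)[OF assms] assms by (simp add: field_simps)
  note 1 = 11 12
  show "(1 - gp p) / 2 \<le> cmod (AA p z)" "(1 - Gz z) / 2 \<le> cmod (AA p z)" by (fact 11, fact 12)
  obtain u v where p: "p = (u, v)" by (metis surj_pair)
  have le: "\<bar>u\<bar> \<le> 1" "\<bar>v\<bar> \<le> 1" "\<bar>Re z\<bar> \<le> 1" "\<bar>Im z\<bar> \<le> 1"
    using gg_le_1[of u v] gg_le_1[of "Re z" "Im z"] assms by (auto simp: p gp_def Gz_def)
  have t4: "cmod (tau p z) \<le> 4"
    using cmod_le[of "tau p z"] le by (simp add: tau_def p)
  have af: "cmod (af p) * cmod (tau p z) \<le> 3 * cmod (AA p z)"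
  proof -
    have "cmod (af p * tau p z) \<le> cmod (AA p z) + cmod (of_real (1 - gp p))"
      unfolding AA_def using norm_triangle_ineq4[of "af p * tau p z + of_real (1 - gp p)" "of_real (1 - gp p)"] by simp
    then show ?thesis using 1(1) assms by (simp only: norm_mult norm_of_real) (simp)
  qed
  show "cmod (tau p z) / 16 \<le> cmod (AA p z)"
  proof (cases "gp p \<le> 1 / 2")
    case True
    then show ?thesis using 1(1) t4 by (simp add: field_simps)
  next
    case False
    have "3 / 16 \<le> cmod (af p)"
    proof -
      have c: "\<bar>da u\<bar> / 2 \<le> cmod (af p)" "\<bar>db v\<bar> / 2 \<le> cmod (af p)"
        using abs_Re_le_cmod[of "af p"] abs_Im_le_cmod[of "af p"] by (auto simp: af_def p)
      from False have "1 / 4 \<le> \<bar>u\<bar> powr m \<or> 1 / 4 \<le> v ^ n" by (auto simp: gp_def gg_def p)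
      then show ?thesis
      proof
        assume a: "1 / 4 \<le> \<bar>u\<bar> powr m"
        then have u0: "u \<noteq> 0" by auto
        have "\<bar>u\<bar> powr m \<le> \<bar>u\<bar> powr (m - 1)" using le u0 by (intro powr_mono') auto
        then have "3 / 2 * (1 / 4) \<le> m * \<bar>u\<bar> powr (m - 1)" using a m by (intro mult_mono) auto
        moreover have "\<bar>da u\<bar> = m * \<bar>u\<bar> powr (m - 1)" using u0 m_bounds by (simp add: da_def abs_mult abs_sgn_eq)
        ultimately show ?thesis using c by linarith
      next
        assume a: "1 / 4 \<le> v ^ n"
        have "v ^ n \<le> \<bar>v\<bar> ^ (n - 1)" using le n power_decreasing[of "n - 1" n "\<bar>v\<bar>"] by auto
        then have "2 * (1 / 4) \<le> real n * \<bar>v\<bar> ^ (n - 1)" using a n by (intro mult_mono) auto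
        moreover have "\<bar>db v\<bar> = real n * \<bar>v\<bar> ^ (n - 1)" by (simp add: db_def abs_mult power_abs)
        ultimately show ?thesis using c by linarith
      qed
    qed
    then have "3 / 16 * cmod (tau p z) \<le> cmod (af p) * cmod (tau p z)" by (intro mult_right_mono) auto
    then show ?thesis using af by linarith
  qed
qed

text \<open>Only \<open>dda\<close> is unbounded. Its size |u|^(m-2) is at least 1 on the domain and
  therefore also absorbs the bounded terms in the upper bound.\<close>

lemma NN_bounds:
  assumes "gp p < 1" "fst p \<noteq> 0"
  shows "0 \<le> NN p" "NN p \<le> 18 * \<bar>fst p\<bar> powr (m - 2)" "(1 - gp p) / 2 * dda (fst p) \<le> NN p"
proof -
  obtain u v where p: "p = (u, v)" by (metis surj_pair)
  have le: "\<bar>u\<bar> \<le> 1" "\<bar>v\<bar> \<le> 1" using gg_le_1[of u v] assms by (auto simp: p gp_def)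
  have u0: "u \<noteq> 0" using assms p by simp
  have P: "1 \<le> \<bar>u\<bar> powr (m - 2)" using powr_mono'[of "m - 2" 0 "\<bar>u\<bar>"] le u0 m by simp
  have m1: "0 \<le> m * (m - 1)" "m * (m - 1) \<le> 2" using m mult_mono[of m 2 "m - 1" 1] by auto
  have d: "0 \<le> dda u" "dda u \<le> 2 * \<bar>u\<bar> powr (m - 2)"
    using mult_right_mono[OF m1(2), of "\<bar>u\<bar> powr (m - 2)"] m1 by (auto simp: dda_def)
  have e: "0 \<le> ddb v" "ddb v \<le> 12"
    using n le by (auto simp: ddb_def abs_square_le_1)
  have "(da u)\<^sup>2 \<le> 4" using da_db_le(1)[OF le] power_mono[of "\<bar>da u\<bar>" 2 2] by simp
  moreover have "(db v)\<^sup>2 \<le> 16" using da_db_le(2)[OF le] power_mono[of "\<bar>db v\<bar>" 4 2] by simp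
  ultimately have g: "0 \<le> grd p" "grd p \<le> 20" by (auto simp: grd_def p)
  have gp0: "0 \<le> gp p" using n by (auto simp: gp_def gg_def)
  have "(1 - gp p) * (dda u + ddb v) \<le> 1 * (dda u + ddb v)" using gp0 d e by (intro mult_right_mono) auto
  then show "NN p \<le> 18 * \<bar>fst p\<bar> powr (m - 2)" using d e g P by (simp add: NN_def p)
  have "0 \<le> (1 - gp p) * ddb v" "0 \<le> (1 - gp p) * dda u" using assms e d by auto
  moreover have "NN p = grd p / 2 + (1 - gp p) * ddb v / 2 + (1 - gp p) * dda u / 2"
    unfolding NN_def p by (simp add: field_simps)
  ultimately show "0 \<le> NN p" "(1 - gp p) / 2 * dda (fst p) \<le> NN p" using g by (auto simp: p)
qed

end

subsection \<open>The constant term\<close>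

lemma real2_measurable [measurable]:
  "(\<lambda>p::real\<times>real. fst p) \<in> borel_measurable borel" "(\<lambda>p::real\<times>real. snd p) \<in> borel_measurable borel"
  "(\<lambda>p::real\<times>real. Complex (fst p) (snd p)) \<in> borel_measurable borel"
  unfolding Complex_eq by (auto intro!: borel_measurable_continuous_onI continuous_intros)

text \<open>A fundamental theorem that tolerates finitely many exceptional points: W is only
  continuous at the points of F. On the slices in u the exceptional point is 0, where
  \<open>dda\<close> blows up.\<close>

lemma integral_slice_zero:
  fixes W W' :: "real \<Rightarrow> complex"
  assumes int: "integrable lborel (\<lambda>u. indicator {a<..<b} u *\<^sub>R W' u)" and "a \<le> b" "finite F"
    and c: "continuous_on {a..b} W" and d: "\<And>u. u \<in> {a<..<b} - F \<Longrightarrow> (W has_vector_derivative W' u) (at u)"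
    and z: "W a = 0" "W b = 0"
  shows "(\<integral>u. indicator {a<..<b} u *\<^sub>R W' u \<partial>lborel) = 0"
proof -
  have "(W' has_integral 0) {a..b}"
    using fundamental_theorem_of_calculus_interior_strong[OF \<open>finite F\<close> \<open>a \<le> b\<close> d c] z by simp
  then have "((\<lambda>u. if u \<in> {a..b} then W' u else 0) has_integral 0) UNIV"
    by (simp only: has_integral_restrict_UNIV)
  then have "((\<lambda>u. indicator {a<..<b} u *\<^sub>R W' u) has_integral 0) UNIV"
    by (rule has_integral_spike_finite[of "{a, b}", rotated 2]) (auto split: split_indicator)
  then show ?thesis using has_integral_integral_lborel[OF int] has_integral_unique by blast
qed

lemma has_vector_derivative_divide_complex:
  fixes f h :: "real \<Rightarrow> complex"
  assumes "(f has_vector_derivative f') (at x)" "(h has_vector_derivative h') (at x)" "h x \<noteq> 0"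
  shows "((\<lambda>x. f x / h x) has_vector_derivative (f' / h x - f x * h' / (h x)\<^sup>2)) (at x)"
  using has_vector_derivative_mult[OF assms(1) field_vector_diff_chain_at[OF assms(2) DERIV_inverse[OF assms(3)]]]
  by (simp add: o_def divide_inverse power2_eq_square numeral_2_eq_2 algebra_simps)

text \<open>The point of the statement is that C does not depend on the position x of the
  singularity: within distance 1 of x the integral is at most 2/(1-c), and farther away the
  integrand is at most 1.\<close>

lemma nn_integral_abs_powr_bound:
  assumes "0 \<le> c" "c < 1" "a \<le> b"
  shows "\<exists>C\<ge>0. \<forall>x. (\<integral>\<^sup>+ t. ennreal (\<bar>t - x\<bar> powr (- c)) * indicator {a..b} t \<partial>lborel) \<le> ennreal C"
proof (intro exI conjI allI)
  let ?I = "1 / (1 - c)"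
  show "0 \<le> 2 * ?I + (b - a)" using assms by simp
  fix x
  have i0: "(\<integral>\<^sup>+ t. ennreal (\<bar>t\<bar> powr (- c)) * indicator {0..1} t \<partial>lborel) = ennreal ?I"
  proof -
    have "((\<lambda>t. t powr (- c)) has_integral (1 powr (- c + 1) / (- c + 1))) {0..1}"
      by (rule has_integral_powr_from_0) (use assms in auto)
    then have "(\<integral>\<^sup>+ t. ennreal (t powr (- c)) * indicator {0..1} t \<partial>lborel) = ennreal (1 powr (- c + 1) / (- c + 1))"
      by (intro nn_integral_has_integral_lebesgue') auto
    moreover have "(\<integral>\<^sup>+ t. ennreal (\<bar>t\<bar> powr (- c)) * indicator {0..1} t \<partial>lborel)
      = (\<integral>\<^sup>+ t. ennreal (t powr (- c)) * indicator {0..1} t \<partial>lborel)"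
      by (rule nn_integral_cong) (auto split: split_indicator)
    ultimately show ?thesis by simp
  qed
  have i1: "(\<integral>\<^sup>+ t. ennreal (\<bar>t\<bar> powr (- c)) * indicator {-1..0} t \<partial>lborel) = ennreal ?I"
    by (subst nn_integral_real_affine[of _ "-1" 0]) (auto simp: i0[symmetric] intro!: nn_integral_cong split: split_indicator)
  have "(\<integral>\<^sup>+ t. ennreal (\<bar>t - x\<bar> powr (- c)) * indicator {a..b} t \<partial>lborel) \<le>
     (\<integral>\<^sup>+ t. ennreal (\<bar>t - x\<bar> powr (- c)) * indicator {0..1} (t - x) + ennreal (\<bar>t - x\<bar> powr (- c)) * indicator {-1..0} (t - x)
        + indicator {a..b} t \<partial>lborel)"
  proof (rule nn_integral_mono)
    fix t
    have "\<bar>t - x\<bar> powr (- c) \<le> 1" if "\<bar>t - x\<bar> > 1"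
      using that assms powr_mono[of "-c" 0 "\<bar>t - x\<bar>"] by (simp split: if_splits)
    then show "ennreal (\<bar>t - x\<bar> powr (- c)) * indicator {a..b} t \<le>
      ennreal (\<bar>t - x\<bar> powr (- c)) * indicator {0..1} (t - x) + ennreal (\<bar>t - x\<bar> powr (- c)) * indicator {-1..0} (t - x)
        + indicator {a..b} t"
      by (cases "\<bar>t - x\<bar> > 1") (auto split: split_indicator)
  qed
  also have "\<dots> = (\<integral>\<^sup>+ t. ennreal (\<bar>t - x\<bar> powr (- c)) * indicator {0..1} (t - x) \<partial>lborel)
     + (\<integral>\<^sup>+ t. ennreal (\<bar>t - x\<bar> powr (- c)) * indicator {-1..0} (t - x) \<partial>lborel) + ennreal (b - a)"
    using assms by (simp add: nn_integral_add)
  also have "\<dots> = ennreal ?I + ennreal ?I + ennreal (b - a)"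
  proof -
    have sh: "(\<integral>\<^sup>+ t. F (t - x) \<partial>lborel) = (\<integral>\<^sup>+ t. F t \<partial>lborel)" if [measurable]: "F \<in> borel_measurable borel" for F :: "real \<Rightarrow> ennreal"
      by (subst nn_integral_real_affine[of "\<lambda>t. F (t - x)" 1 x]) auto
    show ?thesis
      using sh[of "\<lambda>t. ennreal (\<bar>t\<bar> powr (- c)) * indicator {0..1} t"] sh[of "\<lambda>t. ennreal (\<bar>t\<bar> powr (- c)) * indicator {-1..0} t"]
      by (simp add: i0 i1)
  qed
  also have "\<dots> = ennreal (2 * ?I + (b - a))"
    using assms by (simp add: ennreal_plus[symmetric] del: ennreal_plus)
  finally show "(\<integral>\<^sup>+ t. ennreal (\<bar>t - x\<bar> powr (- c)) * indicator {a..b} t \<partial>lborel) \<le> ennreal (2 * ?I + (b - a))" .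
qed

lemma nn_integral_lborel_pair:
  fixes f :: "'a::euclidean_space \<Rightarrow> 'b::euclidean_space \<Rightarrow> ennreal"
  assumes "(\<lambda>x. f (fst x) (snd x)) \<in> borel_measurable borel"
  shows "(\<integral>\<^sup>+ x. f (fst x) (snd x) \<partial>lborel) = (\<integral>\<^sup>+ a. \<integral>\<^sup>+ b. f a b \<partial>lborel \<partial>lborel)"
proof -
  have "(\<lambda>x. f (fst x) (snd x)) \<in> borel_measurable (lborel \<Otimes>\<^sub>M lborel)" using assms by (simp add: lborel_prod)
  from lborel.nn_integral_fst[OF this] show ?thesis by (simp add: lborel_prod)
qed

text \<open>A constant (equal to pi) that does not depend on z, which is what the continuity
  argument uses.\<close>

definition c_kernel :: real where
  "c_kernel = (\<integral>q. 1 / (1 + (fst q)\<^sup>2 + (snd q)\<^sup>2)\<^sup>2 \<partial>(lborel :: (real \<times> real) measure))"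

text \<open>The integrand is dominated by the product 1/((1+x^2)(1+y^2)).\<close>

lemma integrable_kernel:
  "integrable (lborel :: (real \<times> real) measure) (\<lambda>q. 1 / (1 + (fst q)\<^sup>2 + (snd q)\<^sup>2)\<^sup>2)"
proof (rule integrableI_bounded)
  have one: "(\<integral>\<^sup>+ x. ennreal (1 / (1 + x\<^sup>2)) \<partial>lborel) < \<infinity>"
  proof -
    have "integrable lborel (\<lambda>x::real. inverse (1 + x\<^sup>2))"
      using integrable_inverse_1_plus_square by (simp add: set_integrable_def)
    then show ?thesis by (simp add: integrable_iff_bounded inverse_eq_divide)
  qed
  have "(\<integral>\<^sup>+ q. ennreal (norm (1 / (1 + (fst q)\<^sup>2 + (snd q)\<^sup>2)\<^sup>2)) \<partial>(lborel :: (real \<times> real) measure)) \<le>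
    (\<integral>\<^sup>+ q. ennreal (1 / (1 + (fst q)\<^sup>2)) * ennreal (1 / (1 + (snd q)\<^sup>2)) \<partial>(lborel :: (real \<times> real) measure))"
  proof (rule nn_integral_mono)
    fix q :: "real \<times> real"
    have "(1 + (fst q)\<^sup>2) * (1 + (snd q)\<^sup>2) \<le> (1 + (fst q)\<^sup>2 + (snd q)\<^sup>2)\<^sup>2"
    proof -
      have "(1 + a) * (1 + b) \<le> (1 + a + b)\<^sup>2" if "0 \<le> a" "0 \<le> b" for a b :: real
        using that mult_nonneg_nonneg[OF that] by (simp add: power2_eq_square algebra_simps)
      then show ?thesis by simp
    qed
    moreover have "0 < (1 + (fst q)\<^sup>2) * (1 + (snd q)\<^sup>2)" by (simp add: add_pos_nonneg)
    ultimately show "ennreal (norm (1 / (1 + (fst q)\<^sup>2 + (snd q)\<^sup>2)\<^sup>2)) \<le> ennreal (1 / (1 + (fst q)\<^sup>2)) * ennreal (1 / (1 + (snd q)\<^sup>2))"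
      by (auto simp: ennreal_mult[symmetric] intro!: ennreal_leI divide_left_mono mult_pos_pos simp del: ennreal_mult)
  qed
  also have "\<dots> = (\<integral>\<^sup>+ x. \<integral>\<^sup>+ y. ennreal (1 / (1 + x\<^sup>2)) * ennreal (1 / (1 + y\<^sup>2)) \<partial>lborel \<partial>lborel)"
    by (rule nn_integral_lborel_pair) measurable
  also have "\<dots> = (\<integral>\<^sup>+ x. ennreal (1 / (1 + x\<^sup>2)) \<partial>lborel) * (\<integral>\<^sup>+ x. ennreal (1 / (1 + x\<^sup>2)) \<partial>lborel)"
    by (simp add: nn_integral_cmult nn_integral_multc)
  also have "\<dots> < \<infinity>" using one by (simp add: ennreal_mult_less_top)
  finally show "(\<integral>\<^sup>+ q. ennreal (norm (1 / (1 + (fst q)\<^sup>2 + (snd q)\<^sup>2)\<^sup>2)) \<partial>(lborel :: (real \<times> real) measure)) < \<infinity>" .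
qed measurable

context egg
begin

section \<open>Integrability over the base domain g < 1\<close>

definition GG :: "(real \<times> real) set" where "GG = {p. gp p < 1}"

lemma GG_measurable [measurable]: "GG \<in> sets borel" unfolding GG_def by measurable

lemma cont_gp: "continuous_on UNIV gp" unfolding gp_def[abs_def] by (rule cont_gg)

lemma open_GG: "open GG" unfolding GG_def by (intro open_Collect_less continuous_intros cont_gp)

lemma compact_closed_GG: "compact {p. gp p \<le> 1}"
proof (rule compact_eq_bounded_closed[THEN iffD2], intro conjI)
  show "closed {p. gp p \<le> 1}" by (intro closed_Collect_le continuous_intros cont_gp)
  have "{p. gp p \<le> 1} \<subseteq> cbox (-1, -1) (1, 1)"
  proof
    fix p assume "p \<in> {p. gp p \<le> 1}"
    then show "p \<in> cbox (-1, -1) (1, 1)"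
      using gg_le_1[of "fst p" "snd p"] by (cases p) (auto simp: gp_def)
  qed
  then show "bounded {p. gp p \<le> 1}" by (rule bounded_subset[OF bounded_cbox])
qed

lemma integrable_dda: "integrable lborel (\<lambda>p. indicator GG p *\<^sub>R dda (fst p))"
proof (rule integrableI_bounded)
  obtain C where C: "\<forall>x. (\<integral>\<^sup>+ t. ennreal (\<bar>t - x\<bar> powr (- (2 - m))) * indicator {-1..1} t \<partial>lborel) \<le> ennreal C"
    using nn_integral_abs_powr_bound[of "2 - m" "-1" 1] m by auto
  have C0: "(\<integral>\<^sup>+ t. ennreal (\<bar>t\<bar> powr (m - 2)) * indicator {-1..1} t \<partial>lborel) \<le> ennreal C"
    using C[rule_format, of 0] by simp
  have m1: "0 \<le> m * (m - 1)" "m * (m - 1) \<le> 2" using m mult_mono[of m 2 "m - 1" 1] by auto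
  have "(\<integral>\<^sup>+ p. ennreal (norm (indicator GG p *\<^sub>R dda (fst p))) \<partial>lborel) \<le>
    (\<integral>\<^sup>+ p. ennreal (2 * \<bar>fst p\<bar> powr (m - 2)) * indicator {-1..1} (fst p) * indicator {-1..1} (snd p) \<partial>(lborel :: (real \<times> real) measure))"
  proof (rule nn_integral_mono)
    fix p :: "real \<times> real"
    have "\<bar>dda (fst p)\<bar> \<le> 2 * \<bar>fst p\<bar> powr (m - 2)"
    proof -
      have "0 \<le> dda (fst p)" unfolding dda_def using m_bounds by (intro mult_nonneg_nonneg) auto
      then show ?thesis using mult_right_mono[OF m1(2), of "\<bar>fst p\<bar> powr (m - 2)"] by (simp add: dda_def)
    qed
    then show "ennreal (norm (indicator GG p *\<^sub>R dda (fst p))) \<le>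
       ennreal (2 * \<bar>fst p\<bar> powr (m - 2)) * indicator {-1..1} (fst p) * indicator {-1..1} (snd p)"
      using gg_le_1[of "fst p" "snd p"] by (auto simp: GG_def gp_def ennreal_leI split: split_indicator)
  qed
  also have "\<dots> = (\<integral>\<^sup>+ u. \<integral>\<^sup>+ v. ennreal (2 * \<bar>u\<bar> powr (m - 2)) * indicator {-1..1} u * indicator {-1..1::real} v \<partial>lborel \<partial>lborel)"
    by (rule nn_integral_lborel_pair) measurable
  also have "\<dots> = (\<integral>\<^sup>+ u. ennreal 4 * (ennreal (\<bar>u\<bar> powr (m - 2)) * indicator {-1..1} u) \<partial>lborel)"
  proof (rule nn_integral_cong)
    fix u :: real
    have "ennreal (2 * \<bar>u\<bar> powr (m - 2)) * ennreal 2 = ennreal 4 * ennreal (\<bar>u\<bar> powr (m - 2))"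
      by (subst (1 2) ennreal_mult[symmetric]) auto
    moreover have "(\<integral>\<^sup>+ v. ennreal (2 * \<bar>u\<bar> powr (m - 2)) * indicator {-1..1} u * indicator {-1..1::real} v \<partial>lborel)
       = ennreal (2 * \<bar>u\<bar> powr (m - 2)) * indicator {-1..1} u * ennreal 2"
      by (subst nn_integral_cmult_indicator) auto
    ultimately show "(\<integral>\<^sup>+ v. ennreal (2 * \<bar>u\<bar> powr (m - 2)) * indicator {-1..1} u * indicator {-1..1::real} v \<partial>lborel)
       = ennreal 4 * (ennreal (\<bar>u\<bar> powr (m - 2)) * indicator {-1..1} u)"
      by (auto split: split_indicator)
  qed
  also have "\<dots> = ennreal 4 * (\<integral>\<^sup>+ t. ennreal (\<bar>t\<bar> powr (m - 2)) * indicator {-1..1} t \<partial>lborel)"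
    by (rule nn_integral_cmult) measurable
  also have "\<dots> \<le> ennreal 4 * ennreal C" by (rule mult_left_mono[OF C0]) simp
  also have "\<dots> < \<infinity>" by (simp add: ennreal_mult_less_top)
  finally show "(\<integral>\<^sup>+ p. ennreal (norm (indicator GG p *\<^sub>R dda (fst p))) \<partial>lborel) < \<infinity>" .
qed measurable

text \<open>The integrands over the base have the form P + \<open>dda\<close> times R with P and R
  continuous on the compact set g <= 1, so these two cases suffice. The second one rests on m > 1,
  which makes |u|^(m-2) integrable.\<close>

lemma integrable_weights:
  fixes P :: "real \<times> real \<Rightarrow> complex"
  assumes c: "continuous_on {p. gp p \<le> 1} P"
  shows "integrable lborel (\<lambda>p. indicator GG p *\<^sub>R P p)"
    "integrable lborel (\<lambda>p. indicator GG p *\<^sub>R (of_real (dda (fst p)) * P p))"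
proof -
  have "integrable lborel (\<lambda>p. indicator GG p *\<^sub>R (indicator {p. gp p \<le> 1} p *\<^sub>R P p))"
    
    by (rule integrable_mult_indicator[OF _ borel_integrable_compact[OF compact_closed_GG c]]) (use GG_measurable in simp)
  moreover have "(\<lambda>p. indicator GG p *\<^sub>R (indicator {p. gp p \<le> 1} p *\<^sub>R P p)) = (\<lambda>p. indicator GG p *\<^sub>R P p)"
    by (auto simp: GG_def indicator_def fun_eq_iff)
  ultimately show i: "integrable lborel (\<lambda>p. indicator GG p *\<^sub>R P p)" by (simp only:)
  then have [measurable]: "(\<lambda>p. indicator GG p *\<^sub>R P p) \<in> borel_measurable borel" by auto
  obtain B where B: "\<And>p. gp p \<le> 1 \<Longrightarrow> cmod (P p) \<le> B"
    using compact_imp_bounded[OF compact_continuous_image[OF c compact_closed_GG]] by (auto simp: bounded_iff)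
  show "integrable lborel (\<lambda>p. indicator GG p *\<^sub>R (of_real (dda (fst p)) * P p))"
  proof (rule Bochner_Integration.integrable_bound)
    show "integrable lborel (\<lambda>p. B *\<^sub>R (indicator GG p *\<^sub>R dda (fst p)))"
      by (rule integrable_scaleR_right[OF integrable_dda])
    have "(\<lambda>p. of_real (dda (fst p)) * (indicator GG p *\<^sub>R P p)) \<in> borel_measurable borel" by measurable
    then show "(\<lambda>p. indicator GG p *\<^sub>R (complex_of_real (dda (fst p)) * P p)) \<in> borel_measurable lborel" by (simp add: mult_ac)
    show "AE p in lborel. norm (indicator GG p *\<^sub>R (complex_of_real (dda (fst p)) * P p)) \<le> norm (B *\<^sub>R (indicator GG p *\<^sub>R dda (fst p)))"
    proof (rule AE_I2)
      fix p :: "real \<times> real"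
      have "cmod (P p) * \<bar>dda (fst p)\<bar> \<le> \<bar>B\<bar> * \<bar>dda (fst p)\<bar>" if "p \<in> GG"
        using B[of p] that by (intro mult_right_mono) (auto simp: GG_def)
      then show "norm (indicator GG p *\<^sub>R (complex_of_real (dda (fst p)) * P p)) \<le> norm (B *\<^sub>R (indicator GG p *\<^sub>R dda (fst p)))"
        by (auto simp: norm_mult abs_mult mult_ac split: split_indicator)
    qed
  qed
qed

lemma AA_nz: "gp p \<le> 1 \<Longrightarrow> Gz z < 1 \<Longrightarrow> AA p z \<noteq> 0"
  using AA_lower(2)[of p z] by auto

lemma cont_af: "continuous_on S af"
  unfolding af_def[abs_def]
  by (intro continuous_intros continuous_on_compose2[OF cont_da] continuous_on_compose2[OF cont_db]) auto

lemma cont_tau: "continuous_on S (\<lambda>p. tau p z)"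
  unfolding tau_def Complex_eq by (intro continuous_intros)

lemma cont_gp': "continuous_on S gp" using cont_gp continuous_on_subset by blast

lemma cont_AA: "continuous_on S (\<lambda>p. AA p z)"
  unfolding AA_def by (intro continuous_intros cont_af cont_tau cont_gp')

lemma NN_eq: "of_real (NN p) = 2 * af p * cnj (af p) + of_real (1 - gp p) * of_real ((dda (fst p) + ddb (snd p)) / 2)"
  by (simp add: NN_def af_def grd_def complex_eq_iff power2_eq_square field_simps)

context
  fixes z :: complex and e :: real
  assumes z: "Gz z < 1" and e: "0 < e"
begin

section \<open>The regularised Cauchy kernel and Green's formula\<close>

definition QQ :: "real \<times> real \<Rightarrow> real" where "QQ p = (cmod (tau p z))\<^sup>2 + e\<^sup>2"
definition HH :: "real \<times> real \<Rightarrow> complex" where "HH p = of_real (1 - gp p) * cnj (tau p z)"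
text \<open>The function (1-g)/A times conj(tau)/(|tau|^2 + e^2), a bounded substitute for the
  Cauchy kernel 1/tau. The factor 1 - g makes it vanish on the boundary of the base.\<close>

definition WW :: "real \<times> real \<Rightarrow> complex" where "WW p = HH p / (AA p z * of_real (QQ p))"
text \<open>\<open>Wu0\<close> and \<open>Wu1\<close> collect the terms of the u-derivative of
  \<open>WW\<close> without and with the factor \<open>dda\<close>. Both are continuous on g <= 1,
  as \<open>integrable_weights\<close> requires.\<close>

definition Wu0 :: "real \<times> real \<Rightarrow> complex" where
  "Wu0 p = (of_real (1 - gp p) - of_real (da (fst p)) * cnj (tau p z)) / (AA p z * of_real (QQ p))
     - HH p * ((af p - of_real (da (fst p))) * of_real (QQ p) + AA p z * of_real (2 * Re (tau p z))) / (AA p z * of_real (QQ p))\<^sup>2"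
definition Wu1 :: "real \<times> real \<Rightarrow> complex" where
  "Wu1 p = - HH p * (tau p z / 2 * of_real (QQ p)) / (AA p z * of_real (QQ p))\<^sup>2"
definition Wu :: "real \<times> real \<Rightarrow> complex" where "Wu p = Wu0 p + of_real (dda (fst p)) * Wu1 p"
definition Wv :: "real \<times> real \<Rightarrow> complex" where
  "Wv p = (- \<i> * of_real (1 - gp p) - of_real (db (snd p)) * cnj (tau p z)) / (AA p z * of_real (QQ p))
     - HH p * ((- \<i> * of_real (ddb (snd p)) / 2 * tau p z + \<i> * af p - of_real (db (snd p))) * of_real (QQ p)
        + AA p z * of_real (2 * Im (tau p z))) / (AA p z * of_real (QQ p))\<^sup>2"

lemma QQ_pos: "0 < QQ p" using e by (simp add: QQ_def add_nonneg_pos)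

lemma AQ_nz: "gp p \<le> 1 \<Longrightarrow> AA p z * of_real (QQ p) \<noteq> 0"
  using AA_nz[OF _ z, of p] QQ_pos[of p] by simp

lemma cont_QQ: "continuous_on S QQ" unfolding QQ_def[abs_def] by (intro continuous_intros cont_tau)
lemma cont_HH: "continuous_on S HH" unfolding HH_def[abs_def] by (intro continuous_intros cont_tau cont_gp')

lemmas cont_all = continuous_on_compose2[OF cont_da] continuous_on_compose2[OF cont_db]
  cont_QQ cont_HH cont_AA cont_tau cont_gp' cont_af

lemma cont_WW: "continuous_on {p. gp p \<le> 1} WW"
  unfolding WW_def[abs_def] by (intro continuous_intros cont_all) (use AQ_nz in auto)

lemma cont_ddb: "continuous_on S (\<lambda>p. ddb (snd p))"
  unfolding ddb_def by (intro continuous_intros)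

lemma integrable_Wuv: "integrable lborel (\<lambda>p. indicator GG p *\<^sub>R Wu p)" "integrable lborel (\<lambda>p. indicator GG p *\<^sub>R Wv p)"
proof -
  have "continuous_on {p. gp p \<le> 1} Wu0" "continuous_on {p. gp p \<le> 1} Wu1" "continuous_on {p. gp p \<le> 1} Wv"
    unfolding Wu0_def[abs_def] Wu1_def[abs_def] Wv_def[abs_def]
    by (intro continuous_intros cont_all cont_ddb; use AQ_nz in auto)+
  then show "integrable lborel (\<lambda>p. indicator GG p *\<^sub>R Wu p)" "integrable lborel (\<lambda>p. indicator GG p *\<^sub>R Wv p)"
    using integrable_weights unfolding Wu_def scaleR_add_right by auto
qed

lemma tau_deriv: "((\<lambda>t. tau (t, v) z) has_vector_derivative 1) (at u)" "((\<lambda>t. tau (u, t) z) has_vector_derivative \<i>) (at v)"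
  unfolding tau_def Complex_eq by (auto intro!: derivative_eq_intros)

lemma gp_deriv: "((\<lambda>t. complex_of_real (1 - gp (t, v))) has_vector_derivative - of_real (da u)) (at u)"
   "((\<lambda>t. complex_of_real (1 - gp (u, t))) has_vector_derivative - of_real (db v)) (at v)"
proof -
  have "((\<lambda>t. 1 - gp (t, v)) has_real_derivative - da u) (at u)"
    using DERIV_diff[OF DERIV_const DERIV_add[OF pow_m_deriv[of u] DERIV_const[of "v ^ n"]], of 1] by (simp add: gp_def gg_def)
  from has_vector_derivative_of_real[OF this]
  show "((\<lambda>t. complex_of_real (1 - gp (t, v))) has_vector_derivative - of_real (da u)) (at u)" by simp
  have "((\<lambda>t. 1 - gp (u, t)) has_real_derivative - db v) (at v)"
    using DERIV_diff[OF DERIV_const DERIV_add[OF DERIV_const[of "\<bar>u\<bar> powr m"] pow_n_deriv[of v]], of 1] by (simp add: gp_def gg_def)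
  from has_vector_derivative_of_real[OF this]
  show "((\<lambda>t. complex_of_real (1 - gp (u, t))) has_vector_derivative - of_real (db v)) (at v)" by simp
qed

lemma QQ_deriv: "((\<lambda>t. complex_of_real (QQ (t, v))) has_vector_derivative of_real (2 * Re (tau (u, v) z))) (at u)"
   "((\<lambda>t. complex_of_real (QQ (u, t))) has_vector_derivative of_real (2 * Im (tau (u, v) z))) (at v)"
proof -
  have q: "QQ (a, b) = (a - Re z)\<^sup>2 + (b - Im z)\<^sup>2 + e\<^sup>2" for a b by (simp add: QQ_def cmod_power2 tau_def)
  have "((\<lambda>t. QQ (t, v)) has_real_derivative 2 * Re (tau (u, v) z)) (at u)"
    "((\<lambda>t. QQ (u, t)) has_real_derivative 2 * Im (tau (u, v) z)) (at v)"
    unfolding q by (auto intro!: derivative_eq_intros simp: tau_def)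
  note d = this
  show "((\<lambda>t. complex_of_real (QQ (t, v))) has_vector_derivative of_real (2 * Re (tau (u, v) z))) (at u)"
    by (rule has_vector_derivative_of_real[OF d(1)])
  show "((\<lambda>t. complex_of_real (QQ (u, t))) has_vector_derivative of_real (2 * Im (tau (u, v) z))) (at v)"
    by (rule has_vector_derivative_of_real[OF d(2)])
qed

lemma HH_deriv: "((\<lambda>t. HH (t, v)) has_vector_derivative of_real (1 - gp (u, v)) - of_real (da u) * cnj (tau (u, v) z)) (at u)"
   "((\<lambda>t. HH (u, t)) has_vector_derivative - \<i> * of_real (1 - gp (u, v)) - of_real (db v) * cnj (tau (u, v) z)) (at v)"
  using has_vector_derivative_mult[OF gp_deriv(1)[of v u] has_vector_derivative_cnj[OF tau_deriv(1)[of v u]]]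
    has_vector_derivative_mult[OF gp_deriv(2)[of u v] has_vector_derivative_cnj[OF tau_deriv(2)[of u v]]]
  by (simp_all add: HH_def mult.commute)

lemma af_deriv: "u \<noteq> 0 \<Longrightarrow> ((\<lambda>t. af (t, v)) has_vector_derivative of_real (dda u) / 2) (at u)"
  "((\<lambda>t. af (u, t)) has_vector_derivative - \<i> * of_real (ddb v) / 2) (at v)"
proof -
  assume "u \<noteq> 0"
  from has_vector_derivative_mult_left[OF has_vector_derivative_diff[OF has_vector_derivative_of_real[OF da_deriv[OF this]] has_vector_derivative_const[of "\<i> * of_real (db v)"]], of "1/2"]
  show "((\<lambda>t. af (t, v)) has_vector_derivative of_real (dda u) / 2) (at u)" by (simp add: af_def)
next
  from has_vector_derivative_mult_left[OF has_vector_derivative_diff[OF has_vector_derivative_const[of "of_real (da u)"] has_vector_derivative_mult_right[OF has_vector_derivative_of_real[OF db_deriv[of v]], of "\<i>"]], of "1/2"]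
  show "((\<lambda>t. af (u, t)) has_vector_derivative - \<i> * of_real (ddb v) / 2) (at v)" by (simp add: af_def)
qed

lemma AA_deriv: "u \<noteq> 0 \<Longrightarrow> ((\<lambda>t. AA (t, v) z) has_vector_derivative of_real (dda u) / 2 * tau (u, v) z + af (u, v) - of_real (da u)) (at u)"
  "((\<lambda>t. AA (u, t) z) has_vector_derivative - \<i> * of_real (ddb v) / 2 * tau (u, v) z + \<i> * af (u, v) - of_real (db v)) (at v)"
  using has_vector_derivative_add[OF has_vector_derivative_mult[OF af_deriv(1)[of u v] tau_deriv(1)[of v u]] gp_deriv(1)[of v u]]
    has_vector_derivative_add[OF has_vector_derivative_mult[OF af_deriv(2)[of u v] tau_deriv(2)[of u v]] gp_deriv(2)[of u v]]
  by (simp_all add: AA_def algebra_simps)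

lemma WW_deriv:
  assumes "gp (u, v) \<le> 1"
  shows "u \<noteq> 0 \<Longrightarrow> ((\<lambda>t. WW (t, v)) has_vector_derivative Wu (u, v)) (at u)"
    "((\<lambda>t. WW (u, t)) has_vector_derivative Wv (u, v)) (at v)"
proof -
  have alg1: "a / D - H * (A * q + (d / 2 * t + x - y) * Q) / D\<^sup>2 = a / D - H * ((x - y) * Q + A * q) / D\<^sup>2 + d * (- H * (t / 2 * Q) / D\<^sup>2)"
    for a D H A q d t x y Q :: complex
  proof -
    have "H * (A * q + (d / 2 * t + x - y) * Q) = H * ((x - y) * Q + A * q) + d * (H * (t / 2 * Q))" by (simp add: algebra_simps)
    then show ?thesis by (simp add: add_divide_distrib)
  qed
  assume u: "u \<noteq> 0"
  have *: "((\<lambda>t. WW (t, v)) has_vector_derivative ((of_real (1 - gp (u, v)) - of_real (da u) * cnj (tau (u, v) z)) / (AA (u, v) z * of_real (QQ (u, v)))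
     - HH (u, v) * (AA (u, v) z * of_real (2 * Re (tau (u, v) z)) + (of_real (dda u) / 2 * tau (u, v) z + af (u, v) - of_real (da u)) * of_real (QQ (u, v)))
      / (AA (u, v) z * of_real (QQ (u, v)))\<^sup>2)) (at u)"
    unfolding WW_def
    by (rule has_vector_derivative_divide_complex[OF HH_deriv(1) has_vector_derivative_mult[OF AA_deriv(1)[OF u] QQ_deriv(1)] AQ_nz[OF assms]])
  show "((\<lambda>t. WW (t, v)) has_vector_derivative Wu (u, v)) (at u)"
    using * unfolding alg1 by (simp only: Wu_def Wu0_def Wu1_def fst_conv snd_conv)
next
  have *: "((\<lambda>t. WW (u, t)) has_vector_derivative ((- \<i> * of_real (1 - gp (u, v)) - of_real (db v) * cnj (tau (u, v) z)) / (AA (u, v) z * of_real (QQ (u, v)))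
     - HH (u, v) * (AA (u, v) z * of_real (2 * Im (tau (u, v) z)) + (- \<i> * of_real (ddb v) / 2 * tau (u, v) z + \<i> * af (u, v) - of_real (db v)) * of_real (QQ (u, v)))
      / (AA (u, v) z * of_real (QQ (u, v)))\<^sup>2)) (at v)"
    unfolding WW_def
    by (rule has_vector_derivative_divide_complex[OF HH_deriv(2) has_vector_derivative_mult[OF AA_deriv(2) QQ_deriv(2)] AQ_nz[OF assms]])
  then show "((\<lambda>t. WW (u, t)) has_vector_derivative Wv (u, v)) (at v)"
    by (simp only: Wv_def fst_conv snd_conv add.commute)
qed

lemma WW_boundary: "gp p = 1 \<Longrightarrow> WW p = 0" by (simp add: WW_def HH_def)

lemma gg_slice_u: "v ^ n < 1 \<Longrightarrow> \<exists>U>0. (\<forall>u. gg u v < 1 \<longleftrightarrow> \<bar>u\<bar> < U) \<and> gg U v = 1 \<and> gg (- U) v = 1 \<and> (\<forall>u. gg u v \<le> 1 \<longleftrightarrow> \<bar>u\<bar> \<le> U)"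
proof (intro exI conjI allI)
  assume v: "v ^ n < 1"
  let ?U = "(1 - v ^ n) powr (1 / m)"
  have U: "?U powr m = 1 - v ^ n" using v m_bounds by (simp add: powr_powr)
  show "0 < ?U" using v by simp
  have lt: "\<bar>u\<bar> powr m < ?U powr m \<longleftrightarrow> \<bar>u\<bar> < ?U" for u
    using m_bounds powr_less_mono2[of m "\<bar>u\<bar>" ?U] powr_mono2[of m ?U "\<bar>u\<bar>"] by (cases "\<bar>u\<bar> < ?U") auto
  have le: "\<bar>u\<bar> powr m \<le> ?U powr m \<longleftrightarrow> \<bar>u\<bar> \<le> ?U" for u
    using m_bounds powr_mono2[of m "\<bar>u\<bar>" ?U] powr_less_mono2[of m ?U "\<bar>u\<bar>"] by (cases "\<bar>u\<bar> \<le> ?U") auto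
  show "gg u v < 1 \<longleftrightarrow> \<bar>u\<bar> < ?U" for u using lt[of u] U by (auto simp: gg_def)
  show "gg u v \<le> 1 \<longleftrightarrow> \<bar>u\<bar> \<le> ?U" for u using le[of u] U by (auto simp: gg_def)
  show "gg ?U v = 1" "gg (- ?U) v = 1" using U by (auto simp: gg_def)
qed

lemma gg_slice_v: "\<bar>u\<bar> powr m < 1 \<Longrightarrow> \<exists>V>0. (\<forall>v. gg u v < 1 \<longleftrightarrow> \<bar>v\<bar> < V) \<and> gg u V = 1 \<and> gg u (- V) = 1 \<and> (\<forall>v. gg u v \<le> 1 \<longleftrightarrow> \<bar>v\<bar> \<le> V)"
proof (intro exI conjI allI)
  assume u: "\<bar>u\<bar> powr m < 1"
  let ?V = "root n (1 - \<bar>u\<bar> powr m)"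
  have n0: "0 < n" "even n" using n by auto
  have V: "?V ^ n = 1 - \<bar>u\<bar> powr m" using u n0 by (intro real_root_pow_pos2) auto
  show V0: "0 < ?V" using u n0 by simp
  have ab: "\<bar>v\<bar> ^ n = v ^ n" for v :: real using n0 by (simp add: power_even_abs)
  have "?V ^ n \<le> v ^ n \<longleftrightarrow> ?V \<le> \<bar>v\<bar>" for v
    using power_mono_iff[OF less_imp_le[OF V0] abs_ge_zero n0(1), of v] unfolding ab .
  then have lt: "v ^ n < ?V ^ n \<longleftrightarrow> \<bar>v\<bar> < ?V" for v by (simp only: not_le[symmetric])
  have le: "v ^ n \<le> ?V ^ n \<longleftrightarrow> \<bar>v\<bar> \<le> ?V" for v
    using power_mono_iff[of "\<bar>v\<bar>" ?V n] n0 V0 unfolding ab by (simp only: abs_ge_zero less_imp_le)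
  show "gg u v < 1 \<longleftrightarrow> \<bar>v\<bar> < ?V" for v using lt[of v] V by (auto simp: gg_def)
  show "gg u v \<le> 1 \<longleftrightarrow> \<bar>v\<bar> \<le> ?V" for v using le[of v] V by (auto simp: gg_def)
  show "gg u ?V = 1" "gg u (- ?V) = 1" using V n0 by (auto simp: gg_def)
qed

text \<open>For almost every v the slice is empty or an interval whose endpoints lie on g = 1, where
  \<open>WW\<close> vanishes; the integral of its u-derivative over the slice is therefore 0. The
  exceptional point u = 0 is harmless because \<open>WW\<close> is continuous there.\<close>

lemma integral_Wu: "(\<integral>p. indicator GG p *\<^sub>R Wu p \<partial>lborel) = 0"
proof -
  have i: "integrable (lborel \<Otimes>\<^sub>M lborel) (\<lambda>(u, v). indicator GG (u, v) *\<^sub>R Wu (u, v))"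
    using integrable_Wuv(1) by (simp add: lborel_prod case_prod_unfold)
  have "AE v in lborel. (\<integral>u. indicator GG (u, v) *\<^sub>R Wu (u, v) \<partial>lborel) = 0"
    using lborel_pair.AE_integrable_snd[OF i]
  proof eventually_elim
    case (elim v)
    show ?case
    proof (cases "v ^ n < 1")
      case True
      then obtain U where U: "0 < U" "\<And>u. gg u v < 1 \<longleftrightarrow> \<bar>u\<bar> < U" "gg U v = 1" "gg (- U) v = 1" "\<And>u. gg u v \<le> 1 \<longleftrightarrow> \<bar>u\<bar> \<le> U"
        using gg_slice_u by blast
      have ind: "indicator GG (u, v) = (indicator {-U<..<U} u :: real)" for u
        using U(2)[of u] by (auto simp: GG_def gp_def indicator_def abs_less_iff)
      show ?thesis unfolding ind
      proof (rule integral_slice_zero[of _ _ _ "{0}" "\<lambda>u. WW (u, v)"])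
        show "continuous_on {- U..U} (\<lambda>u. WW (u, v))"
          by (rule continuous_on_compose2[OF cont_WW]) (auto intro!: continuous_intros simp: gp_def U(5))
        show "((\<lambda>u. WW (u, v)) has_vector_derivative Wu (u, v)) (at u)" if "u \<in> {- U<..<U} - {0}" for u
          using that U(5)[of u] by (intro WW_deriv) (auto simp: gp_def)
      qed (use elim U in \<open>auto simp: ind WW_boundary gp_def\<close>)
    next
      case False
      then have "indicator GG (u, v) = (0::real)" for u by (auto simp: GG_def gp_def gg_def indicator_def) (smt (verit) powr_ge_zero)
      then show ?thesis by simp
    qed
  qed
  then have "(\<integral>v. (\<integral>u. indicator GG (u, v) *\<^sub>R Wu (u, v) \<partial>lborel) \<partial>lborel) = 0"
    by (rule integral_eq_zero_AE)
  then show ?thesis using lborel_pair.integral_snd[OF i] by (simp add: lborel_prod case_prod_unfold)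
qed

lemma integral_Wv: "(\<integral>p. indicator GG p *\<^sub>R Wv p \<partial>lborel) = 0"
proof -
  have i: "integrable (lborel \<Otimes>\<^sub>M lborel) (\<lambda>(u, v). indicator GG (u, v) *\<^sub>R Wv (u, v))"
    using integrable_Wuv(2) by (simp add: lborel_prod case_prod_unfold)
  have "AE u in lborel. (\<integral>v. indicator GG (u, v) *\<^sub>R Wv (u, v) \<partial>lborel) = 0"
    using lborel_pair.AE_integrable_fst[OF i]
  proof eventually_elim
    case (elim u)
    show ?case
    proof (cases "\<bar>u\<bar> powr m < 1")
      case True
      then obtain V where V: "0 < V" "\<And>v. gg u v < 1 \<longleftrightarrow> \<bar>v\<bar> < V" "gg u V = 1" "gg u (- V) = 1" "\<And>v. gg u v \<le> 1 \<longleftrightarrow> \<bar>v\<bar> \<le> V"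
        using gg_slice_v by blast
      have ind: "indicator GG (u, v) = (indicator {-V<..<V} v :: real)" for v
        using V(2)[of v] by (auto simp: GG_def gp_def indicator_def abs_less_iff)
      show ?thesis unfolding ind
      proof (rule integral_slice_zero[of _ _ _ "{}" "\<lambda>v. WW (u, v)"])
        show "continuous_on {- V..V} (\<lambda>v. WW (u, v))"
          by (rule continuous_on_compose2[OF cont_WW]) (auto intro!: continuous_intros simp: gp_def V(5))
        show "((\<lambda>v. WW (u, v)) has_vector_derivative Wv (u, v)) (at v)" if "v \<in> {- V<..<V} - {}" for v
          using that V(5)[of v] by (intro WW_deriv) (auto simp: gp_def)
      qed (use elim V in \<open>auto simp: ind WW_boundary gp_def\<close>)
    next
      case False
      have "0 \<le> v ^ n" for v :: real using n by auto
      then have "indicator GG (u, v) = (0::real)" for v using False by (auto simp: GG_def gp_def gg_def indicator_def) (smt (verit))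
      then show ?thesis by simp
    qed
  qed
  then have "(\<integral>u. (\<integral>v. indicator GG (u, v) *\<^sub>R Wv (u, v) \<partial>lborel) \<partial>lborel) = 0"
    by (rule integral_eq_zero_AE)
  then show ?thesis using lborel_pair.integral_fst[OF i] by (simp add: lborel_prod case_prod_unfold)
qed

text \<open>The left side is twice the dbar derivative of \<open>WW\<close>, and the right side is
  the product rule: conj(tau)/Q contributes e^2/Q^2, an approximate identity at z, while the
  derivative of (1-g)/A contributes the second term.\<close>

lemma WW_dbar:
  assumes "gp p \<le> 1"
  shows "Wu p + \<i> * Wv p = 2 * (of_real (1 - gp p) / AA p z) * (of_real (e\<^sup>2) / (of_real (QQ p))\<^sup>2)
     - of_real ((cmod (tau p z))\<^sup>2 / QQ p) * (of_real (NN p) / (AA p z)\<^sup>2)"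
proof -
  define A Q g1 t t' x y L M where defs: "A = AA p z" "Q = complex_of_real (QQ p)" "g1 = complex_of_real (1 - gp p)" "t = tau p z" "t' = cnj (tau p z)"
     "x = complex_of_real (da (fst p))" "y = complex_of_real (db (snd p))" "L = complex_of_real (dda (fst p))" "M = complex_of_real (ddb (snd p))"
  have nz: "A \<noteq> 0" "Q \<noteq> 0" using AQ_nz[OF assms] by (auto simp: defs)
  have tt: "complex_of_real ((cmod (tau p z))\<^sup>2) = t * t'" unfolding defs by (simp add: complex_norm_square[symmetric])
  have E: "complex_of_real (e\<^sup>2) = Q - t * t'" unfolding tt[symmetric] by (simp add: defs QQ_def)
  have re: "complex_of_real (2 * Re t) = t + t'" "complex_of_real (2 * Im t) = - \<i> * (t - t')"
    by (auto simp: defs complex_eq_iff)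
  have A: "A = (x - \<i> * y) / 2 * t + g1" by (simp add: defs AA_def af_def)
  have N: "complex_of_real (NN p) = (x - \<i> * y) * (x + \<i> * y) / 2 + g1 * (L + M) / 2"
    unfolding NN_eq by (simp add: defs af_def)
  have comb: "a / D - b / D\<^sup>2 + l * (- h * k / D\<^sup>2) + \<i> * (c / D - d / D\<^sup>2) = ((a + \<i> * c) * D - (b + l * (h * k) + \<i> * d)) / D\<^sup>2"
    if "D \<noteq> 0" for a b c d l h k D :: complex
    using that by (simp add: diff_divide_distrib add_divide_distrib power2_eq_square algebra_simps)
  have "Wu p + \<i> * Wv p = (((g1 - x * t') + \<i> * (- \<i> * g1 - y * t')) * (A * Q) -
     (g1 * t' * (((x - \<i> * y) / 2 - x) * Q + A * (t + t')) + L * (g1 * t' * (t / 2 * Q))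
      + \<i> * (g1 * t' * ((- \<i> * M / 2 * t + \<i> * ((x - \<i> * y) / 2) - y) * Q + A * (- \<i> * (t - t')))))) / (A * Q)\<^sup>2"
    unfolding Wu_def Wu0_def Wu1_def Wv_def HH_def af_def defs(5)[symmetric] unfolding defs(4)[symmetric] re unfolding defs(1-3,6-9)[symmetric]
    by (rule comb) (use nz in simp)
  also have "\<dots> = (2 * g1 * (Q - t * t') * A - t * t' * ((x - \<i> * y) * (x + \<i> * y) / 2 + g1 * (L + M) / 2) * Q) / (A * Q)\<^sup>2"
    by (rule arg_cong[where f="\<lambda>X. X / (A * Q)\<^sup>2"]) (simp add: A field_simps)
  also have "\<dots> = 2 * (g1 / A) * ((Q - t * t') / Q\<^sup>2) - t * t' / Q * (((x - \<i> * y) * (x + \<i> * y) / 2 + g1 * (L + M) / 2) / A\<^sup>2)"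
  proof -
    have gen: "(a * A - b * Q) / (A * Q)\<^sup>2 = a / (A * Q\<^sup>2) - b / (A\<^sup>2 * Q)" for a b
      using nz by (simp add: field_simps power2_eq_square)
    show ?thesis unfolding gen by (simp add: mult_ac)
  qed
  finally show ?thesis
    unfolding E N[symmetric] of_real_divide tt by (simp add: defs)
qed

end

lemma integral_lborel_affine2:
  fixes f :: "real \<times> real \<Rightarrow> complex"
  assumes [measurable]: "f \<in> borel_measurable borel" and c: "c > 0"
  shows "(\<integral>p. f p \<partial>lborel) = (\<integral>q. of_real (c\<^sup>2) * f (t + c *\<^sub>R q) \<partial>lborel)"
proof -
  have "(\<integral>p. f p \<partial>lborel) = (\<integral>p. f p \<partial>density (distr lborel borel (\<lambda>q. t + c *\<^sub>R q)) (\<lambda>_. \<bar>c\<bar>^DIM(real \<times> real)))"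
    using lborel_affine[of c t] c by simp
  also have "\<dots> = (\<integral>q. (\<bar>c\<bar>^DIM(real \<times> real)) *\<^sub>R f (t + c *\<^sub>R q) \<partial>lborel)"
    by (subst integral_density) (auto simp: integral_distr)
  finally show ?thesis using c by (simp add: scaleR_conv_of_real power2_eq_square)
qed

lemma integrable_NN_AA:
  assumes z: "Gz z < 1"
  shows "integrable lborel (\<lambda>p. indicator GG p *\<^sub>R (of_real (NN p) / (AA p z)\<^sup>2))"
proof -
  let ?P = "\<lambda>p. (of_real (grd p) / 2 + of_real ((1 - gp p) * ddb (snd p) / 2)) / (AA p z)\<^sup>2"
  let ?R = "\<lambda>p. of_real ((1 - gp p) / 2) / (AA p z)\<^sup>2"
  have 1: "continuous_on {p. gp p \<le> 1} ?P" "continuous_on {p. gp p \<le> 1} ?R"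
    unfolding grd_def ddb_def
    by (intro continuous_intros cont_AA cont_gp' continuous_on_compose2[OF cont_da] continuous_on_compose2[OF cont_db]; use AA_nz[OF _ z] in auto)+
  have "indicator GG p *\<^sub>R (of_real (NN p) / (AA p z)\<^sup>2) = indicator GG p *\<^sub>R ?P p + indicator GG p *\<^sub>R (of_real (dda (fst p)) * ?R p)" for p
    unfolding scaleR_add_right[symmetric] NN_def by (simp add: add_divide_distrib[symmetric] algebra_simps)
  then show ?thesis using integrable_weights(1)[OF 1(1)] integrable_weights(2)[OF 1(2)] by simp
qed

lemma AE_tau_nz: "AE p in lborel. tau p z \<noteq> 0"
proof -
  have "p = (Re z, Im z)" if "tau p z = 0" for p
  proof -
    have "Complex (fst p) (snd p) = z" using that unfolding tau_def by (simp only: right_minus_eq)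
    then show ?thesis by (metis complex.sel prod.collapse)
  qed
  then have "{p. tau p z = 0} \<subseteq> {(Re z, Im z)}" by blast
  then have "{p. tau p z = 0} \<in> null_sets lborel" by (rule finite_imp_null_set_lborel[OF finite_subset]) simp
  from AE_not_in[OF this] show ?thesis by simp
qed

text \<open>Green's formula without boundary term: the integral of the dbar derivative of
  \<open>WW\<close> over the base is 0, so the integrals of the two terms of \<open>WW_dbar\<close>
  balance.\<close>

lemma integral_regularised:
  assumes z: "Gz z < 1" and e: "0 < e"
  shows "(\<integral>p. of_real ((cmod (tau p z))\<^sup>2 / ((cmod (tau p z))\<^sup>2 + e\<^sup>2)) * (indicator GG p *\<^sub>R (of_real (NN p) / (AA p z)\<^sup>2)) \<partial>lborel)
    = 2 * (\<integral>p. indicator GG p *\<^sub>R (of_real (1 - gp p) / AA p z * (of_real (e\<^sup>2) / (of_real ((cmod (tau p z))\<^sup>2 + e\<^sup>2))\<^sup>2)) \<partial>lborel)"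
proof -
  let ?Q = "\<lambda>p. (cmod (tau p z))\<^sup>2 + e\<^sup>2"
  let ?R = "\<lambda>p. of_real (1 - gp p) / AA p z * (of_real (e\<^sup>2) / (of_real (?Q p))\<^sup>2)"
  let ?L = "\<lambda>p. of_real ((cmod (tau p z))\<^sup>2 / ?Q p) * (indicator GG p *\<^sub>R (of_real (NN p) / (AA p z)\<^sup>2))"
  have Q0: "?Q p > 0" for p using e by (simp add: add_nonneg_pos)
  then have Q0': "complex_of_real (?Q p) \<noteq> 0" for p by (metis less_irrefl of_real_eq_0_iff)
  have "continuous_on {p. gp p \<le> 1} ?R"
    by (intro continuous_intros cont_AA cont_gp' cont_tau) (use AA_nz[OF _ z] Q0' in auto)
  then have iR: "integrable lborel (\<lambda>p. indicator GG p *\<^sub>R ?R p)" by (rule integrable_weights)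
  have iL: "integrable lborel ?L"
  proof (rule Bochner_Integration.integrable_bound[OF integrable_NN_AA[OF z]])
    have "(\<lambda>p. complex_of_real ((cmod (tau p z))\<^sup>2 / ?Q p)) \<in> borel_measurable borel"
      using Q0 by (intro borel_measurable_continuous_onI continuous_intros cont_tau) (metis less_irrefl)
    then show "?L \<in> borel_measurable lborel"
      using borel_measurable_integrable[OF integrable_NN_AA[OF z]] by (intro borel_measurable_times) auto
    have "cmod (of_real ((cmod (tau p z))\<^sup>2 / ?Q p)) \<le> 1" for p
      unfolding norm_of_real using Q0[of p] by (simp add: divide_le_eq)
    then show "AE p in lborel. norm (?L p) \<le> norm (indicator GG p *\<^sub>R (of_real (NN p) / (AA p z)\<^sup>2))"
      by (intro AE_I2) (metis norm_mult mult_left_le_one_le norm_ge_zero)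
  qed
  have "0 = (\<integral>p. indicator GG p *\<^sub>R Wu z e p \<partial>lborel) + \<i> * (\<integral>p. indicator GG p *\<^sub>R Wv z e p \<partial>lborel)"
    using integral_Wu[OF z e] integral_Wv[OF z e] by simp
  also have "\<dots> = (\<integral>p. indicator GG p *\<^sub>R Wu z e p + \<i> * (indicator GG p *\<^sub>R Wv z e p) \<partial>lborel)"
    using Bochner_Integration.integral_add[OF integrable_Wuv(1)[OF z e] integrable_mult_right[OF integrable_Wuv(2)[OF z e], of \<i>]]
    by (simp only: integral_mult_right_zero)
  also have "\<dots> = (\<integral>p. 2 * (indicator GG p *\<^sub>R ?R p) - ?L p \<partial>lborel)"
  proof (rule Bochner_Integration.integral_cong[OF refl])
    fix p
    show "indicator GG p *\<^sub>R Wu z e p + \<i> * (indicator GG p *\<^sub>R Wv z e p) = 2 * (indicator GG p *\<^sub>R ?R p) - ?L p"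
    proof (cases "p \<in> GG")
      case True
      then have i1: "indicator GG p = (1::real)" and g: "gp p \<le> 1" by (simp_all add: GG_def)
      show ?thesis unfolding i1 scaleR_one WW_dbar[OF z e g] QQ_def[OF z e] by (simp only: mult.assoc)
    qed simp
  qed
  also have "\<dots> = 2 * (\<integral>p. indicator GG p *\<^sub>R ?R p \<partial>lborel) - (\<integral>p. ?L p \<partial>lborel)"
    using Bochner_Integration.integral_diff[OF integrable_mult_right[OF iR, of 2] iL] by (simp only: integral_mult_right_zero)
  finally show ?thesis unfolding eq_commute[of 0] right_minus_eq by (rule sym)
qed

text \<open>The Cauchy-Pompeiu formula for (1 - g)/A, with the Cauchy kernel regularised near its pole and
  the regularisation parameter sent to zero.\<close>
lemma integral_NN_AA:
  assumes z: "Gz z < 1"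
  shows "(\<integral>p. indicator GG p *\<^sub>R (of_real (NN p) / (AA p z)\<^sup>2) \<partial>lborel) = 2 * of_real c_kernel"
proof -
  define e where "e k = 1 / real (Suc k)" for k
  have e: "0 < e k" for k by (simp add: e_def)
  have e0: "e \<longlonglongrightarrow> 0" unfolding e_def[abs_def] by (rule LIMSEQ_Suc[OF lim_1_over_n])
  let ?B = "\<lambda>p. indicator GG p *\<^sub>R (of_real (NN p) / (AA p z)\<^sup>2)"
  let ?q = "\<lambda>k p. (cmod (tau p z))\<^sup>2 / ((cmod (tau p z))\<^sup>2 + (e k)\<^sup>2)"
  note iB = integrable_NN_AA[OF z]
  have Bm: "?B \<in> borel_measurable borel" using iB by auto
  have L: "(\<lambda>k. \<integral>p. of_real (?q k p) * ?B p \<partial>lborel) \<longlonglongrightarrow> (\<integral>p. ?B p \<partial>lborel)"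
  proof (rule integral_dominated_convergence[where w="\<lambda>p. norm (?B p)"])
    show "(\<lambda>p. of_real (?q k p) * ?B p) \<in> borel_measurable lborel" for k
    proof -
      have "(\<lambda>p. complex_of_real (?q k p)) \<in> borel_measurable borel"
        using e[of k] by (intro borel_measurable_continuous_onI continuous_intros cont_tau) (auto simp: add_nonneg_eq_0_iff)
      from borel_measurable_times[OF this Bm] show ?thesis by (simp only: measurable_lborel2)
    qed
    show "integrable lborel (\<lambda>p. norm (?B p))" using iB by (rule integrable_norm)
    show "AE p in lborel. (\<lambda>k. of_real (?q k p) * ?B p) \<longlonglongrightarrow> ?B p"
      using AE_tau_nz[of z]
    proof eventually_elim
      case (elim p)
      have "(\<lambda>k. ?q k p) \<longlonglongrightarrow> (cmod (tau p z))\<^sup>2 / ((cmod (tau p z))\<^sup>2 + 0\<^sup>2)"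
        using elim by (intro tendsto_intros e0) auto
      then have "(\<lambda>k. ?q k p) \<longlonglongrightarrow> 1" using elim by simp
      then have "(\<lambda>k. of_real (?q k p) * ?B p) \<longlonglongrightarrow> of_real 1 * ?B p" by (intro tendsto_intros)
      then show ?case by simp
    qed
    show "AE p in lborel. norm (of_real (?q k p) * ?B p) \<le> norm (?B p)" for k
    proof (rule AE_I2)
      fix p
      have "cmod (of_real (?q k p)) \<le> 1"
        unfolding norm_of_real using e[of k] by (simp add: divide_le_eq add_nonneg_pos)
      then show "norm (of_real (?q k p) * ?B p) \<le> norm (?B p)" by (metis norm_mult mult_left_le_one_le norm_ge_zero)
    qed
  qed (simp only: measurable_lborel2 Bm)
  let ?zz = "(Re z, Im z)"
  let ?E = "\<lambda>p. indicator GG p *\<^sub>R (of_real (1 - gp p) / AA p z)"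
  let ?k = "\<lambda>q :: real \<times> real. 1 / (1 + (fst q)\<^sup>2 + (snd q)\<^sup>2)\<^sup>2"
  have Ec: "continuous_on {p. gp p \<le> 1} (\<lambda>p. of_real (1 - gp p) / AA p z)"
    by (intro continuous_intros cont_AA cont_gp') (use AA_nz[OF _ z] in auto)
  obtain C where C: "\<And>p. gp p \<le> 1 \<Longrightarrow> cmod (of_real (1 - gp p) / AA p z) \<le> C"
    using compact_imp_bounded[OF compact_continuous_image[OF Ec compact_closed_GG]] by (auto simp: bounded_iff)
  have "gp ?zz \<le> 1" using z by (simp add: Gz_def gp_def)
  from C[OF this] have C0: "0 \<le> C" by (rule order_trans[OF norm_ge_zero])
  have Em [measurable]: "?E \<in> borel_measurable borel" using integrable_weights(1)[OF Ec] by auto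
  \<comment> \<open>The substitution p = z + e q turns (e^2/Q^2) dp into the fixed kernel of
    \<open>c_kernel\<close>, so that as e tends to 0 only the value of (1-g)/A at z
    survives.\<close>
  have R: "(\<integral>p. indicator GG p *\<^sub>R (of_real (1 - gp p) / AA p z * (of_real ((e k)\<^sup>2) / (of_real ((cmod (tau p z))\<^sup>2 + (e k)\<^sup>2))\<^sup>2)) \<partial>lborel)
     = (\<integral>q. ?E (?zz + e k *\<^sub>R q) * of_real (?k q) \<partial>lborel)" for k
  proof -
    let ?r = "\<lambda>p. of_real ((e k)\<^sup>2) / (complex_of_real ((cmod (tau p z))\<^sup>2 + (e k)\<^sup>2))\<^sup>2"
    have "complex_of_real ((cmod (tau p z))\<^sup>2 + (e k)\<^sup>2) \<noteq> 0" for p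
      using e[of k] by (metis add_nonneg_pos less_irrefl of_real_eq_0_iff zero_le_power2 zero_less_power)
    then have rm: "?r \<in> borel_measurable borel"
      by (intro borel_measurable_continuous_onI continuous_intros cont_tau) auto
    have "(\<integral>p. ?E p * ?r p \<partial>lborel) = (\<integral>q. of_real ((e k)\<^sup>2) * (?E (?zz + e k *\<^sub>R q) * ?r (?zz + e k *\<^sub>R q)) \<partial>lborel)"
      by (rule integral_lborel_affine2[OF borel_measurable_times[OF Em rm] e])
    also have "\<dots> = (\<integral>q. ?E (?zz + e k *\<^sub>R q) * of_real (?k q) \<partial>lborel)"
    proof (rule Bochner_Integration.integral_cong[OF refl])
      fix q :: "real \<times> real"
      have "(cmod (tau (?zz + e k *\<^sub>R q) z))\<^sup>2 + (e k)\<^sup>2 = (e k)\<^sup>2 * (1 + (fst q)\<^sup>2 + (snd q)\<^sup>2)"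
        by (simp add: tau_def cmod_power2 power_mult_distrib algebra_simps)
      then have "of_real ((e k)\<^sup>2) * ?r (?zz + e k *\<^sub>R q) = of_real ((e k)\<^sup>2 * ((e k)\<^sup>2 / ((e k)\<^sup>2 * (1 + (fst q)\<^sup>2 + (snd q)\<^sup>2))\<^sup>2))"
        by simp
      also have "(e k)\<^sup>2 * ((e k)\<^sup>2 / ((e k)\<^sup>2 * (1 + (fst q)\<^sup>2 + (snd q)\<^sup>2))\<^sup>2) = ?k q"
        using e[of k] by (simp add: power_mult_distrib power2_eq_square)
      finally have eq: "of_real ((e k)\<^sup>2) * ?r (?zz + e k *\<^sub>R q) = of_real (?k q)" .
      show "of_real ((e k)\<^sup>2) * (?E (?zz + e k *\<^sub>R q) * ?r (?zz + e k *\<^sub>R q)) = ?E (?zz + e k *\<^sub>R q) * of_real (?k q)"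
        unfolding eq[symmetric] by (rule mult.left_commute)
    qed
    finally show ?thesis unfolding mult_scaleR_left .
  qed
  have "(\<lambda>k. \<integral>q. ?E (?zz + e k *\<^sub>R q) * of_real (?k q) \<partial>lborel) \<longlonglongrightarrow> (\<integral>q. of_real (?k q) \<partial>lborel)"
  proof (rule integral_dominated_convergence[where w="\<lambda>q. C * ?k q"])
    show "integrable lborel (\<lambda>q. C * ?k q)" by (intro integrable_mult_right integrable_kernel)
    have "1 + (fst q)\<^sup>2 + (snd q)\<^sup>2 \<noteq> 0" for q :: "real \<times> real" by (smt (verit) zero_le_power2)
    then have km: "(\<lambda>q. complex_of_real (?k q)) \<in> borel_measurable borel"
      by (intro borel_measurable_continuous_onI continuous_intros) auto
    then show "(\<lambda>q. complex_of_real (?k q)) \<in> borel_measurable lborel" by (simp only: measurable_lborel2)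
    show "(\<lambda>q. ?E (?zz + e k *\<^sub>R q) * of_real (?k q)) \<in> borel_measurable lborel" for k
    proof -
      have "(\<lambda>q. ?zz + e k *\<^sub>R q) \<in> borel_measurable borel"
        by (intro borel_measurable_continuous_onI continuous_intros)
      from borel_measurable_times[OF measurable_compose[OF this Em] km] show ?thesis by (simp only: measurable_lborel2)
    qed
    show "AE q in lborel. norm (?E (?zz + e k *\<^sub>R q) * of_real (?k q)) \<le> C * ?k q" for k
    proof (rule AE_I2)
      fix q
      have "norm (?E p) \<le> C" for p using C[of p] C0 by (auto simp: GG_def split: split_indicator)
      moreover have "cmod (of_real (?k q)) = ?k q" unfolding norm_of_real by (rule abs_of_nonneg) simp
      ultimately show "norm (?E (?zz + e k *\<^sub>R q) * of_real (?k q)) \<le> C * ?k q"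
        unfolding norm_mult by (metis mult_right_mono norm_ge_zero)
    qed
    show "AE q in lborel. (\<lambda>k. ?E (?zz + e k *\<^sub>R q) * of_real (?k q)) \<longlonglongrightarrow> of_real (?k q)"
    proof (rule AE_I2)
      fix q :: "real \<times> real"
      have zG: "?zz \<in> GG" using z by (simp add: GG_def gp_def Gz_def)
      have lim: "(\<lambda>k. ?zz + e k *\<^sub>R q) \<longlonglongrightarrow> ?zz"
        using tendsto_add[OF tendsto_const[of ?zz] tendsto_scaleR[OF e0 tendsto_const[of q]]] by simp
      have "continuous_on GG ?E"
        by (rule continuous_on_eq[OF continuous_on_subset[OF Ec]]) (auto simp: GG_def)
      then have "isCont ?E ?zz" using zG open_GG continuous_on_eq_continuous_at by blast
      then have "(\<lambda>k. ?E (?zz + e k *\<^sub>R q)) \<longlonglongrightarrow> ?E ?zz" using lim isCont_tendsto_compose by blast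
      \<comment> \<open>At p = z the term with tau drops out and A equals 1 - g, so the limit no
        longer depends on z.\<close>
      moreover have "?E ?zz = 1"
      proof -
        have "AA ?zz z = of_real (1 - gp ?zz)" by (simp add: AA_def tau_def)
        moreover have "1 - gp ?zz > 0" using zG by (simp add: GG_def)
        ultimately show ?thesis using zG by (simp del: of_real_diff)
      qed
      ultimately have "(\<lambda>k. ?E (?zz + e k *\<^sub>R q) * of_real (?k q)) \<longlonglongrightarrow> 1 * of_real (?k q)" by (intro tendsto_intros) simp
      then show "(\<lambda>k. ?E (?zz + e k *\<^sub>R q) * of_real (?k q)) \<longlonglongrightarrow> of_real (?k q)" by simp
    qed
  qed
  then have "(\<lambda>k. 2 * (\<integral>q. ?E (?zz + e k *\<^sub>R q) * of_real (?k q) \<partial>lborel)) \<longlonglongrightarrow> 2 * (\<integral>q. of_real (?k q) \<partial>lborel)"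
    by (intro tendsto_intros)
  moreover have "(\<integral>q. complex_of_real (?k q) \<partial>lborel) = of_real c_kernel" unfolding c_kernel_def by (rule integral_complex_of_real)
  ultimately have "(\<lambda>k. \<integral>p. of_real (?q k p) * ?B p \<partial>lborel) \<longlonglongrightarrow> 2 * of_real c_kernel"
    unfolding integral_regularised[OF z e] R by simp
  then show ?thesis using L LIMSEQ_unique by blast
qed

end

subsection \<open>Continuous extension to the closure\<close>

text \<open>From |sin y - y| <= |y|^3 / 6 and y^2 <= 3 on the interval.\<close>

lemma abs_sin_ge_half: assumes "\<bar>y\<bar> \<le> pi / 2" shows "\<bar>y\<bar> / 2 \<le> \<bar>sin y\<bar>"
proof -
  have "\<bar>sin y - (\<Sum>i<3. sin_coeff i * y ^ i)\<bar> \<le> inverse (fact 3) * \<bar>y\<bar> ^ 3" by (rule Maclaurin_sin_bound)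
  moreover have "(\<Sum>i<3. sin_coeff i * y ^ i) = y" by (simp add: numeral_3_eq_3 sin_coeff_def)
  ultimately have 1: "\<bar>sin y - y\<bar> \<le> \<bar>y\<bar> ^ 3 / 6" by (simp add: fact_numeral)
  have "\<bar>y\<bar> \<le> 8 / 5" 
  proof -
    have "pi \<le> 16 / 5" using pi_approx(2) by simp
    then show ?thesis using assms by (simp add: field_simps)
  qed
  then have "\<bar>y\<bar>\<^sup>2 \<le> 3" using power_mono[of "\<bar>y\<bar>" "8/5" 2] by (simp add: power2_eq_square)
  then have "\<bar>y\<bar>\<^sup>2 * \<bar>y\<bar> \<le> 3 * \<bar>y\<bar>" by (intro mult_right_mono) auto
  then have "\<bar>y\<bar> ^ 3 \<le> 3 * \<bar>y\<bar>" by (simp add: power3_eq_cube power2_eq_square)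
  then have "\<bar>sin y - y\<bar> \<le> \<bar>y\<bar> / 2" using 1 by (simp add: field_simps)
  moreover have "\<bar>y\<bar> \<le> \<bar>sin y\<bar> + \<bar>sin y - y\<bar>" by linarith
  ultimately show ?thesis by (simp add: field_simps)
qed

text \<open>The range of t is that of theta + phi with theta in [0, 2 pi] and phi an argument in
  (-pi, pi]; it meets five multiples of pi.\<close>

lemma abs_sin_near_multiple:
  assumes "- pi \<le> t" "t \<le> 3 * pi"
  shows "\<exists>k\<in>{-1..3::int}. \<bar>t - k * pi\<bar> / 2 \<le> \<bar>sin t\<bar>"
proof
  let ?k = "round (t / pi)"
  have r: "\<bar>of_int ?k - t / pi\<bar> \<le> 1 / 2" by (rule of_int_round_abs_le)
  have "- 1 \<le> t / pi" "t / pi \<le> 3" using assms by (simp_all add: field_simps)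
  then have "of_int ?k > (- 2 :: real)" "of_int ?k < (4 :: real)" using r by linarith+
  then show "?k \<in> {-1..3}" by simp
  have "\<bar>of_int ?k - t / pi\<bar> * pi \<le> 1 / 2 * pi" using r by (intro mult_right_mono) auto
  moreover have "\<bar>of_int ?k - t / pi\<bar> * pi = \<bar>- (t - ?k * pi)\<bar>"
  proof -
    have "(of_int ?k - t / pi) * pi = - (t - ?k * pi)" by (simp add: field_simps)
    then show ?thesis by (metis abs_mult abs_of_pos pi_gt_zero)
  qed
  ultimately have "\<bar>t - ?k * pi\<bar> \<le> pi / 2" by (simp only: abs_minus_cancel)
  then have "\<bar>t - ?k * pi\<bar> / 2 \<le> \<bar>sin (t - ?k * pi)\<bar>" by (rule abs_sin_ge_half)
  also have "\<bar>sin (t - ?k * pi)\<bar> = \<bar>sin t\<bar>"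
    by (simp add: sin_diff mult.commute[of _ pi] sin_int_times_real cos_int_times_real abs_mult)
  finally show "\<bar>t - ?k * pi\<bar> / 2 \<le> \<bar>sin t\<bar>" .
qed

text \<open>If |B| <= |A|/2, the integrand is comparable to |A|^(-c). Otherwise write A/B = l e^(i
  phi); then |A - B e^(-it)| >= |B| |sin(t + phi)|, which vanishes linearly at multiples of pi, and
  a power c < 1 of it is integrable. The case |B| = |A|, which can occur for z on the boundary, is
  included.\<close>

lemma circle_integral_bound:
  assumes c: "0 < c" "c < 1"
  shows "\<exists>C\<ge>0. \<forall>A B. A \<noteq> 0 \<longrightarrow> cmod B \<le> cmod A \<longrightarrow>
    (\<integral>\<^sup>+ t. ennreal (cmod (A - B * cis (- t)) powr (- c)) * indicator {0..2*pi} t \<partial>lborel) \<le> ennreal (C * cmod A powr (- c))"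
proof -
  obtain C where C: "0 \<le> C" "\<And>x. (\<integral>\<^sup>+ t. ennreal (\<bar>t - x\<bar> powr (- c)) * indicator {0..2*pi} t \<partial>lborel) \<le> ennreal C"
    using nn_integral_abs_powr_bound[of c 0 "2 * pi"] c by auto
  let ?K = "2 powr c * (2 * pi) + 5 * (4 powr c * C)"
  show ?thesis
  proof (intro exI[of _ ?K] conjI allI impI)
    show "0 \<le> ?K" using C c by simp
    fix A B :: complex
    assume A: "A \<noteq> 0" and B: "cmod B \<le> cmod A"
    define M where "M = cmod A"
    have M: "0 < M" using A by (simp add: M_def)
    have pw: "x powr (- c) \<le> y powr (- c)" if "0 < y" "y \<le> x" for x y :: real
      using that c by (intro powr_mono2') auto
    show "(\<integral>\<^sup>+ t. ennreal (cmod (A - B * cis (- t)) powr (- c)) * indicator {0..2*pi} t \<partial>lborel) \<le> ennreal (?K * cmod A powr (- c))"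
    proof (cases "cmod B \<le> cmod A / 2")
      case True
      have "(\<integral>\<^sup>+ t. ennreal (cmod (A - B * cis (- t)) powr (- c)) * indicator {0..2*pi} t \<partial>lborel)
        \<le> (\<integral>\<^sup>+ t. ennreal ((M / 2) powr (- c)) * indicator {0..2*pi} t \<partial>lborel)"
      proof (intro nn_integral_mono mult_right_mono ennreal_leI pw)
        fix t
        have "cmod A - cmod (B * cis (- t)) \<le> cmod (A - B * cis (- t))" by (rule norm_triangle_ineq2)
        then show "M / 2 \<le> cmod (A - B * cis (- t))" using True by (simp add: M_def norm_mult)
      qed (use M in auto)
      also have "\<dots> = ennreal ((M / 2) powr (- c)) * ennreal (2 * pi)"
        by (subst nn_integral_cmult_indicator) auto
      also have "\<dots> = ennreal ((M / 2) powr (- c) * (2 * pi))" by (simp add: ennreal_mult'')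
      also have "(M / 2) powr (- c) * (2 * pi) = 2 powr c * (2 * pi) * M powr (- c)"
        using M by (simp add: powr_divide powr_minus field_simps)
      also have "\<dots> \<le> ?K * M powr (- c)" using C c by (intro mult_right_mono) auto
      finally show ?thesis using ennreal_leI by (auto simp: M_def)
    next
      case False
      then have B0: "B \<noteq> 0" using A by auto
      define l where "l = cmod (A / B)"
      define \<phi> where "\<phi> = Arg (A / B)"
      have AB: "A = B * (of_real l * cis \<phi>)"
        using B0 rcis_cmod_Arg[of "A / B"] by (simp add: l_def \<phi>_def rcis_def)
      have ph: "- pi < \<phi>" "\<phi> \<le> pi" using Arg_bounded[of "A / B"] by (auto simp: \<phi>_def)
      have lower: "M / 2 * \<bar>sin (t + \<phi>)\<bar> \<le> cmod (A - B * cis (- t))" for t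
      proof -
        have "A - B * cis (- t) = B * cis \<phi> * (of_real l - cis (- (t + \<phi>)))"
          unfolding AB by (simp add: algebra_simps cis_mult)
        then have "cmod (A - B * cis (- t)) = cmod B * cmod (of_real l - cis (- (t + \<phi>)))" by (simp add: norm_mult)
        moreover have "\<bar>sin s\<bar> \<le> cmod (of_real l - cis (- s))" for s
          using abs_Im_le_cmod[of "of_real l - cis (- s)"] by simp
        from this[of "t + \<phi>"] have "M / 2 * \<bar>sin (t + \<phi>)\<bar> \<le> cmod B * cmod (of_real l - cis (- (t + \<phi>)))"
          using False M by (intro mult_mono) (auto simp: M_def)
        ultimately show ?thesis by simp
      qed
      let ?S = "\<Union>k\<in>{-1..3::int}. {k * pi - \<phi>}"
      have ae: "AE t in lborel. t \<notin> ?S"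
        by (rule AE_not_in, rule finite_imp_null_set_lborel) auto
      have "(\<integral>\<^sup>+ t. ennreal (cmod (A - B * cis (- t)) powr (- c)) * indicator {0..2*pi} t \<partial>lborel)
        \<le> (\<integral>\<^sup>+ t. (\<Sum>k\<in>{-1..3::int}. ennreal ((M / 4) powr (- c)) * (ennreal (\<bar>t - (k * pi - \<phi>)\<bar> powr (- c)) * indicator {0..2*pi} t)) \<partial>lborel)"
      proof (rule nn_integral_mono_AE, use ae in eventually_elim)
        case (elim t)
        show ?case
        proof (cases "t \<in> {0..2*pi}")
          case True
          then obtain k where k: "k \<in> {-1..3::int}" "\<bar>(t + \<phi>) - k * pi\<bar> / 2 \<le> \<bar>sin (t + \<phi>)\<bar>"
            using abs_sin_near_multiple[of "t + \<phi>"] ph by auto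
          let ?d = "\<bar>t - (k * pi - \<phi>)\<bar>"
          have d0: "0 < ?d" using elim k(1) by auto
          have "M / 4 * ?d \<le> M / 2 * \<bar>sin (t + \<phi>)\<bar>"
            using mult_left_mono[OF k(2), of "M / 2"] M by (simp add: algebra_simps)
          also have "\<dots> \<le> cmod (A - B * cis (- t))" by (rule lower)
          finally have "cmod (A - B * cis (- t)) powr (- c) \<le> (M / 4 * ?d) powr (- c)"
            using M d0 by (intro pw) auto
          also have "\<dots> = (M / 4) powr (- c) * ?d powr (- c)" by (rule powr_mult)
          finally have "ennreal (cmod (A - B * cis (- t)) powr (- c)) * indicator {0..2*pi} t \<le>
             ennreal ((M / 4) powr (- c)) * (ennreal (?d powr (- c)) * indicator {0..2*pi} t)"
            using True by (simp add: ennreal_mult[symmetric] ennreal_leI)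
          also have "\<dots> \<le> (\<Sum>k\<in>{-1..3::int}. ennreal ((M / 4) powr (- c)) * (ennreal (\<bar>t - (k * pi - \<phi>)\<bar> powr (- c)) * indicator {0..2*pi} t))"
            using k(1) by (intro member_le_sum) auto
          finally show ?thesis .
        qed simp
      qed
      also have "\<dots> = (\<Sum>k\<in>{-1..3::int}. ennreal ((M / 4) powr (- c)) * (\<integral>\<^sup>+ t. ennreal (\<bar>t - (k * pi - \<phi>)\<bar> powr (- c)) * indicator {0..2*pi} t \<partial>lborel))"
        by (subst nn_integral_sum) (auto simp: nn_integral_cmult)
      also have "\<dots> \<le> (\<Sum>k\<in>{-1..3::int}. ennreal ((M / 4) powr (- c)) * ennreal C)"
        by (intro sum_mono mult_left_mono C) auto
      also have "\<dots> = ennreal (5 * ((M / 4) powr (- c) * C))"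
        using C by (simp add: ennreal_mult)
      also have "5 * ((M / 4) powr (- c) * C) = 5 * (4 powr c * C) * M powr (- c)"
        using M by (simp add: powr_divide powr_minus field_simps)
      also have "\<dots> \<le> ?K * M powr (- c)" using C c by (intro mult_right_mono) auto
      finally show ?thesis using ennreal_leI by (auto simp: M_def)
    qed
  qed
qed

text \<open>A uniform bound on a moment of order greater than one replaces a dominating function.\<close>
lemma continuous_on_integral_uniformly_integrable:
  fixes k :: "'a::euclidean_space \<Rightarrow> 'b::metric_space \<Rightarrow> complex"
  assumes meas: "\<And>z. z \<in> D \<Longrightarrow> (\<lambda>x. k x z) \<in> borel_measurable borel"
    and S: "S \<in> sets borel" "emeasure lborel S < \<infinity>" and out: "\<And>x z. x \<notin> S \<Longrightarrow> k x z = 0"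
    and e: "0 < e" "e \<le> 1" and C: "0 \<le> C"
    and bound: "\<And>z. z \<in> D \<Longrightarrow> (\<integral>\<^sup>+ x. ennreal (cmod (k x z) powr (1 + e)) \<partial>lborel) \<le> ennreal C"
    and cont: "\<And>z. z \<in> D \<Longrightarrow> AE x in lborel. continuous (at z within D) (k x)"
  shows "continuous_on D (\<lambda>z. \<integral>x. k x z \<partial>lborel)"
proof -
  \<comment> \<open>A continuous truncation of modulus at most R. On the set S of finite measure
    dominated convergence applies to it, and the error as R grows is uniform in z, so the integral
    of k is a uniform limit of continuous functions.\<close>
  define kR where "kR R x z = k x z / of_real (1 + cmod (k x z) / R)" for R :: real and x z
  have pos: "1 + cmod w / R > 0" if "R > 0" for w R using that by (simp add: add_pos_nonneg)
  have R_le: "cmod (kR R x z) \<le> R * indicator S x" if "R > 0" for R x z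
  proof (cases "x \<in> S")
    case True
    have "cmod (k x z) \<le> R * (1 + cmod (k x z) / R)" using that by (simp add: field_simps)
    then show ?thesis using True pos[OF that, of "k x z"]
      by (simp add: kR_def norm_divide divide_le_eq del: of_real_add of_real_divide)
  qed (simp add: kR_def out)
  have meas_R: "(\<lambda>x. kR R x z) \<in> borel_measurable borel" if "z \<in> D" for R z
    unfolding kR_def using meas[OF that] by measurable
  have intS: "integrable lborel (\<lambda>x. R * indicator S x :: real)" for R
    using S by (intro integrable_mult_right integrable_real_indicator) auto
  have int_R: "integrable lborel (\<lambda>x. kR R x z)" if "R > 0" "z \<in> D" for R z
    by (rule Bochner_Integration.integrable_bound[OF intS[of R]]) (use meas_R[OF that(2)] R_le[OF that(1)] in \<open>auto intro!: AE_I2 order_trans[OF R_le[OF that(1)]]\<close>)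
  have bnd2: "ennreal (cmod (k x z)) \<le> indicator S x + ennreal (cmod (k x z) powr (1 + e))" for x z
  proof (cases "x \<in> S")
    case True
    have "cmod (k x z) \<le> 1 + cmod (k x z) powr (1 + e)"
    proof (cases "cmod (k x z) \<le> 1")
      case False
      then have "cmod (k x z) powr 1 \<le> cmod (k x z) powr (1 + e)" using e by (intro powr_mono) auto
      then show ?thesis using False by simp
    qed (simp add: add_increasing2)
    then have "ennreal (cmod (k x z)) \<le> ennreal (1 + cmod (k x z) powr (1 + e))" by (rule ennreal_leI)
    then show ?thesis using True by simp
  qed (simp add: out)
  have int: "integrable lborel (\<lambda>x. k x z)" if "z \<in> D" for z
  proof (rule integrableI_bounded)
    show "(\<lambda>x. k x z) \<in> borel_measurable lborel" using meas[OF that] by simp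
    have "(\<integral>\<^sup>+ x. ennreal (cmod (k x z)) \<partial>lborel) \<le> (\<integral>\<^sup>+ x. indicator S x + ennreal (cmod (k x z) powr (1 + e)) \<partial>lborel)"
      by (intro nn_integral_mono bnd2)
    also have "\<dots> = emeasure lborel S + (\<integral>\<^sup>+ x. ennreal (cmod (k x z) powr (1 + e)) \<partial>lborel)"
      using S meas[OF that] by (subst nn_integral_add) auto
    also have "\<dots> < \<infinity>" using S(2) order.strict_trans1[OF bound[OF that]] by (simp add: ennreal_add_less_top)
    finally show "(\<integral>\<^sup>+ x. ennreal (cmod (k x z)) \<partial>lborel) < \<infinity>" .
  qed
  have cont_R: "continuous_on D (\<lambda>z. \<integral>x. kR R x z \<partial>lborel)" if R: "R > 0" for R
    unfolding continuous_on_sequentially comp_def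
  proof (intro ballI allI impI, elim conjE)
    fix z0 zs assume z0: "z0 \<in> D" and zs: "\<forall>n. zs n \<in> D" "zs \<longlonglongrightarrow> z0"
    show "(\<lambda>n. \<integral>x. kR R x (zs n) \<partial>lborel) \<longlonglongrightarrow> (\<integral>x. kR R x z0 \<partial>lborel)"
    proof (rule integral_dominated_convergence[OF _ _ intS[of R]])
      show "(\<lambda>x. kR R x z0) \<in> borel_measurable lborel" "(\<lambda>x. kR R x (zs n)) \<in> borel_measurable lborel" for n
        using meas_R z0 zs by auto
      show "AE x in lborel. norm (kR R x (zs n)) \<le> R * indicator S x" for n
        by (intro AE_I2 R_le R)
      show "AE x in lborel. (\<lambda>n. kR R x (zs n)) \<longlonglongrightarrow> kR R x z0"
        using cont[OF z0]
      proof eventually_elim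
        case (elim x)
        have "(\<lambda>n. k x (zs n)) \<longlonglongrightarrow> k x z0"
          using elim zs unfolding continuous_within_sequentially by (auto simp: comp_def)
        then show ?case unfolding kR_def
          using pos[OF R, of "k x z0"] R by (intro tendsto_intros) (auto simp del: of_real_add of_real_divide)
      qed
    qed
  qed
  have close: "cmod ((\<integral>x. kR R x z \<partial>lborel) - (\<integral>x. k x z \<partial>lborel)) \<le> C * R powr (- e)" if R: "R > 0" and z: "z \<in> D" for R z
  proof -
    have "(\<integral>x. k x z \<partial>lborel) - (\<integral>x. kR R x z \<partial>lborel) = (\<integral>x. k x z - kR R x z \<partial>lborel)"
      using int[OF z] int_R[OF R z] by simp
    then have "ennreal (cmod ((\<integral>x. kR R x z \<partial>lborel) - (\<integral>x. k x z \<partial>lborel))) = ennreal (cmod (\<integral>x. k x z - kR R x z \<partial>lborel))"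
      by (metis norm_minus_commute)
    also have "\<dots> \<le> (\<integral>\<^sup>+ x. ennreal (cmod (k x z - kR R x z)) \<partial>lborel)"
      by (rule integral_norm_bound_ennreal) (use int[OF z] int_R[OF R z] in auto)
    also have "\<dots> \<le> (\<integral>\<^sup>+ x. ennreal (R powr (- e)) * ennreal (cmod (k x z) powr (1 + e)) \<partial>lborel)"
    proof (rule nn_integral_mono)
      fix x
      let ?t = "cmod (k x z)"
      have p: "1 + ?t / R > 0" by (rule pos[OF R])
      have "k x z - kR R x z = k x z * of_real (?t / R) / of_real (1 + ?t / R)"
        using p by (simp add: kR_def field_simps del: of_real_add of_real_divide) (simp add: algebra_simps)
      then have eq: "cmod (k x z - kR R x z) = ?t * ((?t / R) / (1 + ?t / R))"
        using p R by (simp add: norm_mult norm_divide del: of_real_add of_real_divide)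
      \<comment> \<open>The inequality y/(1+y) <= y^e for 0 < e <= 1 converts the truncation error
        into R^(-e) times the moment of order 1 + e.\<close>
      have "(?t / R) / (1 + ?t / R) \<le> (?t / R) powr e"
      proof (cases "?t / R \<le> 1")
        case True
        have "(?t / R) / (1 + ?t / R) \<le> ?t / R" using divide_left_mono[of 1 "1 + ?t / R" "?t / R"] R p by simp
        also have "\<dots> \<le> (?t / R) powr e"
        proof (cases "?t = 0")
          case False
          then have "(?t / R) powr 1 \<le> (?t / R) powr e" using True e R by (intro powr_mono') auto
          then show ?thesis using R by simp
        qed simp
        finally show ?thesis .
      next
        case False
        then have "1 \<le> (?t / R) powr e" using e by (intro ge_one_powr_ge_zero) auto
        moreover have "(?t / R) / (1 + ?t / R) \<le> 1" by (subst divide_le_eq_1_pos[OF p]) simp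
        ultimately show ?thesis by linarith
      qed
      then have "cmod (k x z - kR R x z) \<le> ?t * (?t / R) powr e" unfolding eq by (intro mult_left_mono) auto
      also have "\<dots> = R powr (- e) * ?t powr (1 + e)"
        using R by (simp add: powr_divide powr_add powr_minus_divide)
      finally show "ennreal (cmod (k x z - kR R x z)) \<le> ennreal (R powr (- e)) * ennreal (?t powr (1 + e))"
        by (simp add: ennreal_mult[symmetric] ennreal_leI)
    qed
    also have "\<dots> = ennreal (R powr (- e)) * (\<integral>\<^sup>+ x. ennreal (cmod (k x z) powr (1 + e)) \<partial>lborel)"
      using meas[OF z] by (intro nn_integral_cmult) auto
    also have "\<dots> \<le> ennreal (R powr (- e)) * ennreal C" by (intro mult_left_mono bound z) auto
    also have "\<dots> = ennreal (C * R powr (- e))" using C by (simp add: ennreal_mult mult.commute)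
    finally show ?thesis using C by (subst (asm) ennreal_le_iff) auto
  qed
  show ?thesis
  proof (rule uniform_limit_theorem)
    show "\<forall>\<^sub>F R in at_top. continuous_on D (\<lambda>z. \<integral>x. kR R x z \<partial>lborel)"
      using eventually_gt_at_top[of "0::real"] by eventually_elim (rule cont_R)
    show "uniform_limit D (\<lambda>R z. \<integral>x. kR R x z \<partial>lborel) (\<lambda>z. \<integral>x. k x z \<partial>lborel) at_top"
    proof (rule uniform_limitI)
      fix d :: real assume d: "0 < d"
      have "((\<lambda>R. C * R powr (- e)) \<longlongrightarrow> C * 0) at_top"
        using e by (intro tendsto_intros tendsto_neg_powr filterlim_ident) auto
      then have "\<forall>\<^sub>F R in at_top. C * R powr (- e) < d" using d by (intro order_tendstoD(2)) auto
      then show "\<forall>\<^sub>F R in at_top. \<forall>z\<in>D. dist (\<integral>x. kR R x z \<partial>lborel) (\<integral>x. k x z \<partial>lborel) < d"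
        using eventually_gt_at_top[of "0::real"]
      proof eventually_elim
        case (elim R)
        show ?case
        proof
          fix z assume z: "z \<in> D"
          show "dist (\<integral>x. kR R x z \<partial>lborel) (\<integral>x. k x z \<partial>lborel) < d"
            using close[OF elim(2) z] elim(1) by (simp add: dist_norm)
        qed
      qed
    qed
  qed simp
qed

lemma integrable_times_bounded:
  fixes f g :: "'a \<Rightarrow> complex"
  assumes "integrable M f" "g \<in> borel_measurable M" "\<And>x. f x \<noteq> 0 \<Longrightarrow> cmod (g x) \<le> B"
  shows "integrable M (\<lambda>x. f x * g x)"
proof (rule Bochner_Integration.integrable_bound)
  show "integrable M (\<lambda>x. of_real B * f x)" using assms(1) by (rule integrable_mult_right)
  show "(\<lambda>x. f x * g x) \<in> borel_measurable M" using assms(1,2) by (intro borel_measurable_times) auto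
  show "AE x in M. norm (f x * g x) \<le> norm (of_real B * f x)"
  proof (rule AE_I2)
    fix x
    show "norm (f x * g x) \<le> norm (of_real B * f x)"
    proof (cases "f x = 0")
      case False
      then have "cmod (g x) \<le> \<bar>B\<bar>" using assms(3)[of x] by linarith
      then have "cmod (f x) * cmod (g x) \<le> cmod (f x) * \<bar>B\<bar>" by (intro mult_left_mono) auto
      then show ?thesis by (simp add: norm_mult mult.commute)
    qed simp
  qed
qed

lemma integral_Icc_Ico:
  fixes g :: "real \<Rightarrow> complex"
  assumes "continuous_on {0..2*pi} g"
  shows "(\<integral>t. indicator {0..<2*pi} t *\<^sub>R g t \<partial>lborel) = integral {0..2*pi} g"
    "integrable lborel (\<lambda>t. indicator {0..<2*pi} t *\<^sub>R g t)"
proof -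
  have i: "integrable lborel (\<lambda>t. indicator {0..2*pi} t *\<^sub>R g t)"
    by (rule borel_integrable_compact[OF compact_Icc assms])
  have "integrable lborel (\<lambda>t. indicator {0..<2*pi} t *\<^sub>R (indicator {0..2*pi} t *\<^sub>R g t))"
    by (rule integrable_mult_indicator[OF _ i]) simp
  moreover have "(\<lambda>t. indicator {0..<2*pi} t *\<^sub>R (indicator {0..2*pi} t *\<^sub>R g t)) = (\<lambda>t. indicator {0..<2*pi} t *\<^sub>R g t)"
    by (auto simp: indicator_def fun_eq_iff)
  ultimately show j: "integrable lborel (\<lambda>t. indicator {0..<2*pi} t *\<^sub>R g t)" by (simp only:)
  have "(\<integral>t. indicator {0..<2*pi} t *\<^sub>R g t \<partial>lborel) = (\<integral>t. indicator {0..2*pi} t *\<^sub>R g t \<partial>lborel)"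
    by (rule integral_cong_AE)
      (use i j AE_lborel_singleton[of "2 * pi"] in \<open>auto elim!: eventually_mono simp: indicator_def\<close>)
  also have "\<dots> = integral {0..2*pi} g"
    using set_borel_integral_eq_integral(2)[of "{0..2*pi}" g] i by (simp add: set_integrable_def set_lebesgue_integral_def)
  finally show "(\<integral>t. indicator {0..<2*pi} t *\<^sub>R g t \<partial>lborel) = integral {0..2*pi} g" .
qed

lemma real3_measurable [measurable]:
  "(\<lambda>x::(real\<times>real)\<times>real. fst x) \<in> borel_measurable borel" "(\<lambda>x::(real\<times>real)\<times>real. snd x) \<in> borel_measurable borel"
  by (auto intro!: borel_measurable_continuous_onI continuous_intros)

lemma integrable_times_interval:
  fixes h :: "real \<times> real \<Rightarrow> complex"
  assumes "integrable lborel h"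
  shows "integrable lborel (\<lambda>x. indicator {0..<2*pi} (snd x) *\<^sub>R h (fst x))"
proof (rule integrableI_bounded)
  have [measurable]: "h \<in> borel_measurable borel" using assms by auto
  have m1: "(\<lambda>x::(real\<times>real)\<times>real. h (fst x)) \<in> borel_measurable borel"
    by (rule measurable_compose[OF real3_measurable(1)]) measurable
  have m2: "(\<lambda>x::(real\<times>real)\<times>real. indicator {0..<2*pi} (snd x) :: real) \<in> borel_measurable borel"
    by (rule measurable_compose[OF real3_measurable(2)]) measurable
  show "(\<lambda>x. indicator {0..<2*pi} (snd x) *\<^sub>R h (fst x)) \<in> borel_measurable lborel"
    using borel_measurable_scaleR[OF m2 m1] by simp
  have "(\<integral>\<^sup>+ x. ennreal (norm (indicator {0..<2*pi} (snd x) *\<^sub>R h (fst x))) \<partial>lborel)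
    = (\<integral>\<^sup>+ p. \<integral>\<^sup>+ t. ennreal (norm (indicator {0..<2*pi} t *\<^sub>R h p)) \<partial>lborel \<partial>lborel)"
    by (rule nn_integral_lborel_pair[where f="\<lambda>p t. ennreal (norm (indicator {0..<2*pi} t *\<^sub>R h p))"])
      (use borel_measurable_scaleR[OF m2 m1] in measurable)
  also have "\<dots> = (\<integral>\<^sup>+ p. ennreal (norm (h p)) * ennreal (2 * pi) \<partial>lborel)"
  proof (rule nn_integral_cong)
    fix p
    have "(\<integral>\<^sup>+ t. ennreal (norm (indicator {0..<2*pi} t *\<^sub>R h p)) \<partial>lborel) = (\<integral>\<^sup>+ t. ennreal (norm (h p)) * indicator {0..<2*pi} t \<partial>lborel)"
      by (rule nn_integral_cong) (auto split: split_indicator)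
    also have "\<dots> = ennreal (norm (h p)) * ennreal (2 * pi)" by (subst nn_integral_cmult_indicator) auto
    finally show "(\<integral>\<^sup>+ t. ennreal (norm (indicator {0..<2*pi} t *\<^sub>R h p)) \<partial>lborel) = ennreal (norm (h p)) * ennreal (2 * pi)" .
  qed
  also have "\<dots> = (\<integral>\<^sup>+ p. ennreal (norm (h p)) \<partial>lborel) * ennreal (2 * pi)" by (rule nn_integral_multc) measurable
  also have "\<dots> < \<infinity>" using assms by (simp add: integrable_iff_bounded ennreal_mult_less_top)
  finally show "(\<integral>\<^sup>+ x. ennreal (norm (indicator {0..<2*pi} (snd x) *\<^sub>R h (fst x))) \<partial>lborel) < \<infinity>" .
qed

lemma integral_lborel_pair:
  fixes f :: "'a::euclidean_space \<times> 'b::euclidean_space \<Rightarrow> complex"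
  assumes "integrable lborel f"
  shows "(\<integral>x. f x \<partial>lborel) = (\<integral>p. (\<integral>t. f (p, t) \<partial>lborel) \<partial>lborel)"
proof -
  have "integrable (lborel \<Otimes>\<^sub>M lborel) f" using assms by (simp add: lborel_prod)
  from lborel_pair.integral_fst'[OF this] show ?thesis by (simp add: lborel_prod)
qed

context egg
begin

section \<open>Integration by parts along the circles\<close>

lemma Om_iff: "x \<in> Om \<longleftrightarrow> fst x \<in> GG \<and> snd x \<in> {0..<2*pi}" by (auto simp: Om_def GG_def)

lemma indicator_Om: "indicator Om (p, t) = indicator GG p * (indicator {0..<2*pi} t :: real)"
  by (auto simp: Om_iff indicator_def)

lemma indicator_Om': "indicator Om x = indicator GG (fst x) * (indicator {0..<2*pi} (snd x) :: real)"
  by (auto simp: Om_iff indicator_def)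

lemma Phi_bound: "x \<in> Om \<Longrightarrow> norm (Phi x) \<le> 3"
proof -
  assume x: "x \<in> Om"
  then have g: "gg (fst (fst x)) (snd (fst x)) \<le> 1" by (simp add: Om_def gp_def)
  have "norm (fst (Phi x)) \<le> \<bar>fst (fst x)\<bar> + \<bar>snd (fst x)\<bar>" using cmod_le[of "fst (Phi x)"] by (simp add: Phi_simps)
  moreover have "norm (snd (Phi x)) \<le> 1"
  proof -
    have "0 \<le> gp (fst x)" using n by (auto simp: gp_def gg_def)
    then show ?thesis using x by (simp add: Phi_simps norm_mult Om_def)
  qed
  moreover have "norm (Phi x) \<le> norm (fst (Phi x)) + norm (snd (Phi x))"
    using norm_Pair_le[of "fst (Phi x)" "snd (Phi x)"] by simp
  ultimately show ?thesis using gg_le_1[OF g] by linarith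
qed

lemma integrable_NN_Om: "integrable lborel (\<lambda>x. indicator Om x *\<^sub>R complex_of_real (NN (fst x)))"
proof -
  let ?P = "\<lambda>p. complex_of_real (grd p / 2 + (1 - gp p) * ddb (snd p) / 2)"
  let ?R = "\<lambda>p. complex_of_real ((1 - gp p) / 2)"
  have 1: "continuous_on {p. gp p \<le> 1} ?P" "continuous_on {p. gp p \<le> 1} ?R"
    unfolding grd_def ddb_def
    by (intro continuous_intros cont_gp' continuous_on_compose2[OF cont_da] continuous_on_compose2[OF cont_db]; auto)+
  have e: "complex_of_real (NN p) = ?P p + of_real (dda (fst p)) * ?R p" for p
    by (simp add: NN_def field_simps)
  have "integrable lborel (\<lambda>p. indicator GG p *\<^sub>R complex_of_real (NN p))"
    unfolding e scaleR_add_right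
    by (rule Bochner_Integration.integrable_add[OF integrable_weights(1)[OF 1(1)] integrable_weights(2)[OF 1(2)]])
  from integrable_times_interval[OF this]
  show ?thesis by (simp add: indicator_Om' mult.commute)
qed

lemma slice_Om:
  fixes g :: "real \<Rightarrow> complex"
  assumes "p \<in> GG \<Longrightarrow> continuous_on {0..2*pi} g"
  shows "(\<integral>t. indicator Om (p, t) *\<^sub>R (c * g t) \<partial>lborel) = indicator GG p *\<^sub>R (c * integral {0..2*pi} g)"
proof (cases "p \<in> GG")
  case True
  have "(\<integral>t. indicator Om (p, t) *\<^sub>R (c * g t) \<partial>lborel) = (\<integral>t. c * (indicator {0..<2*pi} t *\<^sub>R g t) \<partial>lborel)"
    using True by (intro Bochner_Integration.integral_cong) (auto simp: indicator_Om scaleR_conv_of_real mult_ac)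
  also have "\<dots> = c * integral {0..2*pi} g" unfolding integral_mult_right_zero using integral_Icc_Ico(1)[OF assms[OF True]] by simp
  finally show ?thesis using True by simp
qed (simp add: indicator_Om)

lemma Delta_bounds:
  assumes z: "z \<in> dom gg" and p: "gp p \<le> 1"
  shows "(1 - Gz (fst z) - (cmod (snd z))\<^sup>2) / 2 \<le> cmod (Delta gg (Phi (p, t)) z)" "Delta gg (Phi (p, t)) z \<noteq> 0"
    "AA p (fst z) \<noteq> 0" "(1 - Gz (fst z)) / 2 \<le> cmod (AA p (fst z))" "0 < 1 - Gz (fst z) - (cmod (snd z))\<^sup>2" "0 < 1 - Gz (fst z)"
proof -
  have r: "rho gg z \<le> 0" using z by (simp add: dom_def)
  have pos: "0 < 1 - Gz (fst z) - (cmod (snd z))\<^sup>2" using dom_facts(1)[OF z] by simp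
  moreover have "0 \<le> (cmod (snd z))\<^sup>2" by simp
  ultimately show pos': "0 < 1 - Gz (fst z)" by linarith
  have "(1 - Gz (fst z) - (cmod (snd z))\<^sup>2) / 2 \<le> Re (Delta gg (Phi (p, t)) z)" using Re_Delta(2)[of "(p, t)" z] p r by simp
  also have "\<dots> \<le> cmod (Delta gg (Phi (p, t)) z)" by (rule complex_Re_le_cmod)
  finally show 1: "(1 - Gz (fst z) - (cmod (snd z))\<^sup>2) / 2 \<le> cmod (Delta gg (Phi (p, t)) z)" .
  show "0 < 1 - Gz (fst z) - (cmod (snd z))\<^sup>2" by (rule pos)
  show "Delta gg (Phi (p, t)) z \<noteq> 0" using 1 pos by auto
  show 2: "(1 - Gz (fst z)) / 2 \<le> cmod (AA p (fst z))" using AA_lower(2)[OF p] pos' by simp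
  show "AA p (fst z) \<noteq> 0" using 2 pos' by auto
qed

lemma Delta_theta:
  assumes p: "gp p \<le> 1"
  shows "Delta gg (Phi (p, t)) z = AA p (fst z) - of_real (rr p) * snd z * cis (- t)"
  using Delta_AA[of "(p, t)" z] p by simp

lemma Delta_theta_deriv:
  assumes p: "gp p \<le> 1"
  shows "((\<lambda>t. Delta gg (Phi (p, t)) z) has_vector_derivative \<i> * (AA p (fst z) - Delta gg (Phi (p, t)) z)) (at t)"
proof -
  have "((\<lambda>t. cis (- t)) has_vector_derivative - (\<i> * cis (- t))) (at t)"
    unfolding has_vector_derivative_def
    by (rule has_derivative_eq_rhs[OF has_derivative_cis[of _ "\<lambda>h. - h"]]) (auto intro!: derivative_eq_intros)
  from has_vector_derivative_diff[OF has_vector_derivative_const has_vector_derivative_mult_right[OF this], of "AA p (fst z)" "of_real (rr p) * snd z"]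
  show ?thesis unfolding Delta_theta[OF p] by (simp add: mult_ac)
qed

context
  fixes f :: "c2 \<Rightarrow> complex" and F' :: "c2 \<Rightarrow> c2 \<Rightarrow>\<^sub>L complex"
  assumes F: "\<And>x. (f has_derivative blinfun_apply (F' x)) (at x)" and F': "continuous_on UNIV F'"
begin

definition fth :: "(real \<times> real) \<times> real \<Rightarrow> complex" where
  "fth x = blinfun_apply (F' (Phi x)) (0, \<i> * snd (Phi x))"

lemma cont_f: "continuous_on UNIV f"
  using F has_derivative_continuous by (blast intro: continuous_at_imp_continuous_on)

lemma cont_fPhi: "continuous_on S (\<lambda>x. f (Phi x))"
  using continuous_on_compose2[OF cont_f cont_Phi] continuous_on_subset by blast

lemma cont_fth: "continuous_on S fth"
proof -
  have "continuous_on UNIV (\<lambda>x. F' (Phi x))" by (rule continuous_on_compose2[OF F' cont_Phi]) simp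
  then have "continuous_on UNIV fth" unfolding fth_def[abs_def]
    by (intro continuous_intros cont_Phi)
  then show ?thesis using continuous_on_subset by blast
qed

lemma fPhi_deriv: "((\<lambda>t. f (Phi (p, t))) has_vector_derivative fth (p, t)) (at t)"
proof -
  have "((\<lambda>t. Phi (p, t)) has_derivative (\<lambda>h. h *\<^sub>R (0, \<i> * snd (Phi (p, t))))) (at t)"
  proof -
    have "((\<lambda>t. (Complex (fst p) (snd p), complex_of_real (sqrt (1 - gp p)) * cis t)) has_derivative
      (\<lambda>h. (0, complex_of_real (sqrt (1 - gp p)) * (h *\<^sub>R (\<i> * cis t))))) (at t)"
      by (intro has_derivative_Pair has_derivative_const has_derivative_mult_right has_derivative_cis has_derivative_ident)
    moreover have "(\<lambda>t. Phi (p, t)) = (\<lambda>t. (Complex (fst p) (snd p), complex_of_real (sqrt (1 - gp p)) * cis t))"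
      by (auto simp: prod_eq_iff Phi_simps)
    ultimately show ?thesis by (auto simp: Phi_simps elim!: has_derivative_eq_rhs)
  qed
  from has_derivative_compose[OF this F]
  show ?thesis unfolding has_vector_derivative_def fth_def by (simp only: blinfun.scaleR_right)
qed

text \<open>The velocity along the circle is i w_2, of length r. This factor r lets the derivative
  term obey the same bound sqrt|A| as f(w) - f(z).\<close>

lemma fth_bound: "\<exists>K\<ge>0. \<forall>x\<in>Om. cmod (fth x) \<le> K * rr (fst x)"
proof -
  have "compact (F' ` cball 0 3)" by (intro compact_continuous_image continuous_on_subset[OF F'] compact_cball) auto
  then obtain K where K: "\<And>w. norm w \<le> 3 \<Longrightarrow> norm (F' w) \<le> K" 
    using compact_imp_bounded[of "F' ` cball 0 3"] unfolding bounded_iff by (metis imageI mem_cball_0)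
  have "0 \<le> K" using order_trans[OF norm_ge_zero K[of 0]] by simp
  moreover have "cmod (fth x) \<le> K * rr (fst x)" if "x \<in> Om" for x
  proof -
    have "cmod (fth x) \<le> norm (F' (Phi x)) * norm (0 :: complex, \<i> * snd (Phi x))" unfolding fth_def by (rule norm_blinfun)
    also have "norm (0 :: complex, \<i> * snd (Phi x)) = rr (fst x)"
      using that by (simp add: norm_Pair norm_mult Phi_simps rr_def Om_def)
    also have "norm (F' (Phi x)) * rr (fst x) \<le> K * rr (fst x)"
      using that by (intro mult_right_mono K Phi_bound) (auto simp: rr_def Om_def)
    finally show ?thesis .
  qed
  ultimately show ?thesis by blast
qed

text \<open>The ball of radius 3 is convex and contains the closed domain, so the mean value
  inequality applies to any two of its points, whether or not they lie on the boundary.\<close>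

lemma f_lipschitz: "\<exists>K\<ge>0. \<forall>w z. norm w \<le> 3 \<longrightarrow> norm z \<le> 3 \<longrightarrow> cmod (f w - f z) \<le> K * norm (w - z)"
proof -
  have "compact (F' ` cball 0 3)" by (intro compact_continuous_image continuous_on_subset[OF F'] compact_cball) auto
  then obtain K where K: "\<And>w. norm w \<le> 3 \<Longrightarrow> norm (F' w) \<le> K" 
    using compact_imp_bounded[of "F' ` cball 0 3"] unfolding bounded_iff by (metis imageI mem_cball_0)
  have "0 \<le> K" using order_trans[OF norm_ge_zero K[of 0]] by simp
  moreover have "cmod (f w - f z) \<le> K * norm (w - z)" if "norm w \<le> 3" "norm z \<le> 3" for w z
  proof (rule differentiable_bound[of "cball 0 3"])
    show "(f has_derivative blinfun_apply (F' x)) (at x within cball 0 3)" for x using F by (rule has_derivative_at_withinI)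
    show "onorm (blinfun_apply (F' x)) \<le> K" if "x \<in> cball 0 3" for x using K[of x] that by (simp add: norm_blinfun.rep_eq[symmetric])
  qed (use that in auto)
  ultimately show ?thesis by blast
qed

lemma measurable_kernel_parts:
  "(\<lambda>x::(real\<times>real)\<times>real. AA (fst x) w) \<in> borel_measurable borel" "(\<lambda>x. Delta gg (Phi x) z) \<in> borel_measurable borel"
  "(\<lambda>x. f (Phi x)) \<in> borel_measurable borel" "fth \<in> borel_measurable borel"
proof -
  have "continuous_on UNIV (\<lambda>x::(real\<times>real)\<times>real. AA (fst x) w)"
    by (rule continuous_on_compose2[OF cont_AA[of UNIV]]) (auto intro: continuous_intros)
  then show "(\<lambda>x::(real\<times>real)\<times>real. AA (fst x) w) \<in> borel_measurable borel" by (rule borel_measurable_continuous_onI)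
  show "(\<lambda>x. Delta gg (Phi x) z) \<in> borel_measurable borel" by (rule Phi_comp_measurable)
  show "(\<lambda>x. f (Phi x)) \<in> borel_measurable borel" by (rule borel_measurable_continuous_onI[OF cont_fPhi])
  show "fth \<in> borel_measurable borel" by (rule borel_measurable_continuous_onI[OF cont_fth])
qed

lemma bounded_on_Om: "\<exists>B. \<forall>x\<in>Om. cmod (f (Phi x)) \<le> B \<and> cmod (fth x) \<le> B"
proof -
  have "compact (f ` cball 0 3)" by (intro compact_continuous_image continuous_on_subset[OF cont_f] compact_cball) auto
  then obtain B where B: "\<And>w. norm w \<le> 3 \<Longrightarrow> cmod (f w) \<le> B"
    using compact_imp_bounded[of "f ` cball 0 3"] unfolding bounded_iff by (metis imageI mem_cball_0)
  obtain K where K: "0 \<le> K" "\<And>x. x \<in> Om \<Longrightarrow> cmod (fth x) \<le> K * rr (fst x)" using fth_bound by auto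
  have "rr (fst x) \<le> 1" if "x \<in> Om" for x
  proof -
    have "0 \<le> gp (fst x)" using n by (auto simp: gp_def gg_def)
    then show ?thesis using that by (simp add: rr_def Om_def)
  qed
  then have "K * rr (fst x) \<le> K" if "x \<in> Om" for x using K(1) that by (simp add: mult_left_le)
  then show ?thesis using B K Phi_bound by (intro exI[of _ "max B K"]) (meson le_max_iff_disj order_trans)
qed

lemma integrable_kernels:
  assumes z: "z \<in> dom gg"
  shows "integrable lborel (\<lambda>x. indicator Om x *\<^sub>R (of_real (NN (fst x)) * (f (Phi x) / (Delta gg (Phi x) z)\<^sup>2)))"
   "integrable lborel (\<lambda>x. indicator Om x *\<^sub>R (of_real (NN (fst x)) * ((f (Phi x) - \<i> * fth x) / (AA (fst x) (fst z) * Delta gg (Phi x) z))))"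
proof -
  obtain B where B: "\<And>x. x \<in> Om \<Longrightarrow> cmod (f (Phi x)) \<le> B" "\<And>x. x \<in> Om \<Longrightarrow> cmod (fth x) \<le> B"
    using bounded_on_Om by blast
  define d where "d = (1 - Gz (fst z) - (cmod (snd z))\<^sup>2) / 2"
  define d' where "d' = (1 - Gz (fst z)) / 2"
  have gp: "gp (fst x) \<le> 1" if "x \<in> Om" for x using that by (simp add: Om_def)
  have d: "0 < d" "0 < d'" using Delta_bounds(5,6)[OF z, of "(0,0)"] m n by (auto simp: d_def d'_def gp_def gg_def)
  have D: "d \<le> cmod (Delta gg (Phi x) z)" "d' \<le> cmod (AA (fst x) (fst z))" if "x \<in> Om" for x
    using Delta_bounds(1)[OF z gp[OF that], of "snd x"] Delta_bounds(4)[OF z gp[OF that]] by (simp_all add: d_def d'_def)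
  have "integrable lborel (\<lambda>x. (indicator Om x *\<^sub>R complex_of_real (NN (fst x))) * (f (Phi x) / (Delta gg (Phi x) z)\<^sup>2))"
  proof (rule integrable_times_bounded[OF integrable_NN_Om, where B="B / d\<^sup>2"])
    show "(\<lambda>x. f (Phi x) / (Delta gg (Phi x) z)\<^sup>2) \<in> borel_measurable lborel"
      using measurable_kernel_parts(2)[of z] measurable_kernel_parts(3) by simp
    fix x assume "indicator Om x *\<^sub>R complex_of_real (NN (fst x)) \<noteq> 0"
    then have x: "x \<in> Om" by (auto simp: indicator_def split: if_splits)
    show "cmod (f (Phi x) / (Delta gg (Phi x) z)\<^sup>2) \<le> B / d\<^sup>2"
      unfolding norm_divide norm_power using B(1)[OF x] D(1)[OF x] d
      by (intro frac_le power_mono) (auto intro: order_trans[OF norm_ge_zero])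
  qed
  then show "integrable lborel (\<lambda>x. indicator Om x *\<^sub>R (of_real (NN (fst x)) * (f (Phi x) / (Delta gg (Phi x) z)\<^sup>2)))"
    unfolding mult_scaleR_left .
  have "integrable lborel (\<lambda>x. (indicator Om x *\<^sub>R complex_of_real (NN (fst x))) * ((f (Phi x) - \<i> * fth x) / (AA (fst x) (fst z) * Delta gg (Phi x) z)))"
  proof (rule integrable_times_bounded[OF integrable_NN_Om, where B="(B + B) / (d' * d)"])
    show "(\<lambda>x. (f (Phi x) - \<i> * fth x) / (AA (fst x) (fst z) * Delta gg (Phi x) z)) \<in> borel_measurable lborel"
      using measurable_kernel_parts(1)[of "fst z"] measurable_kernel_parts(2)[of z] measurable_kernel_parts(3,4) by simp
    fix x assume "indicator Om x *\<^sub>R complex_of_real (NN (fst x)) \<noteq> 0"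
    then have x: "x \<in> Om" by (auto simp: indicator_def split: if_splits)
    have "cmod (f (Phi x) - \<i> * fth x) \<le> cmod (f (Phi x)) + cmod (\<i> * fth x)" by (rule norm_triangle_ineq4)
    also have "\<dots> \<le> B + B" using B[OF x] by (simp add: norm_mult)
    finally have "cmod (f (Phi x) - \<i> * fth x) \<le> B + B" .
    then show "cmod ((f (Phi x) - \<i> * fth x) / (AA (fst x) (fst z) * Delta gg (Phi x) z)) \<le> (B + B) / (d' * d)"
      unfolding norm_divide norm_mult using D[OF x] d order_trans[OF norm_ge_zero B(1)[OF x]]
      by (intro frac_le mult_mono) (auto intro: order_trans[OF norm_ge_zero])
  qed
  then show "integrable lborel (\<lambda>x. indicator Om x *\<^sub>R (of_real (NN (fst x)) * ((f (Phi x) - \<i> * fth x) / (AA (fst x) (fst z) * Delta gg (Phi x) z))))"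
    unfolding mult_scaleR_left .
qed

lemma integral_theta_by_parts:
  assumes z: "z \<in> dom gg"
  shows "(\<integral>x. indicator Om x *\<^sub>R (of_real (NN (fst x)) * (f (Phi x) / (Delta gg (Phi x) z)\<^sup>2)) \<partial>lborel)
   = (\<integral>x. indicator Om x *\<^sub>R (of_real (NN (fst x)) * ((f (Phi x) - \<i> * fth x) / (AA (fst x) (fst z) * Delta gg (Phi x) z))) \<partial>lborel)"
  unfolding integral_lborel_pair[OF integrable_kernels(1)[OF z]] integral_lborel_pair[OF integrable_kernels(2)[OF z]] fst_conv
proof (rule Bochner_Integration.integral_cong[OF refl])
  fix p
  have cD: "continuous_on {0..2*pi} (\<lambda>t. Delta gg (Phi (p, t)) z)" if "p \<in> GG"
    using Delta_theta_deriv[of p z] that by (intro continuous_at_imp_continuous_on ballI has_vector_derivative_continuous) (auto simp: GG_def)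
  have cf: "continuous_on {0..2*pi} (\<lambda>t. f (Phi (p, t)))"
    by (rule continuous_on_compose2[OF cont_fPhi[of UNIV]]) (auto intro!: continuous_intros)
  have cft: "continuous_on S (\<lambda>t. fth (p, t))" for S
    by (rule continuous_on_compose2[OF cont_fth[of UNIV]]) (auto intro!: continuous_intros)
  have c1: "continuous_on {0..2*pi} (\<lambda>t. f (Phi (p, t)) / (Delta gg (Phi (p, t)) z)\<^sup>2)" if "p \<in> GG"
    using that Delta_bounds(2)[OF z] by (intro continuous_intros cf cD) (auto simp: GG_def)
  have c2: "continuous_on {0..2*pi} (\<lambda>t. (f (Phi (p, t)) - \<i> * fth (p, t)) / (AA p (fst z) * Delta gg (Phi (p, t)) z))" if "p \<in> GG"
    using that Delta_bounds(2,3)[OF z] by (intro continuous_intros cf cft cD) (auto simp: GG_def)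
  have per: "Phi (p, 0) = Phi (p, 2 * pi)" by (simp add: prod_eq_iff Phi_simps)
  have "indicator GG p *\<^sub>R (of_real (NN p) * integral {0..2*pi} (\<lambda>t. f (Phi (p, t)) / (Delta gg (Phi (p, t)) z)\<^sup>2))
      = indicator GG p *\<^sub>R (of_real (NN p) * integral {0..2*pi} (\<lambda>t. (f (Phi (p, t)) - \<i> * fth (p, t)) / (AA p (fst z) * Delta gg (Phi (p, t)) z)))"
  proof (cases "p \<in> GG")
    case True
    then have p: "gp p \<le> 1" by (simp add: GG_def)
    have "integral {0..2*pi} (\<lambda>t. f (Phi (p, t)) / (Delta gg (Phi (p, t)) z)\<^sup>2)
      = integral {0..2*pi} (\<lambda>t. (f (Phi (p, t)) - \<i> * fth (p, t)) / (AA p (fst z) * Delta gg (Phi (p, t)) z))"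
      by (rule periodic_ibp[OF fPhi_deriv cft Delta_theta_deriv[OF p] Delta_bounds(2,3)[OF z p]])
        (simp_all add: per)
    then show ?thesis by simp
  qed simp
  then show "(\<integral>t. indicator Om (p, t) *\<^sub>R (of_real (NN p) * (f (Phi (p, t)) / (Delta gg (Phi (p, t)) z)\<^sup>2)) \<partial>lborel)
    = (\<integral>t. indicator Om (p, t) *\<^sub>R (of_real (NN p) * ((f (Phi (p, t)) - \<i> * fth (p, t)) / (AA p (fst z) * Delta gg (Phi (p, t)) z))) \<partial>lborel)"
    using slice_Om[OF c1, where c="of_real (NN p)"] slice_Om[OF c2, where c="of_real (NN p)"] by (simp only:)
qed

end

text \<open>For f = 1 the derivative term is absent, the circle integral is 2 pi / A^2 and
  \<open>integral_NN_AA\<close> evaluates the rest. Since \<open>c_kernel\<close> is pi, this is the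
  reproducing property C(1) = 1.\<close>

lemma integral_kernel_one:
  assumes z: "z \<in> dom gg"
  shows "(\<integral>x. indicator Om x *\<^sub>R (of_real (NN (fst x)) * (1 / (Delta gg (Phi x) z)\<^sup>2)) \<partial>lborel) = 4 * pi * c_kernel"
    "integrable lborel (\<lambda>x. indicator Om x *\<^sub>R (of_real (NN (fst x)) * (1 / (Delta gg (Phi x) z)\<^sup>2)))"
proof -
  have d: "((\<lambda>_. 1 :: complex) has_derivative blinfun_apply ((\<lambda>_. 0) x)) (at x)" for x :: c2
    by (simp add: zero_blinfun.rep_eq)
  have f0: "fth (\<lambda>_. 0) x = 0" for x by (simp add: fth_def[OF d continuous_on_const])
  note ik = integrable_kernels[OF d continuous_on_const z, unfolded f0]
  show "integrable lborel (\<lambda>x. indicator Om x *\<^sub>R (of_real (NN (fst x)) * (1 / (Delta gg (Phi x) z)\<^sup>2)))"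
    by (rule ik(1))
  have i2: "integrable lborel (\<lambda>x. indicator Om x *\<^sub>R (complex_of_real (NN (fst x)) * (1 / (AA (fst x) (fst z) * Delta gg (Phi x) z))))"
    using ik(2) by simp
  have "(\<integral>x. indicator Om x *\<^sub>R (of_real (NN (fst x)) * (1 / (Delta gg (Phi x) z)\<^sup>2)) \<partial>lborel)
    = (\<integral>x. indicator Om x *\<^sub>R (of_real (NN (fst x)) * (1 / (AA (fst x) (fst z) * Delta gg (Phi x) z))) \<partial>lborel)"
    using integral_theta_by_parts[OF d continuous_on_const z, unfolded f0] by simp
  also have "\<dots> = (\<integral>p. indicator GG p *\<^sub>R (2 * pi * (of_real (NN p) / (AA p (fst z))\<^sup>2)) \<partial>lborel)"
    unfolding integral_lborel_pair[OF i2] fst_conv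
  proof (rule Bochner_Integration.integral_cong[OF refl])
    fix p
    let ?g = "\<lambda>t. 1 / (AA p (fst z) * Delta gg (Phi (p, t)) z)"
    have c: "continuous_on {0..2*pi} ?g" if "p \<in> GG"
    proof -
      have p: "gp p \<le> 1" using that by (simp add: GG_def)
      have "continuous_on {0..2*pi} (\<lambda>t. Delta gg (Phi (p, t)) z)"
        by (intro continuous_at_imp_continuous_on ballI has_vector_derivative_continuous[OF Delta_theta_deriv[OF p]])
      then show ?thesis using Delta_bounds(2,3)[OF z p] by (intro continuous_intros) auto
    qed
    have "indicator GG p *\<^sub>R (of_real (NN p) * integral {0..2*pi} ?g) = indicator GG p *\<^sub>R (2 * pi * (of_real (NN p) / (AA p (fst z))\<^sup>2))"
    proof (cases "p \<in> GG")
      case True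
      then have p: "gp p \<le> 1" by (simp add: GG_def)
      have "integral {0..2*pi} ?g = 1 / AA p (fst z) * integral {0..2*pi} (\<lambda>t. 1 / (AA p (fst z) - of_real (rr p) * snd z * cis (- t)))"
        unfolding Delta_theta[OF p] by (subst integral_mult_right[symmetric]) (simp add: field_simps)
      also have "integral {0..2*pi} (\<lambda>t. 1 / (AA p (fst z) - of_real (rr p) * snd z * cis (- t))) = 2 * pi / AA p (fst z)"
      proof (rule integral_circle_inverse)
        have r0: "0 \<le> rr p" using p by (simp add: rr_def)
        have "0 < (1 - Gz (fst z) - (cmod (snd z))\<^sup>2) / 2" using Delta_bounds(5)[OF z p] by simp
        have "cmod (of_real (rr p) * snd z) = rr p * cmod (snd z)" using r0 by (simp add: norm_mult)
        also have "\<dots> \<le> ((rr p)\<^sup>2 + (cmod (snd z))\<^sup>2) / 2"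
          using zero_le_power2[of "rr p - cmod (snd z)"] by (simp add: power2_eq_square algebra_simps)
        also have "\<dots> < ((1 - gp p) + (1 - Gz (fst z))) / 2" using Delta_bounds(5)[OF z p] rr_sq[OF p] by simp
        also have "\<dots> \<le> Re (AA p (fst z))" using Re_AA[of p "fst z"] conv_lower(2)[OF p, of "fst z"] Delta_bounds(6)[OF z p] by simp
        also have "\<dots> \<le> cmod (AA p (fst z))" by (rule complex_Re_le_cmod)
        finally show "cmod (of_real (rr p) * snd z) < cmod (AA p (fst z))" .
      qed
      finally show ?thesis by (simp add: power2_eq_square)
    qed simp
    then show "(\<integral>t. indicator Om (p, t) *\<^sub>R (of_real (NN p) * ?g t) \<partial>lborel) = indicator GG p *\<^sub>R (2 * pi * (of_real (NN p) / (AA p (fst z))\<^sup>2))"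
      using slice_Om[OF c, where c="of_real (NN p)"] by (simp only:)
  qed
  also have "\<dots> = 2 * pi * (\<integral>p. indicator GG p *\<^sub>R (of_real (NN p) / (AA p (fst z))\<^sup>2) \<partial>lborel)"
    unfolding integral_mult_right_zero[symmetric] by (simp only: mult_scaleR_right)
  also have "\<dots> = 2 * pi * (2 * of_real c_kernel)" 
  proof -
    have "gp (0, 0) \<le> 1" using n m by (auto simp: gp_def gg_def)
    then show ?thesis using integral_NN_AA[of "fst z"] Delta_bounds(6)[OF z] by simp
  qed
  finally show "(\<integral>x. indicator Om x *\<^sub>R (of_real (NN (fst x)) * (1 / (Delta gg (Phi x) z)\<^sup>2)) \<partial>lborel) = 4 * pi * c_kernel" by simp
qed

text \<open>The integrand after integration by parts, applied to f - f(z) in place of f.\<close>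

definition kk :: "(c2 \<Rightarrow> complex) \<Rightarrow> (c2 \<Rightarrow> c2 \<Rightarrow>\<^sub>L complex) \<Rightarrow> (real \<times> real) \<times> real \<Rightarrow> c2 \<Rightarrow> complex" where
  "kk f F' x z = indicator Om x *\<^sub>R (of_real (NN (fst x)) *
     ((f (Phi x) - f z - \<i> * blinfun_apply (F' (Phi x)) (0, \<i> * snd (Phi x))) / (AA (fst x) (fst z) * Delta gg (Phi x) z)))"

text \<open>The point z is fixed, so w -> f w - f z has the same derivative as f and the integration
  by parts applies to it; the subtracted constant contributes f(z) times the integral for f =
  1.\<close>

lemma cauchy_leray_representation:
  fixes f :: "c2 \<Rightarrow> complex"
  assumes F: "\<And>x. (f has_derivative blinfun_apply (F' x)) (at x)" and F': "continuous_on UNIV F'" and z: "z \<in> dom gg"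
  shows "cauchy_leray gg f z = 1 / (4 * pi\<^sup>2) * (f z * (4 * pi * c_kernel) + (\<integral>x. kk f F' x z \<partial>lborel))"
proof -
  have F1: "((\<lambda>w. f w - f z) has_derivative blinfun_apply (F' x)) (at x)" for x
    using has_derivative_diff[OF F[of x] has_derivative_const[of "f z"]] by simp
  have fm: "f \<in> borel_measurable borel" by (rule borel_measurable_continuous_onI[OF cont_f[OF F F']])
  let ?i = "\<lambda>g x. indicator Om x *\<^sub>R (complex_of_real (NN (fst x)) * (g x / (Delta gg (Phi x) z)\<^sup>2))"
  have "(\<integral>x. indicator Om x * of_real (NN (fst x)) * f (Phi x) / (Delta gg (Phi x) z)\<^sup>2 \<partial>lborel)
    = (\<integral>x. ?i (\<lambda>x. f (Phi x) - f z) x + f z * ?i (\<lambda>x. 1) x \<partial>lborel)"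
    by (intro Bochner_Integration.integral_cong refl) (simp add: indicator_def diff_divide_distrib algebra_simps)
  also have "\<dots> = (\<integral>x. ?i (\<lambda>x. f (Phi x) - f z) x \<partial>lborel) + f z * (\<integral>x. ?i (\<lambda>x. 1) x \<partial>lborel)"
    using Bochner_Integration.integral_add[OF integrable_kernels(1)[OF F1 F' z] integrable_mult_right[OF integral_kernel_one(2)[OF z], of "f z"]]
    by (simp only: integral_mult_right_zero)
  also have "(\<integral>x. ?i (\<lambda>x. f (Phi x) - f z) x \<partial>lborel) = (\<integral>x. kk f F' x z \<partial>lborel)"
    unfolding integral_theta_by_parts[OF F1 F' z] kk_def fth_def[OF F1 F'] by simp
  finally show ?thesis unfolding cauchy_leray_eq[OF fm] integral_kernel_one(1)[OF z] by (simp add: add.commute)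
qed

section \<open>Size and continuity of the remaining kernel\<close>

lemma AE_lborel_fst:
  fixes P :: "real \<times> real \<Rightarrow> bool"
  assumes "AE p in lborel. P p" "{x. P (fst x)} \<in> sets (borel :: ((real \<times> real) \<times> real) measure)"
  shows "AE x in (lborel :: ((real \<times> real) \<times> real) measure). P (fst x)"
proof -
  have "AE x in (lborel :: (real \<times> real) measure) \<Otimes>\<^sub>M (lborel :: real measure). P (fst x)"
    by (rule lborel_pair.AE_pair_measure) (unfold lborel_prod, use assms in auto)
  then show ?thesis unfolding lborel_prod .
qed

lemma AE_tau3: "AE x in (lborel :: ((real \<times> real) \<times> real) measure). tau (fst x) z \<noteq> 0"
proof (rule AE_lborel_fst[OF AE_tau_nz])
  have "continuous_on UNIV (\<lambda>x::(real\<times>real)\<times>real. tau (fst x) z)"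
    by (rule continuous_on_compose2[OF cont_tau[of UNIV]]) (auto intro: continuous_intros)
  then show "{x. tau (fst x) z \<noteq> 0} \<in> sets (borel :: ((real \<times> real) \<times> real) measure)"
    by (intro borel_open open_Collect_neq continuous_intros)
qed

lemma AE_coords_ne: "AE p in (lborel :: (real \<times> real) measure). fst p \<noteq> c \<and> snd p \<noteq> d"
proof -
  have 1: "{p. fst p \<noteq> c \<and> snd p \<noteq> d} \<in> sets (borel :: (real \<times> real) measure)"
    by (intro borel_open open_Collect_conj open_Collect_neq continuous_intros)
  have "AE p in lborel \<Otimes>\<^sub>M (lborel :: real measure). fst p \<noteq> c \<and> snd p \<noteq> (d :: real)"
    by (rule lborel_pair.AE_pair_measure)
      (unfold lborel_prod, use 1 AE_lborel_singleton[of c] AE_lborel_singleton[of d] in \<open>auto elim!: eventually_mono\<close>)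
  then show ?thesis unfolding lborel_prod .
qed

lemma Gz_le: "rho gg z \<le> 0 \<Longrightarrow> Gz (fst z) \<le> 1"
  using dom_facts(2)[of z] zero_le_power2[of "cmod (snd z)"] by linarith

lemma norm_z_le: assumes "rho gg z \<le> 0" shows "norm z \<le> 3"
proof -
  have "norm (fst z) \<le> 2" using gg_le_1[of "Re (fst z)" "Im (fst z)"] Gz_le[OF assms] cmod_le[of "fst z"] by (simp add: Gz_def)
  moreover have "(cmod (snd z))\<^sup>2 \<le> 1"
  proof -
    have "0 \<le> Gz (fst z)" using n by (auto simp: Gz_def gg_def)
    then show ?thesis using dom_facts(2)[OF assms] by linarith
  qed
  then have "norm (snd z) \<le> 1" by (simp add: power_le_one_iff)
  ultimately show ?thesis using norm_Pair_le[of "fst z" "snd z"] by simp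
qed

lemma AA_upper: assumes "gp p \<le> 1" "Gz z \<le> 1" shows "cmod (AA p z) \<le> 16"
proof -
  obtain u v where p: "p = (u, v)" by (metis surj_pair)
  have le: "\<bar>u\<bar> \<le> 1" "\<bar>v\<bar> \<le> 1" "\<bar>Re z\<bar> \<le> 1" "\<bar>Im z\<bar> \<le> 1"
    using gg_le_1[of u v] gg_le_1[of "Re z" "Im z"] assms by (auto simp: p gp_def Gz_def)
  have "\<bar>da u\<bar> \<le> 2 * 1"
  proof (cases "u = 0")
    case False
    then show ?thesis unfolding da_def abs_mult using m le powr_mono'[of 0 "m - 1" "\<bar>u\<bar>"]
      by (intro mult_mono) (auto simp: abs_sgn_eq)
  qed (simp add: da_def)
  moreover have "\<bar>db v\<bar> \<le> 4 * 1" unfolding db_def abs_mult power_abs using n le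
    by (intro mult_mono power_le_one) auto
  ultimately have "cmod (af p) \<le> 3" using cmod_le[of "af p"] by (simp add: af_def p)
  moreover have t4: "cmod (tau p z) \<le> 4" using cmod_le[of "tau p z"] le by (simp add: tau_def p)
  ultimately have 1: "cmod (af p) * cmod (tau p z) \<le> 3 * 4" by (intro mult_mono) auto
  have "0 \<le> gp p" using n by (auto simp: gp_def gg_def)
  then have 2: "cmod (of_real (1 - gp p)) \<le> 1" using assms unfolding norm_of_real by simp
  have "cmod (AA p z) \<le> cmod (af p) * cmod (tau p z) + cmod (of_real (1 - gp p))"
    unfolding AA_def using norm_triangle_ineq[of "af p * tau p z" "of_real (1 - gp p)"] by (simp only: norm_mult)
  also have "\<dots> \<le> 3 * 4 + 1" by (rule add_mono[OF 1 2])
  finally show ?thesis by simp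
qed

text \<open>The smaller of the two bases dominates. This replaces a product of singularities at two
  different points by a sum of singularities at one point each, of the combined order.\<close>

lemma powr_minus_prod_le:
  fixes s w :: real
  assumes "0 < s" "0 < w" "0 \<le> a" "0 \<le> b"
  shows "s powr (- a) * w powr (- b) \<le> s powr (- (a + b)) + w powr (- (a + b))"
proof (cases "s \<le> w")
  case True
  have "s powr (- a) * w powr (- b) \<le> s powr (- a) * s powr (- b)"
    using assms True by (intro mult_left_mono powr_mono2') auto
  also have "\<dots> = s powr (- (a + b))" by (simp add: powr_add[symmetric])
  finally show ?thesis using powr_ge_zero[of w "- (a + b)"] by linarith
next
  case False
  have "s powr (- a) * w powr (- b) \<le> w powr (- a) * w powr (- b)"
    using assms False by (intro mult_right_mono powr_mono2') auto
  also have "\<dots> = w powr (- (a + b))" by (simp add: powr_add[symmetric])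
  finally show ?thesis using powr_ge_zero[of s "- (a + b)"] by linarith
qed

context
  fixes f :: "c2 \<Rightarrow> complex" and F' :: "c2 \<Rightarrow> c2 \<Rightarrow>\<^sub>L complex"
  assumes F: "\<And>x. (f has_derivative blinfun_apply (F' x)) (at x)" and F': "continuous_on UNIV F'"
begin

text \<open>The difference w_2 - z_2 is estimated by |w_2| + |z_2|, and both r^2 = |w_2|^2 and
  |z_2|^2 are at most 2|A| up to 1 - g(z_1) >= |z_2|^2. The remaining difference tau is even of
  order |A|, hence of order sqrt|A| since A is bounded. The circle derivative carries the factor
  r.\<close>

lemma kk_numerator_bound:
  "\<exists>K\<ge>0. \<forall>x\<in>Om. \<forall>z. rho gg z \<le> 0 \<longrightarrow>
     cmod (f (Phi x) - f z - \<i> * blinfun_apply (F' (Phi x)) (0, \<i> * snd (Phi x))) \<le> K * sqrt (cmod (AA (fst x) (fst z)))"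
proof -
  obtain K1 where K1: "0 \<le> K1" "\<And>x. x \<in> Om \<Longrightarrow> cmod (fth F' x) \<le> K1 * rr (fst x)" using fth_bound[OF F F'] by auto
  obtain K2 where K2: "0 \<le> K2" "\<And>w z. norm w \<le> 3 \<Longrightarrow> norm z \<le> 3 \<Longrightarrow> cmod (f w - f z) \<le> K2 * norm (w - z)"
    using f_lipschitz[OF F F'] by auto
  show ?thesis
  proof (intro exI[of _ "K2 * 68 + K1 * 2"] conjI ballI allI impI)
    show "0 \<le> K2 * 68 + K1 * 2" using K1 K2 by simp
    fix x z assume x: "x \<in> Om" and z: "rho gg z \<le> 0"
    define a where "a = cmod (AA (fst x) (fst z))"
    have p: "gp (fst x) \<le> 1" using x by (simp add: Om_def)
    note G = Gz_le[OF z]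
    have a: "(1 - gp (fst x)) / 2 \<le> a" "(1 - Gz (fst z)) / 2 \<le> a" "cmod (tau (fst x) (fst z)) / 16 \<le> a" "a \<le> 16"
      using AA_lower[OF p G] AA_upper[OF p G] by (auto simp: a_def)
    have a0: "0 \<le> a" by (simp add: a_def)
    have sa: "sqrt a \<le> 4" using real_sqrt_le_mono[OF a(4)] by simp
    have "a = sqrt a * sqrt a" using a0 by simp
    also have "\<dots> \<le> 4 * sqrt a" using sa a0 by (intro mult_right_mono) auto
    finally have a4: "a \<le> 4 * sqrt a" .
    have half: "y \<le> 2 * sqrt a" if "y\<^sup>2 / 2 \<le> a" "0 \<le> y" for y
    proof (rule power2_le_imp_le)
      show "y\<^sup>2 \<le> (2 * sqrt a)\<^sup>2" using that a0 by (simp add: power_mult_distrib)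
    qed (use a0 in simp)
    have r: "rr (fst x) \<le> 2 * sqrt a" using a(1) rr_sq[OF p] p by (intro half) (auto simp: rr_def)
    have s: "cmod (snd z) \<le> 2 * sqrt a" using a(2) dom_facts(2)[OF z] by (intro half) auto
    have "norm (Phi x - z) \<le> norm (fst (Phi x - z)) + norm (snd (Phi x - z))"
      using norm_Pair_le[of "fst (Phi x - z)" "snd (Phi x - z)"] unfolding prod.collapse .
    also have "fst (Phi x - z) = tau (fst x) (fst z)" by (simp add: Phi_simps tau_def)
    also have "norm (snd (Phi x - z)) \<le> norm (snd (Phi x)) + norm (snd z)" unfolding snd_diff by (rule norm_triangle_ineq4)
    also have "norm (snd (Phi x)) = rr (fst x)" using p by (simp add: Phi_simps norm_mult rr_def)
    finally have "norm (Phi x - z) \<le> 68 * sqrt a" using a(3) a4 r s by linarith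
    then have "K2 * norm (Phi x - z) \<le> K2 * (68 * sqrt a)" using K2(1) by (rule mult_left_mono)
    moreover have "K1 * rr (fst x) \<le> K1 * (2 * sqrt a)" using r K1(1) by (rule mult_left_mono)
    moreover have "cmod (f (Phi x) - f z - \<i> * fth F' x) \<le> cmod (f (Phi x) - f z) + cmod (\<i> * fth F' x)" by (rule norm_triangle_ineq4)
    moreover have "cmod (\<i> * fth F' x) \<le> K1 * rr (fst x)" using K1(2)[OF x] by (simp add: norm_mult)
    moreover have "cmod (f (Phi x) - f z) \<le> K2 * norm (Phi x - z)" by (rule K2(2)[OF Phi_bound[OF x] norm_z_le[OF z]])
    ultimately have "cmod (f (Phi x) - f z - \<i> * fth F' x) \<le> (K2 * 68 + K1 * 2) * sqrt a" by (simp add: algebra_simps)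
    then show "cmod (f (Phi x) - f z - \<i> * blinfun_apply (F' (Phi x)) (0, \<i> * snd (Phi x))) \<le> (K2 * 68 + K1 * 2) * sqrt (cmod (AA (fst x) (fst z)))"
      unfolding a_def fth_def[OF F F'] .
  qed
qed

lemma kk_measurable: "(\<lambda>x. kk f F' x z) \<in> borel_measurable borel"
proof -
  have "(\<lambda>x. complex_of_real (NN (fst x)) * ((f (Phi x) - f z - \<i> * fth F' x) / (AA (fst x) (fst z) * Delta gg (Phi x) z))) \<in> borel_measurable borel"
    using measurable_kernel_parts[OF F F'] NN_fst_measurable by simp
  then show ?thesis unfolding kk_def fth_def[OF F F', symmetric] by (intro borel_measurable_scaleR) auto
qed

text \<open>With exponent 1 the integrals in t and v are borderline, while the order in u is 5/2 - m
  < 1. Part of this room in u pays for raising the exponent to 1 + e and for bringing the orders in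
  t and v below 1, uniformly up to the boundary.\<close>

lemma kk_moment_bound:
  "\<exists>e C. 0 < e \<and> e \<le> 1 \<and> 0 \<le> C \<and> (\<forall>z. rho gg z \<le> 0 \<longrightarrow> (\<integral>\<^sup>+ x. ennreal (cmod (kk f F' x z) powr (1 + e)) \<partial>lborel) \<le> ennreal C)"
proof -
  \<comment> \<open>With 16 e = m - 3/2 and q = 1 + e the order in u is (2-m) q + q/2 + 4 e q = q (1
    - 12 e) = s, which is below 1. The order left for the circle and for v is g = 1 - e^2.\<close>
  define e where "e = (m - 3/2) / 16"
  define q where "q = 1 + e"
  define g where "g = (1 - e) * q"
  define s where "s = q * (1 - 12 * e)"
  have me: "m = 3/2 + 16 * e" by (simp add: e_def field_simps)
  have e: "0 < e" "e \<le> 1 / 32" using m by (auto simp: e_def)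
  have ee: "0 < e * e" using e by simp
  have g1: "g = 1 - e * e" by (simp add: g_def q_def algebra_simps)
  have s1: "s = 1 - 11 * e - 12 * (e * e)" by (simp add: s_def q_def algebra_simps)
  have e2: "e * e \<le> e / 32" using mult_left_mono[OF e(2), of e] e by simp
  have g: "0 < g" "g < 1" unfolding g1 using ee e2 e by linarith+
  have s: "0 \<le> s" "s < 1" unfolding s1 using ee e2 e by linarith+
  have q: "1 < q" using e by (simp add: q_def)
  then have eq0: "0 < e * q" using e by simp
  obtain K where K: "0 \<le> K" "\<And>x z. x \<in> Om \<Longrightarrow> rho gg z \<le> 0 \<Longrightarrow>
     cmod (f (Phi x) - f z - \<i> * blinfun_apply (F' (Phi x)) (0, \<i> * snd (Phi x))) \<le> K * sqrt (cmod (AA (fst x) (fst z)))"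
    using kk_numerator_bound by blast
  obtain Cg where Cg: "0 \<le> Cg" "\<And>A B. A \<noteq> 0 \<Longrightarrow> cmod B \<le> cmod A \<Longrightarrow>
    (\<integral>\<^sup>+ t. ennreal (cmod (A - B * cis (- t)) powr (- g)) * indicator {0..2*pi} t \<partial>lborel) \<le> ennreal (Cg * cmod A powr (- g))"
    using circle_integral_bound[OF g] by blast
  obtain Cs where Cs: "0 \<le> Cs" "\<And>x. (\<integral>\<^sup>+ t. ennreal (\<bar>t - x\<bar> powr (- s)) * indicator {-1..1} t \<partial>lborel) \<le> ennreal Cs"
    using nn_integral_abs_powr_bound[OF s, of "-1" 1] by auto
  obtain Cb where Cb: "0 \<le> Cb" "\<And>x. (\<integral>\<^sup>+ t. ennreal (\<bar>t - x\<bar> powr (- g)) * indicator {-1..1} t \<partial>lborel) \<le> ennreal Cb"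
    using nn_integral_abs_powr_bound[of g "-1" 1] g by auto
  define K1 where "K1 = (18 * K) powr q * (1/64) powr (- (e * q))"
  define K2 where "K2 = K1 * Cg * (1/16) powr (- (q / 2 + g))"
  have K12: "0 \<le> K1" "0 \<le> K2" using Cg by (auto simp: K1_def K2_def)
  have bound: "(\<integral>\<^sup>+ x. ennreal (cmod (kk f F' x z) powr (1 + e)) \<partial>lborel) \<le> ennreal (K2 * (2 * Cs) * Cb)" if z: "rho gg z \<le> 0" for z
  proof -
    note G = Gz_le[OF z]
    let ?A = "\<lambda>p. AA p (fst z)" and ?t = "\<lambda>p. cmod (tau p (fst z))"
    let ?L = "\<lambda>p. K1 * \<bar>fst p\<bar> powr ((m - 2) * q) * cmod (?A p) powr (- q / 2) * ?t p powr (- 4 * (e * q))"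
    have pt: "cmod (kk f F' (p, t) z) powr q \<le> ?L p * cmod (Delta gg (Phi (p, t)) z) powr (- g)"
      if p: "p \<in> GG" "fst p \<noteq> 0" "tau p (fst z) \<noteq> 0" and t: "t \<in> {0..<2*pi}" for p t
    proof -
      have x: "(p, t) \<in> Om" using p t by (simp add: Om_iff)
      have gp: "gp p \<le> 1" "gp p < 1" using p by (auto simp: GG_def)
      define a where "a = cmod (?A p)"
      define dl where "dl = cmod (Delta gg (Phi (p, t)) z)"
      have t0: "0 < ?t p" using p by simp
      have a0: "0 < a" using AA_lower(3)[OF gp(1) G] t0 by (auto simp: a_def)
      have "?t p ^ 4 / 64 \<le> Re (Delta gg (Phi (p, t)) z)"
        using conv_lower(1)[OF gp(1) G] Re_Delta(1)[of "(p, t)" z] gp z by simp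
      then have dl: "?t p ^ 4 / 64 \<le> dl" using complex_Re_le_cmod[of "Delta gg (Phi (p, t)) z"] by (simp add: dl_def)
      have dl0: "0 < dl" using dl t0 zero_less_power[OF t0, of 4] by linarith
      have NN: "0 \<le> NN p" "NN p \<le> 18 * \<bar>fst p\<bar> powr (m - 2)" using NN_bounds[of p] gp p by auto
      have "cmod (kk f F' (p, t) z) = NN p * (cmod (f (Phi (p, t)) - f z - \<i> * blinfun_apply (F' (Phi (p, t))) (0, \<i> * snd (Phi (p, t)))) / (a * dl))"
        using x NN by (simp add: kk_def norm_mult norm_divide a_def dl_def)
      also have "\<dots> \<le> (18 * \<bar>fst p\<bar> powr (m - 2)) * (K * sqrt a / (a * dl))"
        using K(2)[OF x z] NN a0 dl0 by (intro mult_mono divide_right_mono) (auto simp: a_def)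
      also have "\<dots> = (18 * K) * \<bar>fst p\<bar> powr (m - 2) * a powr (- 1 / 2) * dl powr (- 1)"
        using a0 dl0 by (simp add: powr_half_sqrt powr_minus_divide real_div_sqrt field_simps)
      finally have "cmod (kk f F' (p, t) z) powr q \<le> ((18 * K) * \<bar>fst p\<bar> powr (m - 2) * a powr (- 1 / 2) * dl powr (- 1)) powr q"
        using q by (intro powr_mono2) auto
      also have "\<dots> = (18 * K) powr q * \<bar>fst p\<bar> powr ((m - 2) * q) * a powr (- q / 2) * dl powr (- q)"
        unfolding powr_mult powr_powr by simp
      \<comment> \<open>Since q = g + e q, the power g < 1 is kept for the circle integral, and the
        small excess e q is paid for with the weak pointwise bound |Delta| >= |tau|^4 / 64.\<close>
      also have "dl powr (- q) = dl powr (- (e * q)) * dl powr (- g)"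
        by (simp add: powr_add[symmetric] g_def algebra_simps)
      also have "dl powr (- (e * q)) \<le> (?t p ^ 4 / 64) powr (- (e * q))"
        using dl t0 e q by (intro powr_mono2') auto
      also have "(?t p ^ 4 / 64) powr (- (e * q)) = (1/64) powr (- (e * q)) * ?t p powr (- 4 * (e * q))"
      proof -
        have "?t p ^ 4 = ?t p powr 4" using t0 by (simp add: powr_numeral)
        then have "(?t p ^ 4 / 64) powr (- (e * q)) = (1/64 * ?t p powr 4) powr (- (e * q))" by simp
        also have "\<dots> = (1/64) powr (- (e * q)) * ?t p powr (- 4 * (e * q))" unfolding powr_mult powr_powr by simp
        finally show ?thesis .
      qed
      finally show ?thesis by (simp add: K1_def a_def dl_def mult_ac mult_left_mono mult_right_mono)
    qed
    have inner: "(\<integral>\<^sup>+ t. ennreal (cmod (kk f F' (p, t) z) powr q) \<partial>lborel)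
        \<le> ennreal K2 * ((ennreal (\<bar>fst p - 0\<bar> powr (- s)) + ennreal (\<bar>fst p - Re (fst z)\<bar> powr (- s))) * indicator {-1..1} (fst p)
            * (ennreal (\<bar>snd p - Im (fst z)\<bar> powr (- g)) * indicator {-1..1} (snd p)))"
      if ne: "fst p \<noteq> 0" "fst p \<noteq> Re (fst z)" "snd p \<noteq> Im (fst z)" for p
    proof (cases "p \<in> GG")
      case True
      then have gp: "gp p \<le> 1" by (simp add: GG_def)
      have le: "\<bar>fst p\<bar> \<le> 1" "\<bar>snd p\<bar> \<le> 1" using gg_le_1[of "fst p" "snd p"] gp by (auto simp: gp_def)
      have tn: "tau p (fst z) \<noteq> 0" using ne by (auto simp: tau_def complex_eq_iff)
      have t0: "0 < ?t p" using tn by simp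
      have a0: "0 < cmod (?A p)" "?t p / 16 \<le> cmod (?A p)" using AA_lower(3)[OF gp G] t0 by auto
      have BA: "cmod (of_real (rr p) * snd z) \<le> cmod (?A p)"
      proof -
        have r0: "0 \<le> rr p" using gp by (simp add: rr_def)
        have "cmod (of_real (rr p) * snd z) = rr p * cmod (snd z)" using r0 by (simp add: norm_mult)
        also have "\<dots> \<le> ((rr p)\<^sup>2 + (cmod (snd z))\<^sup>2) / 2"
          using zero_le_power2[of "rr p - cmod (snd z)"] by (simp add: power2_eq_square algebra_simps)
        also have "\<dots> \<le> ((1 - gp p) + (1 - Gz (fst z))) / 2" using dom_facts(2)[OF z] rr_sq[OF gp] by simp
        also have "\<dots> \<le> Re (?A p)" using Re_AA[of p "fst z"] conv_lower(2)[OF gp G] by simp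
        also have "\<dots> \<le> cmod (?A p)" by (rule complex_Re_le_cmod)
        finally show ?thesis .
      qed
      have L0: "0 \<le> ?L p" using K12 by simp
      have "(\<integral>\<^sup>+ t. ennreal (cmod (kk f F' (p, t) z) powr q) \<partial>lborel)
        \<le> (\<integral>\<^sup>+ t. ennreal (?L p) * (ennreal (cmod (?A p - of_real (rr p) * snd z * cis (- t)) powr (- g)) * indicator {0..2*pi} t) \<partial>lborel)"
      proof (rule nn_integral_mono)
        fix t
        show "ennreal (cmod (kk f F' (p, t) z) powr q) \<le> ennreal (?L p) * (ennreal (cmod (?A p - of_real (rr p) * snd z * cis (- t)) powr (- g)) * indicator {0..2*pi} t)"
        proof (cases "t \<in> {0..<2*pi}")
          case t: True
          have "ennreal (cmod (kk f F' (p, t) z) powr q) \<le> ennreal (?L p * cmod (Delta gg (Phi (p, t)) z) powr (- g))"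
            by (intro ennreal_leI pt True ne(1) tn t)
          also have "\<dots> = ennreal (?L p) * (ennreal (cmod (?A p - of_real (rr p) * snd z * cis (- t)) powr (- g)) * indicator {0..2*pi} t)"
            using t L0 unfolding Delta_theta[OF gp] by (simp add: ennreal_mult)
          finally show ?thesis .
        next
          case False
          then have "(p, t) \<notin> Om" by (simp add: Om_iff)
          then have "kk f F' (p, t) z = 0" unfolding kk_def by simp
          then show ?thesis by simp
        qed
      qed
      also have "\<dots> = ennreal (?L p) * (\<integral>\<^sup>+ t. ennreal (cmod (?A p - of_real (rr p) * snd z * cis (- t)) powr (- g)) * indicator {0..2*pi} t \<partial>lborel)"
      proof (rule nn_integral_cmult)
        have "(\<lambda>t. cmod (?A p - of_real (rr p) * snd z * cis (- t))) \<in> borel_measurable borel"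
          by (intro borel_measurable_continuous_onI continuous_intros)
        then show "(\<lambda>t. ennreal (cmod (?A p - of_real (rr p) * snd z * cis (- t)) powr (- g)) * indicator {0..2*pi} t) \<in> borel_measurable lborel"
          by simp
      qed
      also have "\<dots> \<le> ennreal (?L p) * ennreal (Cg * cmod (?A p) powr (- g))"
        using a0 BA by (intro mult_left_mono Cg) auto
      also have "\<dots> = ennreal (?L p * (Cg * cmod (?A p) powr (- g)))" using L0 Cg(1) by (intro ennreal_mult[symmetric]) auto
      also have "\<dots> \<le> ennreal (K2 * ((\<bar>fst p\<bar> powr (- s) + \<bar>fst p - Re (fst z)\<bar> powr (- s)) * \<bar>snd p - Im (fst z)\<bar> powr (- g)))"
      proof (rule ennreal_leI)
        let ?a1 = "\<bar>fst p - Re (fst z)\<bar>" and ?b = "\<bar>snd p - Im (fst z)\<bar>"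
        have tge: "?a1 \<le> ?t p" "?b \<le> ?t p" using abs_Re_le_cmod[of "tau p (fst z)"] abs_Im_le_cmod[of "tau p (fst z)"] by (auto simp: tau_def)
        have "cmod (?A p) powr (- q / 2) * cmod (?A p) powr (- g) = cmod (?A p) powr (- (q / 2 + g))" by (simp add: powr_add[symmetric])
        also have "\<dots> \<le> (1/16 * ?t p) powr (- (q / 2 + g))" using a0 t0 q g by (intro powr_mono2') auto
        also have "\<dots> = (1/16) powr (- (q / 2 + g)) * ?t p powr (- (q / 2 + g))" by (rule powr_mult)
        finally have 1: "cmod (?A p) powr (- q / 2) * cmod (?A p) powr (- g) \<le> (1/16) powr (- (q / 2 + g)) * ?t p powr (- (q / 2 + g))" .
        have "?t p powr (- (q / 2 + g)) * ?t p powr (- 4 * (e * q)) = ?t p powr (- (q / 2 + 4 * (e * q))) * ?t p powr (- g)"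
          unfolding powr_add[symmetric] by (rule arg_cong[where f="\<lambda>y. ?t p powr y"]) simp
        \<comment> \<open>Both |u - x| and |v - y| are at most |tau|: order g is spent on v, where
          it is integrable, and all the rest goes to u.\<close>
        also have "\<dots> \<le> ?a1 powr (- (q / 2 + 4 * (e * q))) * ?b powr (- g)"
          using tge ne q g eq0 by (intro mult_mono powr_mono2') auto
        finally have 2: "?t p powr (- (q / 2 + g)) * ?t p powr (- 4 * (e * q)) \<le> ?a1 powr (- (q / 2 + 4 * (e * q))) * ?b powr (- g)" .
        have "\<bar>fst p\<bar> powr (- ((2 - m) * q)) * ?a1 powr (- (q / 2 + 4 * (e * q)))
          \<le> \<bar>fst p\<bar> powr (- ((2 - m) * q + (q / 2 + 4 * (e * q)))) + ?a1 powr (- ((2 - m) * q + (q / 2 + 4 * (e * q))))"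
          using ne q eq0 m by (intro powr_minus_prod_le) auto
        also have "(2 - m) * q + (q / 2 + 4 * (e * q)) = s" unfolding me s_def by (simp add: algebra_simps)
        finally have 3: "\<bar>fst p\<bar> powr ((m - 2) * q) * ?a1 powr (- (q / 2 + 4 * (e * q))) \<le> \<bar>fst p\<bar> powr (- s) + ?a1 powr (- s)"
          by (simp add: algebra_simps)
        have "?L p * (Cg * cmod (?A p) powr (- g)) = K1 * Cg * (\<bar>fst p\<bar> powr ((m - 2) * q) * ?t p powr (- 4 * (e * q)) * (cmod (?A p) powr (- q / 2) * cmod (?A p) powr (- g)))"
          by (simp add: mult_ac)
        also have "\<dots> \<le> K1 * Cg * (\<bar>fst p\<bar> powr ((m - 2) * q) * ?t p powr (- 4 * (e * q)) * ((1/16) powr (- (q / 2 + g)) * ?t p powr (- (q / 2 + g))))"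
          using 1 K12 Cg(1) by (intro mult_left_mono) auto
        also have "\<dots> = K2 * (\<bar>fst p\<bar> powr ((m - 2) * q) * (?t p powr (- (q / 2 + g)) * ?t p powr (- 4 * (e * q))))"
          by (simp add: K2_def mult_ac)
        also have "\<dots> \<le> K2 * (\<bar>fst p\<bar> powr ((m - 2) * q) * (?a1 powr (- (q / 2 + 4 * (e * q))) * ?b powr (- g)))"
          using 2 K12 by (intro mult_left_mono) auto
        also have "\<dots> = K2 * ((\<bar>fst p\<bar> powr ((m - 2) * q) * ?a1 powr (- (q / 2 + 4 * (e * q)))) * ?b powr (- g))" by (simp add: mult_ac)
        also have "\<dots> \<le> K2 * ((\<bar>fst p\<bar> powr (- s) + ?a1 powr (- s)) * ?b powr (- g))"
          using 3 K12 by (intro mult_left_mono mult_right_mono) auto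
        finally show "?L p * (Cg * cmod (?A p) powr (- g)) \<le> K2 * ((\<bar>fst p\<bar> powr (- s) + ?a1 powr (- s)) * ?b powr (- g))" .
      qed
      also have "\<dots> = ennreal K2 * ((ennreal (\<bar>fst p - 0\<bar> powr (- s)) + ennreal (\<bar>fst p - Re (fst z)\<bar> powr (- s))) * indicator {-1..1} (fst p)
            * (ennreal (\<bar>snd p - Im (fst z)\<bar> powr (- g)) * indicator {-1..1} (snd p)))"
        using le K12 by (simp add: ennreal_mult abs_le_iff)
      finally show ?thesis .
    next
      case False
      then have "(p, t) \<notin> Om" for t by (simp add: Om_iff)
      then have "kk f F' (p, t) z = 0" for t unfolding kk_def by simp
      then show ?thesis by simp
    qed
    let ?U = "\<lambda>u. (ennreal (\<bar>u - 0\<bar> powr (- s)) + ennreal (\<bar>u - Re (fst z)\<bar> powr (- s))) * indicator {-1..1} u"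
    let ?V = "\<lambda>v. ennreal (\<bar>v - Im (fst z)\<bar> powr (- g)) * indicator {-1..1} v"
    have km: "(\<lambda>x. ennreal (cmod (kk f F' x z) powr q)) \<in> borel_measurable borel"
      using kk_measurable[of z] by measurable
    have "(\<integral>\<^sup>+ x. ennreal (cmod (kk f F' x z) powr q) \<partial>lborel) = (\<integral>\<^sup>+ p. \<integral>\<^sup>+ t. ennreal (cmod (kk f F' (p, t) z) powr q) \<partial>lborel \<partial>lborel)"
      using nn_integral_lborel_pair[of "\<lambda>p t. ennreal (cmod (kk f F' (p, t) z) powr q)"] km by simp
    also have "\<dots> \<le> (\<integral>\<^sup>+ p. ennreal K2 * (?U (fst p) * ?V (snd p)) \<partial>lborel)"
    proof (rule nn_integral_mono_AE)
      show "AE p in lborel. (\<integral>\<^sup>+ t. ennreal (cmod (kk f F' (p, t) z) powr q) \<partial>lborel) \<le> ennreal K2 * (?U (fst p) * ?V (snd p))"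
        using AE_coords_ne[of 0 "Im (fst z)"] AE_coords_ne[of "Re (fst z)" "Im (fst z)"]
        by eventually_elim (rule inner, auto)
    qed
    also have "\<dots> = (\<integral>\<^sup>+ u. \<integral>\<^sup>+ v. ennreal K2 * (?U u * ?V v) \<partial>lborel \<partial>lborel)"
      by (rule nn_integral_lborel_pair) measurable
    also have "\<dots> = ennreal K2 * ((\<integral>\<^sup>+ u. ?U u \<partial>lborel) * (\<integral>\<^sup>+ v. ?V v \<partial>lborel))"
      by (simp add: nn_integral_cmult nn_integral_multc)
    also have "\<dots> \<le> ennreal K2 * (ennreal (2 * Cs) * ennreal Cb)"
    proof (intro mult_left_mono mult_mono Cb)
      have "(\<integral>\<^sup>+ u. ?U u \<partial>lborel) = (\<integral>\<^sup>+ u. ennreal (\<bar>u - 0\<bar> powr (- s)) * indicator {-1..1} u \<partial>lborel) + (\<integral>\<^sup>+ u. ennreal (\<bar>u - Re (fst z)\<bar> powr (- s)) * indicator {-1..1} u \<partial>lborel)"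
        unfolding distrib_right by (rule nn_integral_add) auto
      also have "\<dots> \<le> ennreal Cs + ennreal Cs" by (intro add_mono Cs)
      also have "\<dots> = ennreal (2 * Cs)" using Cs(1) by (subst ennreal_plus[symmetric]) auto
      finally show "(\<integral>\<^sup>+ u. ?U u \<partial>lborel) \<le> ennreal (2 * Cs)" .
    qed auto
    also have "\<dots> = ennreal (K2 * (2 * Cs) * Cb)" using K12 Cs(1) Cb(1) by (simp add: ennreal_mult mult.assoc)
    finally show ?thesis by (simp only: q_def)
  qed
  show ?thesis
    by (rule exI[of _ e], rule exI[of _ "K2 * (2 * Cs) * Cb"]) (use bound e K12 Cs(1) Cb(1) in auto)
qed

lemma kk_continuous:
  assumes z: "rho gg z \<le> 0"
  shows "AE x in lborel. continuous (at z within D) (kk f F' x)"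
  using AE_tau3[of "fst z"]
proof eventually_elim
  case (elim x)
  show ?case
  proof (cases "x \<in> Om")
    case True
    then have p: "gp (fst x) \<le> 1" by (simp add: Om_def)
    note G = Gz_le[OF z]
    have t0: "0 < cmod (tau (fst x) (fst z))" using elim by simp
    have A: "AA (fst x) (fst z) \<noteq> 0" using AA_lower(3)[OF p G] t0 by auto
    have "0 < cmod (tau (fst x) (fst z)) ^ 4 / 64" using t0 by simp
    then have "0 < Re (Delta gg (Phi x) z)" using conv_lower(1)[OF p G] Re_Delta(1)[OF p z] by linarith
    then have D: "Delta gg (Phi x) z \<noteq> 0" by auto
    have cf: "continuous (at z within D) f" using F has_derivative_continuous continuous_at_imp_continuous_within by blast
    have cA: "continuous (at z within D) (\<lambda>z. AA (fst x) (fst z))" unfolding AA_def tau_def by (intro continuous_intros)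
    have cD: "continuous (at z within D) (\<lambda>z. Delta gg (Phi x) z)" unfolding Delta_eq by (intro continuous_intros)
    show ?thesis unfolding kk_def using A D by (intro continuous_intros cf cA cD) auto
  next
    case False
    then have "kk f F' x = (\<lambda>z. 0)" by (simp add: kk_def fun_eq_iff)
    then show ?thesis by simp
  qed
qed

lemma cauchy_leray_extension:
  "\<exists>G. continuous_on (closure (dom gg)) G \<and> (\<forall>z\<in>dom gg. G z = cauchy_leray gg f z)"
proof -
  obtain e C where eC: "0 < e" "e \<le> 1" "0 \<le> C" "\<And>z. rho gg z \<le> 0 \<Longrightarrow> (\<integral>\<^sup>+ x. ennreal (cmod (kk f F' x z) powr (1 + e)) \<partial>lborel) \<le> ennreal C"
    using kk_moment_bound by blast
  let ?D = "{z. rho gg z \<le> 0}"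
  have crho: "continuous_on UNIV (rho gg)"
  proof -
    have "continuous_on UNIV (\<lambda>w::c2. gg (Re (fst w)) (Im (fst w)))"
    proof -
      have "continuous_on UNIV (\<lambda>w::c2. (Re (fst w), Im (fst w)))" by (intro continuous_intros)
      from continuous_on_compose2[OF cont_gg this] show ?thesis by simp
    qed
    then show ?thesis unfolding rho_def[abs_def] by (intro continuous_intros)
  qed
  have "closed ?D" by (intro closed_Collect_le crho continuous_intros)
  then have sub: "closure (dom gg) \<subseteq> ?D" by (intro closure_minimal) (auto simp: dom_def)
  have "Om \<subseteq> cbox ((-1, -1), 0) ((1, 1), 2 * pi)"
  proof
    fix x assume x: "x \<in> Om"
    then show "x \<in> cbox ((-1, -1), 0) ((1, 1), 2 * pi)"
      using gg_le_1[of "fst (fst x)" "snd (fst x)"] by (cases x) (auto simp: Om_def gp_def abs_le_iff)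
  qed
  then have fin: "emeasure lborel Om < \<infinity>" using emeasure_bounded_finite[OF bounded_subset[OF bounded_cbox]] by blast
  have "continuous_on ?D (\<lambda>z. \<integral>x. kk f F' x z \<partial>lborel)"
  proof (rule continuous_on_integral_uniformly_integrable[where S=Om and e=e and C=C])
    show "kk f F' x z = 0" if "x \<notin> Om" for x z using that by (simp add: kk_def)
  qed (use eC fin kk_measurable kk_continuous Om_measurable in auto)
  note c = this
  have "continuous_on ?D (\<lambda>z. 1 / (4 * pi\<^sup>2) * (f z * (4 * pi * c_kernel) + (\<integral>x. kk f F' x z \<partial>lborel)))"
    by (rule continuous_on_mult[OF continuous_on_const continuous_on_add[OF continuous_on_mult[OF continuous_on_subset[OF cont_f[OF F F'] subset_UNIV] continuous_on_const] c]])
  from continuous_on_subset[OF this sub] show ?thesis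
    by (intro exI conjI ballI, assumption) (rule cauchy_leray_representation[OF F F', symmetric])
qed

end

end

subsection \<open>Large boundary values\<close>

definition C1_real :: "(c2 \<Rightarrow> real) \<Rightarrow> bool" where
  "C1_real h \<longleftrightarrow> (\<exists>h'. (\<forall>x. (h has_derivative blinfun_apply (h' x)) (at x)) \<and> continuous_on UNIV h')"

lemma C1_real_cont: "C1_real h \<Longrightarrow> continuous_on UNIV h"
  unfolding C1_real_def using has_derivative_continuous by (blast intro: continuous_at_imp_continuous_on)

lemma C1_real_linear: "bounded_linear h \<Longrightarrow> C1_real h"
  unfolding C1_real_def
  by (intro exI[of _ "\<lambda>_. Blinfun h"]) (auto simp: bounded_linear_Blinfun_apply bounded_linear_imp_has_derivative)

lemma C1_real_const: "C1_real (\<lambda>_. c)"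
  unfolding C1_real_def by (intro exI[of _ "\<lambda>_. 0"]) (auto simp: zero_blinfun.rep_eq)

lemma C1_real_add: assumes "C1_real f" "C1_real g" shows "C1_real (\<lambda>x. f x + g x)"
proof -
  obtain f' g' where "\<And>x. (f has_derivative blinfun_apply (f' x)) (at x)" "continuous_on UNIV f'"
    "\<And>x. (g has_derivative blinfun_apply (g' x)) (at x)" "continuous_on UNIV g'"
    using assms unfolding C1_real_def by blast
  then show ?thesis unfolding C1_real_def
    by (intro exI[of _ "\<lambda>x. f' x + g' x"]) (auto simp: plus_blinfun.rep_eq intro!: has_derivative_add continuous_intros)
qed

lemma C1_real_mult: assumes "C1_real f" "C1_real g" shows "C1_real (\<lambda>x. f x * g x)"
proof -
  obtain f' g' where *: "\<And>x. (f has_derivative blinfun_apply (f' x)) (at x)" "continuous_on UNIV f'"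
    "\<And>x. (g has_derivative blinfun_apply (g' x)) (at x)" "continuous_on UNIV g'"
    using assms unfolding C1_real_def by blast
  show ?thesis unfolding C1_real_def
  proof (intro exI[of _ "\<lambda>x. f x *\<^sub>R g' x + g x *\<^sub>R f' x"] conjI allI)
    show "((\<lambda>x. f x * g x) has_derivative blinfun_apply (f x *\<^sub>R g' x + g x *\<^sub>R f' x)) (at x)" for x
      by (rule has_derivative_eq_rhs[OF has_derivative_mult[OF *(1,3)]]) (auto simp: plus_blinfun.rep_eq scaleR_blinfun.rep_eq)
    show "continuous_on UNIV (\<lambda>x. f x *\<^sub>R g' x + g x *\<^sub>R f' x)"
      by (intro continuous_intros * C1_real_cont assms)
  qed
qed

lemma C1_real_compose:
  assumes "C1_real f" and d: "\<And>t. (\<psi> has_real_derivative \<psi>' t) (at t)" and c: "continuous_on UNIV \<psi>'"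
  shows "C1_real (\<lambda>x. \<psi> (f x))"
proof -
  obtain f' where *: "\<And>x. (f has_derivative blinfun_apply (f' x)) (at x)" "continuous_on UNIV f'"
    using assms unfolding C1_real_def by blast
  show ?thesis unfolding C1_real_def
  proof (intro exI[of _ "\<lambda>x. \<psi>' (f x) *\<^sub>R f' x"] conjI allI)
    show "((\<lambda>x. \<psi> (f x)) has_derivative blinfun_apply (\<psi>' (f x) *\<^sub>R f' x)) (at x)" for x
      by (rule has_derivative_eq_rhs[OF has_derivative_compose[OF *(1) d[unfolded has_field_derivative_def]]])
        (auto simp: scaleR_blinfun.rep_eq)
    show "continuous_on UNIV (\<lambda>x. \<psi>' (f x) *\<^sub>R f' x)"
      by (intro continuous_intros * continuous_on_compose2[OF c C1_real_cont[OF assms(1)]]) auto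
  qed
qed

lemma C1_fun_of_real: assumes "C1_real f" shows "C1_fun (\<lambda>x. complex_of_real (f x))"
proof -
  obtain f' where *: "\<And>x. (f has_derivative blinfun_apply (f' x)) (at x)" "continuous_on UNIV f'"
    using assms unfolding C1_real_def by blast
  have b: "blinfun_apply (Blinfun complex_of_real) = of_real"
    by (rule bounded_linear_Blinfun_apply[OF bounded_linear_of_real])
  show ?thesis unfolding C1_fun_def
  proof (intro exI[of _ "\<lambda>x. Blinfun of_real o\<^sub>L f' x"] conjI allI)
    show "((\<lambda>x. complex_of_real (f x)) has_derivative blinfun_apply (Blinfun of_real o\<^sub>L f' x)) (at x)" for x
      by (rule has_derivative_eq_rhs[OF has_derivative_of_real[OF *(1)]]) (auto simp: blinfun_compose.rep_eq b)
    show "continuous_on UNIV (\<lambda>x. Blinfun complex_of_real o\<^sub>L f' x)" by (intro continuous_intros *)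
  qed
qed

lemma DERIV_max_sq: "((\<lambda>s::real. (max 0 s)\<^sup>2) has_real_derivative 2 * max 0 s) (at s)"
proof (cases s "0::real" rule: linorder_cases)
  case less
  have "((\<lambda>_. 0) has_real_derivative 2 * max 0 s) (at s)" using less by simp
  then show ?thesis
    by (rule has_field_derivative_transform_within[where d="-s"]) (use less in \<open>auto simp: dist_real_def\<close>)
next
  case greater
  have "((\<lambda>s. s\<^sup>2) has_real_derivative 2 * max 0 s) (at s)" using greater by (auto intro!: derivative_eq_intros)
  then show ?thesis
    by (rule has_field_derivative_transform_within[where d=s]) (use greater in \<open>auto simp: dist_real_def\<close>)
next
  case equal
  have "((\<lambda>h. (max 0 h)\<^sup>2 / h) \<longlongrightarrow> 0) (at (0::real))"
  proof (rule Lim_null_comparison)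
    have "norm ((max 0 h)\<^sup>2 / h) \<le> \<bar>h\<bar>" for h :: real
      by (cases "h \<le> 0") (auto simp: power2_eq_square)
    then show "\<forall>\<^sub>F h in at 0. norm ((max 0 h)\<^sup>2 / h) \<le> \<bar>h :: real\<bar>" by simp
    show "((\<lambda>h::real. \<bar>h\<bar>) \<longlongrightarrow> 0) (at 0)" using tendsto_rabs[OF tendsto_ident_at, of "0::real" UNIV] by simp
  qed
  then show ?thesis using equal by (simp add: has_field_derivative_iff)
qed

text \<open>The outer square makes the cut-off continuously differentiable at t = 1 and t =
  -1.\<close>

definition bump :: "real \<Rightarrow> real" where "bump t = (max 0 (1 - t\<^sup>2))\<^sup>2"

lemma bump_deriv: "(bump has_real_derivative 2 * max 0 (1 - t\<^sup>2) * (- 2 * t)) (at t)"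
  unfolding bump_def[abs_def]
  by (rule DERIV_chain2[OF DERIV_max_sq]) (auto intro!: derivative_eq_intros)

lemma C1_real_bump: "C1_real f \<Longrightarrow> C1_real (\<lambda>x. bump (f x))"
  by (erule C1_real_compose[OF _ bump_deriv]) (intro continuous_intros)

lemma bump_bounds: "0 \<le> bump t" "bump t \<le> 1" "bump t \<noteq> 0 \<Longrightarrow> \<bar>t\<bar> < 1" "\<bar>t\<bar> \<le> 1/2 \<Longrightarrow> 1/2 \<le> bump t"
proof -
  show "0 \<le> bump t" by (simp add: bump_def)
  have "max 0 (1 - t\<^sup>2) \<le> 1" by simp
  then show "bump t \<le> 1" unfolding bump_def by (simp add: power_le_one)
  show "\<bar>t\<bar> < 1" if "bump t \<noteq> 0"
  proof (rule ccontr)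
    assume "\<not> \<bar>t\<bar> < 1"
    then have "1 \<le> t\<^sup>2" using one_le_power[of "\<bar>t\<bar>" 2] by simp
    then show False using that by (simp add: bump_def)
  qed
  assume "\<bar>t\<bar> \<le> 1/2"
  then have "t\<^sup>2 \<le> 1/4" using power_mono[of "\<bar>t\<bar>" "1/2" 2] by (simp add: power2_eq_square)
  then have "(3/4)\<^sup>2 \<le> (max 0 (1 - t\<^sup>2))\<^sup>2" by (intro power_mono) auto
  then show "1/2 \<le> bump t" by (simp add: bump_def power2_eq_square)
qed

text \<open>\<open>rel\<close> is the relation X^m = dl^n rewritten with X = dl lam^(-m). The bound
  dl <= 1/lam^2 keeps lam^2 dl^n small, so that quadratic effects of the tilt stay below dl^n. The
  number 256 gives room for the numerical constants; in particular U/X <= 1/256.\<close>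

locale egg_scale = egg +
  fixes lam dl :: real
  assumes lam: "256 \<le> lam" and dl: "0 < dl" "dl \<le> 1 / lam\<^sup>2"
    and rel: "dl powr (real n - m) = lam powr (- (m * m))"
begin

definition XX :: real where "XX = dl * lam powr (- m)"
definition UU :: real where "UU = XX / lam"
definition YY :: real where "YY = dl / lam"
definition DD :: real where "DD = dl ^ n"

section \<open>Relations between the scales\<close>

lemma pos: "0 < lam" "0 < XX" "0 < UU" "0 < YY" "0 < DD"
  using lam dl by (auto simp: XX_def UU_def YY_def DD_def)

lemma XX_powr: "XX powr m = DD"
proof -
  have "XX powr m = dl powr m * dl powr (real n - m)" unfolding XX_def rel powr_mult powr_powr by simp
  also have "\<dots> = dl powr real n" unfolding powr_add[symmetric] by simp
  also have "\<dots> = DD" using dl by (simp add: DD_def powr_realpow)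
  finally show ?thesis .
qed

text \<open>Over the height \<open>YY\<close> of the receiving box the tilt alpha'(U) y varies by
  about one unit \<open>DD\<close>, so y does not disturb Im Delta.\<close>

lemma UU_YY: "UU powr (m - 1) * YY = DD"
proof -
  have "UU powr (m - 1) * YY = XX powr (m - 1) * (lam powr (- (m - 1)) * lam powr (- 1)) * dl"
  proof -
    have "UU = XX * lam powr (- 1)" "YY = dl * lam powr (- 1)" using pos by (simp_all add: UU_def YY_def powr_minus_divide)
    then have "UU powr (m - 1) * YY = XX powr (m - 1) * lam powr (- 1 * (m - 1)) * (dl * lam powr (- 1))"
      by (simp only: powr_mult powr_powr)
    then show ?thesis by (simp add: mult_ac)
  qed
  also have "lam powr (- (m - 1)) * lam powr (- 1) = lam powr (- m)" unfolding powr_add[symmetric] by simp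
  also have "XX powr (m - 1) * lam powr (- m) * dl = XX powr (m - 1) * XX powr 1" using pos by (simp add: XX_def)
  also have "\<dots> = XX powr m" unfolding powr_add[symmetric] by simp
  finally show ?thesis using XX_powr by simp
qed

text \<open>The base rectangles of the two boxes have comparable area; this is why the measures
  cancel for every p.\<close>

lemma XX_YY: "XX * YY = UU * dl" by (simp add: YY_def UU_def)

text \<open>Over the height \<open>dl\<close> of the source box the tilt varies by about lam units
  \<open>DD\<close>. This is the source of the gain.\<close>

lemma UU_dl: "UU powr (m - 1) * dl = lam * DD"
  using UU_YY pos by (simp add: YY_def field_simps)

lemma XX_le: "XX \<le> dl / lam" "UU \<le> XX / 256" "YY \<le> dl"
proof -
  have "lam powr (- m) \<le> lam powr (- 1)" using lam m by (intro powr_mono) auto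
  then show "XX \<le> dl / lam" unfolding XX_def using dl pos mult_left_mono[of "lam powr - m" "lam powr - 1" dl] by (simp add: powr_minus_divide)
  show "UU \<le> XX / 256" unfolding UU_def using lam pos by (intro divide_left_mono) auto
  show "YY \<le> dl" unfolding YY_def using lam pos dl by (simp add: divide_le_eq)
qed

text \<open>On the source box |Im w_2| is of size lam \<open>DD\<close>, much larger than
  \<open>DD\<close>. Smallness of lam^2 \<open>DD\<close> makes its square negligible against
  \<open>DD\<close>; it follows from \<open>DD\<close> <= dl^2 <= dl/lam^2.\<close>

lemma small: "dl \<le> 1/65536" "lam * DD \<le> 1/65536" "lam\<^sup>2 * DD \<le> 1/65536" "DD \<le> 1/65536"
proof -
  have l2: "65536 \<le> lam\<^sup>2" using power_mono[OF lam, of 2] by simp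
  have "1 / lam\<^sup>2 \<le> 1 / 65536" using l2 by (intro divide_left_mono) auto
  then show d1: "dl \<le> 1/65536" using dl by linarith
  have "DD \<le> dl ^ 2" unfolding DD_def using dl d1 n by (intro power_decreasing) auto
  also have "\<dots> \<le> dl * (1 / lam\<^sup>2)" using mult_left_mono[OF dl(2), of dl] dl(1) by (simp add: power2_eq_square)
  finally have D: "DD \<le> dl / lam\<^sup>2" by simp
  then have "lam\<^sup>2 * DD \<le> dl" using pos by (simp add: field_simps)
  then show 3: "lam\<^sup>2 * DD \<le> 1/65536" using d1 by linarith
  have "lam * DD \<le> lam\<^sup>2 * DD" using lam pos by (intro mult_right_mono self_le_power) auto
  then show "lam * DD \<le> 1/65536" using 3 by linarith
  have "1 * DD \<le> lam\<^sup>2 * DD" using l2 pos by (intro mult_right_mono) auto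
  then show "DD \<le> 1/65536" using 3 by linarith
qed

lemma UU_lt_XX: "2 * UU \<le> XX" "UU powr m \<le> DD" "u \<le> 2 * UU \<Longrightarrow> 0 \<le> u \<Longrightarrow> u powr m \<le> DD"
proof -
  show 1: "2 * UU \<le> XX" using XX_le(2) pos by simp
  show "u powr m \<le> DD" if "u \<le> 2 * UU" "0 \<le> u" for u
    unfolding XX_powr[symmetric] using that 1 m by (intro powr_mono2) auto
  from this[of UU] show "UU powr m \<le> DD" using pos by simp
qed

lemma pow_n_le: "\<bar>v\<bar> \<le> dl \<Longrightarrow> v ^ n \<le> DD" "\<bar>v\<bar> \<le> dl \<Longrightarrow> 0 \<le> v ^ n"
  using power_mono[of "\<bar>v\<bar>" dl n] n by (auto simp: DD_def)

text \<open>The test function lives on the boundary points satisfying inT, and its Cauchy-Leray integral is large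
  on the points satisfying inS. Restricting to negative Re w2 selects the sheet near w2 = -1.\<close>
definition inT :: "c2 \<Rightarrow> bool" where
  "inT w \<longleftrightarrow> UU \<le> Re (fst w) \<and> Re (fst w) \<le> 2 * UU \<and> \<bar>Im (fst w)\<bar> \<le> dl \<and>
     \<bar>Im (snd w) - da (Re (fst w)) / 2 * Im (fst w)\<bar> \<le> DD / 64 \<and> Re (snd w) < 0"
definition inS :: "c2 \<Rightarrow> bool" where
  "inS z \<longleftrightarrow> XX \<le> Re (fst z) \<and> Re (fst z) \<le> 2 * XX \<and> \<bar>Im (fst z)\<bar> \<le> YY / 64 \<and>
     \<bar>Im (snd z)\<bar> \<le> DD / 64 \<and> Re (snd z) < 0 \<and> rho gg z = 0"

lemma da_bound: "UU \<le> u \<Longrightarrow> u \<le> 2 * UU \<Longrightarrow> 0 \<le> da u \<and> da u / 2 \<le> 2 * UU powr (m - 1)"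
proof -
  assume u: "UU \<le> u" "u \<le> 2 * UU"
  then have u0: "0 < u" using pos by linarith
  have "u powr (m - 1) \<le> (2 * UU) powr (m - 1)" using u u0 m by (intro powr_mono2) auto
  also have "\<dots> = 2 powr (m - 1) * UU powr (m - 1)" by (rule powr_mult)
  also have "\<dots> \<le> 2 * UU powr (m - 1)" using m powr_mono[of "m - 1" 1 "2::real"] by (intro mult_right_mono) auto
  finally have "m / 2 * u powr (m - 1) \<le> 1 * (2 * UU powr (m - 1))" using m by (intro mult_mono) auto
  then show ?thesis using u0 m by (simp add: da_def)
qed

text \<open>For 0 < a <= 1 one has a^2 <= a, so 1 - a <= 1 - a^2; here a = -Re w. A point near the
  sheet w_2 = -1 deviates from it only to the order of g + (Im w)^2.\<close>

lemma Re_near: 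
  assumes "(Re w)\<^sup>2 + (Im w)\<^sup>2 = 1 - g" "Re w < 0" "0 \<le> g"
  shows "\<bar>Re w + 1\<bar> \<le> g + (Im w)\<^sup>2"
proof -
  define a where "a = - Re w"
  have a: "0 < a" "a\<^sup>2 = 1 - (g + (Im w)\<^sup>2)" using assms by (auto simp: a_def)
  have "0 \<le> g + (Im w)\<^sup>2" using assms by simp
  then have "a\<^sup>2 \<le> 1" using a by linarith
  then have a1: "a \<le> 1" using a(1) by (simp add: power_le_one_iff)
  have "a * a \<le> a * 1" using a(1) a1 by (intro mult_left_mono) auto
  then have "a\<^sup>2 \<le> a" by (simp add: power2_eq_square)
  then have "1 - a \<le> g + (Im w)\<^sup>2" using a by linarith
  then show ?thesis using a1 by (simp add: a_def)
qed

lemma T_facts: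
  assumes "inT (Phi x)" "x \<in> Om"
  shows "\<bar>Im (snd (Phi x))\<bar> \<le> 3 * (lam * DD)" "gp (fst x) \<le> 2 * DD" "\<bar>Re (snd (Phi x)) + 1\<bar> \<le> 3 * DD"
    "(Im (snd (Phi x)))\<^sup>2 \<le> DD / 100"
proof -
  let ?u = "fst (fst x)" and ?v = "snd (fst x)" and ?p = "Im (snd (Phi x))"
  have T: "UU \<le> ?u" "?u \<le> 2 * UU" "\<bar>?v\<bar> \<le> dl" "\<bar>?p - da ?u / 2 * ?v\<bar> \<le> DD / 64" "Re (snd (Phi x)) < 0"
    using assms(1) by (auto simp: inT_def Phi_simps(1))
  have u0: "0 < ?u" using T pos by linarith
  have "\<bar>da ?u / 2 * ?v\<bar> = da ?u / 2 * \<bar>?v\<bar>" using da_bound[OF T(1,2)] by (simp add: abs_mult)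
  also have "\<dots> \<le> (2 * UU powr (m - 1)) * dl" using da_bound[OF T(1,2)] T(3) by (intro mult_mono) auto
  also have "\<dots> = 2 * (lam * DD)" using UU_dl by simp
  finally have 1: "\<bar>da ?u / 2 * ?v\<bar> \<le> 2 * (lam * DD)" .
  have "DD \<le> lam * DD" using lam pos by simp
  then show p: "\<bar>?p\<bar> \<le> 3 * (lam * DD)" using 1 T(4) pos by linarith
  have "\<bar>?p\<bar>\<^sup>2 \<le> (3 * (lam * DD))\<^sup>2" using p by (intro power_mono) auto
  also have "\<dots> = 9 * (lam\<^sup>2 * DD) * DD" by (simp add: power2_eq_square)
  also have "\<dots> \<le> 1/100 * DD" using small(3) pos by (intro mult_right_mono) auto
  finally show p2: "?p\<^sup>2 \<le> DD / 100" by simp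
  have "gp (fst x) = ?u powr m + ?v ^ n" using u0 by (simp add: gp_def gg_def)
  then show g: "gp (fst x) \<le> 2 * DD" using UU_lt_XX(3)[of ?u] pow_n_le(1)[OF T(3)] T u0 by simp
  have g0: "0 \<le> gp (fst x)" using n by (auto simp: gp_def gg_def)
  have "(Re (snd (Phi x)))\<^sup>2 + ?p\<^sup>2 = 1 - gp (fst x)"
  proof -
    have "(cmod (snd (Phi x)))\<^sup>2 = 1 - gp (fst x)" using assms(2) by (simp add: Phi_simps norm_mult Om_def)
    then show ?thesis by (simp add: cmod_power2)
  qed
  from Re_near[OF this T(5) g0] show "\<bar>Re (snd (Phi x)) + 1\<bar> \<le> 3 * DD" using g p2 pos by linarith
qed

lemma S_facts:
  assumes "inS z"
  shows "Gz (fst z) \<le> 5 * DD" "\<bar>Re (snd z) + 1\<bar> \<le> 6 * DD" "(cmod (snd z))\<^sup>2 = 1 - Gz (fst z)"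
proof -
  let ?x = "Re (fst z)" and ?y = "Im (fst z)"
  have S: "XX \<le> ?x" "?x \<le> 2 * XX" "\<bar>?y\<bar> \<le> YY / 64" "\<bar>Im (snd z)\<bar> \<le> DD / 64" "Re (snd z) < 0" "rho gg z = 0"
    using assms by (auto simp: inS_def)
  have x0: "0 < ?x" using S pos by linarith
  have "?x powr m \<le> (2 * XX) powr m" using S x0 m by (intro powr_mono2) auto
  also have "\<dots> = 2 powr m * DD" unfolding powr_mult XX_powr ..
  also have "\<dots> \<le> 4 * DD"
  proof (rule mult_right_mono)
    have "(2::real) powr m \<le> 2 powr 2" using m by (intro powr_mono) auto
    then show "(2::real) powr m \<le> 4" by simp
  qed (use pos in simp)
  finally have 1: "?x powr m \<le> 4 * DD" .
  have "\<bar>?y\<bar> \<le> dl" using S(3) XX_le(3) pos by linarith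
  from pow_n_le(1)[OF this] 1 show G: "Gz (fst z) \<le> 5 * DD" using x0 by (simp add: Gz_def gg_def)
  show c: "(cmod (snd z))\<^sup>2 = 1 - Gz (fst z)" using S(6) by (simp add: rho_def Gz_def)
  have g0: "0 \<le> Gz (fst z)" using n by (auto simp: Gz_def gg_def)
  have "(Im (snd z))\<^sup>2 \<le> DD"
  proof -
    have "\<bar>Im (snd z)\<bar>\<^sup>2 \<le> DD\<^sup>2" using S(4) pos by (intro power_mono) auto
    also have "\<dots> \<le> DD * 1" unfolding power2_eq_square using small(4) pos by (intro mult_left_mono) auto
    finally show ?thesis by simp
  qed
  moreover have "(Re (snd z))\<^sup>2 + (Im (snd z))\<^sup>2 = 1 - Gz (fst z)" using c by (simp add: cmod_power2)
  from Re_near[OF this S(5) g0] have "\<bar>Re (snd z) + 1\<bar> \<le> Gz (fst z) + (Im (snd z))\<^sup>2" .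
  ultimately show "\<bar>Re (snd z) + 1\<bar> \<le> 6 * DD" using G by linarith
qed

section \<open>Delta between the two boxes\<close>

lemma Delta_conj:
  assumes "gp (fst x) \<le> 1"
  shows "Delta gg (Phi x) z = AA (fst x) (fst z) - cnj (snd (Phi x)) * snd z"
  unfolding Delta_AA[OF assms] by (simp add: Phi_simps rr_def cis_cnj mult_ac)

text \<open>Because u is much smaller than x, the gap in the u direction is essentially x^m, of size
  \<open>DD\<close>: the linear term is m (u/x)^(m-1) x^m with (u/x)^(m-1) <= 64^(-1/2) = 1/8. The
  gap in v is nonnegative and also O(\<open>DD\<close>).\<close>

lemma conv_region:
  assumes "inT (Phi x)" "x \<in> Om" "inS z"
  shows "DD / 4 \<le> conv (fst x) (fst z)" "conv (fst x) (fst z) \<le> 13/2 * DD"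
proof -
  let ?u = "fst (fst x)" and ?v = "snd (fst x)" and ?x = "Re (fst z)" and ?y = "Im (fst z)"
  have T: "UU \<le> ?u" "?u \<le> 2 * UU" "\<bar>?v\<bar> \<le> dl" using assms(1) by (auto simp: inT_def Phi_simps(1))
  have S: "XX \<le> ?x" "?x \<le> 2 * XX" "\<bar>?y\<bar> \<le> YY / 64" using assms(3) by (auto simp: inS_def)
  have u0: "0 < ?u" and x0: "0 < ?x" using T S pos by linarith+
  have um: "?u powr m \<le> DD" by (rule UU_lt_XX(3)) (use T u0 in auto)
  have xm: "DD \<le> ?x powr m" unfolding XX_powr[symmetric] using S pos m by (intro powr_mono2) auto
  have xm2: "?x powr m \<le> 4 * DD"
  proof -
    have "?x powr m \<le> (2 * XX) powr m" using S x0 m by (intro powr_mono2) auto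
    also have "\<dots> = 2 powr m * DD" unfolding powr_mult XX_powr ..
    also have "\<dots> \<le> 4 * DD"
    proof (rule mult_right_mono)
      have "(2::real) powr m \<le> 2 powr 2" using m by (intro powr_mono) auto
      then show "(2::real) powr m \<le> 4" by simp
    qed (use pos in simp)
    finally show ?thesis .
  qed
  have yd: "\<bar>?y\<bar> \<le> dl" using S(3) XX_le(3) pos by linarith
  define al where "al = ?x powr m - ?u powr m - da ?u * (?x - ?u)"
  define be where "be = ?y ^ n - ?v ^ n - db ?v * (?y - ?v)"
  have cv: "conv (fst x) (fst z) = (al + be) / 2"
    using u0 x0 by (simp add: conv_def Gz_def gp_def gg_def al_def be_def)
  have dau: "da ?u * ?u = m * ?u powr m" "da ?u = m * ?u powr (m - 1)"
  proof -
    have "?u powr (m - 1) * ?u powr 1 = ?u powr m" unfolding powr_add[symmetric] by simp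
    then show "da ?u * ?u = m * ?u powr m" "da ?u = m * ?u powr (m - 1)" using u0 by (auto simp: da_def mult.assoc)
  qed
  have al_eq: "al = ?x powr m - da ?u * ?x + (m - 1) * ?u powr m" unfolding al_def by (simp add: right_diff_distrib dau(1) left_diff_distrib)
  have dax: "da ?u * ?x \<le> ?x powr m / 2"
  proof -
    have "da ?u * ?x = m * ((?u powr (m - 1) / ?x powr (m - 1)) * (?x powr (m - 1) * ?x powr 1))"
      using x0 by (simp add: dau(2))
    also have "?x powr (m - 1) * ?x powr 1 = ?x powr m" unfolding powr_add[symmetric] by simp
    also have "?u powr (m - 1) / ?x powr (m - 1) = (?u / ?x) powr (m - 1)" by (rule powr_divide[symmetric])
    also have "\<dots> \<le> (1 / 64) powr (m - 1)"
    proof (intro powr_mono2)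
      have "?u \<le> XX / 64" using T(2) XX_le(2) pos by linarith
      then have "?u / ?x \<le> (XX / 64) / XX" using S(1) u0 pos by (intro frac_le) auto
      then show "?u / ?x \<le> 1 / 64" using pos by simp
    qed (use m u0 x0 in auto)
    also have "(1 / 64 :: real) powr (m - 1) \<le> (1 / 64) powr (1 / 2)" using m by (intro powr_mono') auto
    also have "(1 / 64 :: real) powr (1 / 2) = 1 / 8"
    proof -
      have "sqrt ((1 / 8)\<^sup>2 :: real) = 1 / 8" by (rule real_sqrt_unique) auto
      then show ?thesis by (simp add: powr_half_sqrt power2_eq_square)
    qed
    finally have "da ?u * ?x \<le> m * (1 / 8 * ?x powr m)" using m by (simp add: mult_left_mono mult_right_mono)
    also have "\<dots> \<le> 2 * (1 / 8 * ?x powr m)" using m by (intro mult_right_mono) auto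
    finally show ?thesis using powr_ge_zero[of ?x m] by linarith
  qed
  have "0 \<le> (m - 1) * ?u powr m" using m by simp
  then have al1: "DD / 2 \<le> al" unfolding al_eq using dax xm by linarith
  have "0 \<le> da ?u * ?x" using da_bound[OF T(1,2)] x0 by simp
  moreover have "(m - 1) * ?u powr m \<le> 1 * DD" using um m by (intro mult_mono) auto
  ultimately have al2: "al \<le> 5 * DD" unfolding al_eq using xm2 by linarith
  have be1: "0 \<le> be"
  proof -
    have "0 \<le> (?y - ?v) ^ n" using n by auto
    then show ?thesis using beta_conv[of ?y ?v] unfolding be_def by linarith
  qed
  have be2: "be \<le> 8 * DD"
  proof -
    have n1: "dl ^ (n - 1) * dl = DD" unfolding DD_def using n by (intro power_minus_mult) auto
    have vn: "\<bar>db ?v\<bar> \<le> 4 * dl ^ (n - 1)" unfolding db_def abs_mult power_abs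
      using n T(3) by (intro mult_mono power_mono) auto
    have "\<bar>db ?v * (?y - ?v)\<bar> = \<bar>db ?v\<bar> * \<bar>?y - ?v\<bar>" by (rule abs_mult)
    also have "\<dots> \<le> (4 * dl ^ (n - 1)) * (5/4 * dl)"
    proof (rule mult_mono[OF vn])
      have "\<bar>?y\<bar> \<le> dl / 64" using S(3) XX_le(3) by linarith
      then show "\<bar>?y - ?v\<bar> \<le> 5/4 * dl" using T(3) dl by linarith
    qed (use dl in auto)
    also have "\<dots> = 5 * DD" using n1 by simp
    finally have "\<bar>db ?v * (?y - ?v)\<bar> \<le> 5 * DD" .
    then show ?thesis unfolding be_def using pow_n_le(1)[OF yd] pow_n_le(2)[OF T(3)] pos by linarith
  qed
  show "DD / 4 \<le> conv (fst x) (fst z)" "conv (fst x) (fst z) \<le> 13/2 * DD"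
    unfolding cv using al1 al2 be1 be2 by (simp_all add: field_simps)
qed

text \<open>Re Delta is the convexity gap plus |w_2 - z_2|^2 / 2, which is negligible as both points
  are close to the sheet w_2 = -1. The bound on |Im Delta| is half the lower bound on Re Delta:
  Delta stays in a sector on which Delta^-2 has positive real part, so the integral has no
  cancellation.\<close>

lemma Delta_region:
  assumes T: "inT (Phi x)" "x \<in> Om" and S: "inS z"
  shows "DD / 4 \<le> Re (Delta gg (Phi x) z)" "Re (Delta gg (Phi x) z) \<le> 7 * DD" "\<bar>Im (Delta gg (Phi x) z)\<bar> \<le> DD / 8"
proof -
  let ?u = "fst (fst x)" and ?v = "snd (fst x)" and ?x = "Re (fst z)" and ?y = "Im (fst z)"
  let ?w = "snd (Phi x)" and ?z = "snd z"
  have T': "UU \<le> ?u" "?u \<le> 2 * UU" "\<bar>?v\<bar> \<le> dl" "\<bar>Im ?w - da ?u / 2 * ?v\<bar> \<le> DD / 64" "Re ?w < 0"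
    using T(1) by (auto simp: inT_def Phi_simps(1))
  have S': "XX \<le> ?x" "?x \<le> 2 * XX" "\<bar>?y\<bar> \<le> YY / 64" "\<bar>Im ?z\<bar> \<le> DD / 64" "Re ?z < 0" using S by (auto simp: inS_def)
  have p: "gp (fst x) \<le> 1" using T(2) by (simp add: Om_def)
  note tf = T_facts[OF T] and sf = S_facts[OF S]
  have w2: "(cmod ?w)\<^sup>2 = 1 - gp (fst x)" using T(2) by (simp add: Phi_simps norm_mult Om_def)
  have "Re (Delta gg (Phi x) z) = conv (fst x) (fst z) + (((cmod ?w)\<^sup>2 + (cmod ?z)\<^sup>2) / 2 - Re (cnj ?w * ?z))"
    unfolding Delta_conj[OF p] w2 sf(3) using Re_AA[of "fst x" "fst z"] by simp
  also have "((cmod ?w)\<^sup>2 + (cmod ?z)\<^sup>2) / 2 - Re (cnj ?w * ?z) = ((Re ?w - Re ?z)\<^sup>2 + (Im ?w - Im ?z)\<^sup>2) / 2"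
    unfolding cmod_power2 by (simp add: power2_eq_square algebra_simps)
  finally have Re: "Re (Delta gg (Phi x) z) = conv (fst x) (fst z) + ((Re ?w - Re ?z)\<^sup>2 + (Im ?w - Im ?z)\<^sup>2) / 2" .
  have "\<bar>Re ?w - Re ?z\<bar> \<le> 9 * DD" using tf(3) sf(2) by linarith
  then have "\<bar>Re ?w - Re ?z\<bar>\<^sup>2 \<le> (9 * DD)\<^sup>2" by (intro power_mono) auto
  then have "(Re ?w - Re ?z)\<^sup>2 \<le> (81 * DD) * DD" by (simp add: power2_eq_square)
  also have "\<dots> \<le> 1/10 * DD" using small(4) pos by (intro mult_right_mono) auto
  finally have r1: "(Re ?w - Re ?z)\<^sup>2 \<le> DD / 10" by simp
  have "(Im ?w - Im ?z)\<^sup>2 \<le> 2 * (Im ?w)\<^sup>2 + 2 * (Im ?z)\<^sup>2"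
    using zero_le_power2[of "Im ?w + Im ?z"] by (simp add: power2_eq_square algebra_simps)
  moreover have "(Im ?z)\<^sup>2 \<le> DD / 100"
  proof -
    have "\<bar>Im ?z\<bar>\<^sup>2 \<le> DD\<^sup>2" using S'(4) pos by (intro power_mono) auto
    also have "\<dots> \<le> DD * (1/100)" unfolding power2_eq_square using small(4) pos by (intro mult_left_mono) auto
    finally show ?thesis by simp
  qed
  ultimately have r2: "(Im ?w - Im ?z)\<^sup>2 \<le> DD / 10" using tf(4) pos by linarith
  note cr = conv_region[OF T S]
  have "0 \<le> (Re ?w - Re ?z)\<^sup>2" "0 \<le> (Im ?w - Im ?z)\<^sup>2" by auto
  then show "DD / 4 \<le> Re (Delta gg (Phi x) z)" "Re (Delta gg (Phi x) z) \<le> 7 * DD"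
    unfolding Re using cr r1 r2 pos by argo+
  \<comment> \<open>As Re z_2 is close to -1, the leading terms are alpha'(u) v/2 and -Im w_2; the
    tilted condition in \<open>inT\<close> makes their sum small. The other four terms are estimated
    one by one.\<close>
  have Im: "Im (Delta gg (Phi x) z) = (da ?u / 2 * ?v - Im ?w) + Im ?w * (1 + Re ?z) - da ?u / 2 * ?y - db ?v / 2 * (?u - ?x) - Re ?w * Im ?z"
    unfolding Delta_conj[OF p] by (simp add: AA_def af_def tau_def field_simps)
  have i1: "\<bar>Im ?w * (1 + Re ?z)\<bar> \<le> DD / 64"
  proof -
    have "\<bar>Im ?w * (1 + Re ?z)\<bar> = \<bar>Im ?w\<bar> * \<bar>1 + Re ?z\<bar>" by (rule abs_mult)
    also have "\<dots> \<le> (3 * (lam * DD)) * (6 * DD)" using tf(1) sf(2) by (intro mult_mono) (auto simp: add.commute)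
    also have "\<dots> = (18 * (lam * DD)) * DD" by simp
    also have "\<dots> \<le> 1/64 * DD" using small(2) pos by (intro mult_right_mono) auto
    finally show ?thesis by simp
  qed
  have i2: "\<bar>da ?u / 2 * ?y\<bar> \<le> DD / 32"
  proof -
    have "\<bar>da ?u / 2 * ?y\<bar> = da ?u / 2 * \<bar>?y\<bar>" using da_bound[OF T'(1,2)] by (simp add: abs_mult)
    also have "\<dots> \<le> (2 * UU powr (m - 1)) * (YY / 64)" using da_bound[OF T'(1,2)] S'(3) by (intro mult_mono) auto
    also have "\<dots> = DD / 32" using UU_YY by (simp add: mult.commute)
    finally show ?thesis .
  qed
  have i3: "\<bar>db ?v / 2 * (?u - ?x)\<bar> \<le> DD / 64"
  proof -
    have n1: "dl ^ (n - 1) * dl = DD" unfolding DD_def using n by (intro power_minus_mult) auto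
    have vn: "\<bar>db ?v\<bar> \<le> 4 * dl ^ (n - 1)" unfolding db_def abs_mult power_abs
      using n T'(3) by (intro mult_mono power_mono) auto
    have "\<bar>db ?v / 2 * (?u - ?x)\<bar> = \<bar>db ?v\<bar> / 2 * \<bar>?u - ?x\<bar>" by (simp add: abs_mult)
    also have "\<dots> \<le> (4 * dl ^ (n - 1)) / 2 * (2 * (dl / lam))"
    proof (intro mult_mono divide_right_mono vn)
      show "\<bar>?u - ?x\<bar> \<le> 2 * (dl / lam)" using T'(1,2) S'(1,2) UU_lt_XX(1) XX_le(1) pos by linarith
    qed (use dl lam in auto)
    also have "\<dots> = 4 / lam * (dl ^ (n - 1) * dl)" by simp
    also have "\<dots> \<le> 1 / 64 * DD" unfolding n1 using lam pos by (intro mult_right_mono) (auto simp: divide_le_eq)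
    finally show ?thesis by simp
  qed
  have i4: "\<bar>Re ?w * Im ?z\<bar> \<le> DD / 64"
  proof -
    have "0 \<le> gp (fst x)" using n by (auto simp: gp_def gg_def)
    then have "(cmod ?w)\<^sup>2 \<le> 1" using w2 by simp
    then have "cmod ?w \<le> 1" by (simp add: power_le_one_iff)
    then have "\<bar>Re ?w\<bar> \<le> 1" using abs_Re_le_cmod[of ?w] by linarith
    then have "\<bar>Re ?w\<bar> * \<bar>Im ?z\<bar> \<le> 1 * (DD / 64)" using S'(4) by (intro mult_mono) auto
    then show ?thesis by (simp add: abs_mult)
  qed
  show "\<bar>Im (Delta gg (Phi x) z)\<bar> \<le> DD / 8" unfolding Im using T'(4) i1 i2 i3 i4 pos by linarith
qed

text \<open>With D = X + iY and |Y| <= X/2, the real part (X^2 - Y^2)/(X^2 + Y^2)^2 is at least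
  12/25 times X^-2, and X <= 7 \<open>DD\<close>.\<close>

lemma Re_inverse_square:
  assumes "DD / 4 \<le> Re D" "Re D \<le> 7 * DD" "\<bar>Im D\<bar> \<le> DD / 8"
  shows "1 / (128 * DD\<^sup>2) \<le> Re (1 / D\<^sup>2)"
proof -
  define X Y where "X = Re D" and "Y = Im D"
  have X: "0 < X" using assms pos by (simp add: X_def)
  have "\<bar>Y\<bar> \<le> X / 2" using assms by (simp add: X_def Y_def)
  then have "\<bar>Y\<bar>\<^sup>2 \<le> (X / 2)\<^sup>2" by (intro power_mono) auto
  then have Y2: "Y\<^sup>2 \<le> X\<^sup>2 / 4" by (simp add: power2_eq_square)
  have X2: "0 < X\<^sup>2" using X by simp
  have "1 / D\<^sup>2 = (cnj D)\<^sup>2 / of_real ((X\<^sup>2 + Y\<^sup>2)\<^sup>2)"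
  proof -
    have e: "D * cnj D = of_real (X\<^sup>2 + Y\<^sup>2)" by (simp add: complex_mult_cnj X_def Y_def)
    have D0: "D \<noteq> 0" using X by (auto simp: X_def)
    have "of_real ((X\<^sup>2 + Y\<^sup>2)\<^sup>2) = D\<^sup>2 * (cnj D)\<^sup>2" unfolding of_real_power e[symmetric] by (rule power_mult_distrib)
    then show ?thesis using D0 by (simp add: nonzero_divide_mult_cancel_right)
  qed
  then have "Re (1 / D\<^sup>2) = (X\<^sup>2 - Y\<^sup>2) / (X\<^sup>2 + Y\<^sup>2)\<^sup>2"
    by (simp only: Re_divide_of_real) (simp add: X_def Y_def power2_eq_square)
  also have "\<dots> \<ge> (3/4 * X\<^sup>2) / (5/4 * X\<^sup>2)\<^sup>2"
  proof (rule frac_le)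
    show "(X\<^sup>2 + Y\<^sup>2)\<^sup>2 \<le> (5/4 * X\<^sup>2)\<^sup>2" using Y2 by (intro power_mono) auto
    show "0 < (X\<^sup>2 + Y\<^sup>2)\<^sup>2" by (rule zero_less_power[OF add_pos_nonneg[OF X2 zero_le_power2]])
  qed (use Y2 order_trans[OF Y2, of "X\<^sup>2"] in \<open>simp_all add: field_simps\<close>)
  also have "(3/4 * X\<^sup>2) / (5/4 * X\<^sup>2)\<^sup>2 = 12 / 25 / X\<^sup>2" using X by (simp add: power2_eq_square)
  finally have 1: "12 / 25 / X\<^sup>2 \<le> Re (1 / D\<^sup>2)" .
  have "X\<^sup>2 \<le> (7 * DD)\<^sup>2" using X assms by (intro power_mono) (auto simp: X_def)
  then have "12 / 25 / (7 * DD)\<^sup>2 \<le> 12 / 25 / X\<^sup>2" using X2 pos by (intro divide_left_mono) auto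
  moreover have "1 / (128 * DD\<^sup>2) \<le> 12 / 25 / (7 * DD)\<^sup>2" using pos by (simp add: power_mult_distrib field_simps)
  ultimately show ?thesis using 1 by linarith
qed

text \<open>A positive C^1 function on the whole line that equals u for u >= U; below U it is (u^2 +
  U^2)/(2U). Powers of it are C^1 everywhere, whereas \<open>da\<close> need not be C^1 at 0, so
  \<open>kap\<close> is a C^1 extension of the tilt coefficient alpha'(u)/2.\<close>

definition phi_ext :: "real \<Rightarrow> real" where "phi_ext u = u + (max 0 (UU - u))\<^sup>2 / (2 * UU)"
definition kap :: "real \<Rightarrow> real" where "kap u = m / 2 * phi_ext u powr (m - 1)"
text \<open>Cut-offs to U < u < 2U, |v| < dl and the tilted strip for Im w_2. The last factor
  confines Re w_2 to (-3/2, -1/2) and thus selects the sheet in a C^1 way.\<close>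

definition test :: "c2 \<Rightarrow> real" where
  "test w = bump ((Re (fst w) - 3/2 * UU) / (UU / 2)) * bump (Im (fst w) / dl) *
     (bump ((Im (snd w) - kap (Re (fst w)) * Im (fst w)) / (DD / 64)) * bump (2 * (Re (snd w) + 1)))"

lemma phi_ext_pos: "0 < phi_ext u"
proof (cases "UU \<le> u")
  case True
  then show ?thesis using pos by (simp add: phi_ext_def max_def)
next
  case False
  have "phi_ext u = (u\<^sup>2 + UU\<^sup>2) / (2 * UU)"
    using False pos by (simp add: phi_ext_def max_def field_simps power2_eq_square)
  then show ?thesis using pos by (simp add: add_nonneg_pos)
qed

lemma kap_eq: "UU \<le> u \<Longrightarrow> kap u = da u / 2"
  using pos by (simp add: kap_def phi_ext_def da_def max_def)

lemma C1_real_test: "C1_real test"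
proof -
  have re: "C1_real (\<lambda>w. Re (fst w))" "C1_real (\<lambda>w. Im (fst w))" "C1_real (\<lambda>w. Re (snd w))" "C1_real (\<lambda>w. Im (snd w))"
    by (intro C1_real_linear bounded_linear_compose[OF bounded_linear_Re] bounded_linear_compose[OF bounded_linear_Im] bounded_linear_fst bounded_linear_snd)+
  have sc: "C1_real (\<lambda>w. c * h w)" if "C1_real h" for c h by (rule C1_real_mult[OF C1_real_const that])
  have dphi: "(phi_ext has_real_derivative 1 - max 0 (UU - t) / UU) (at t)" for t
  proof -
    have "((\<lambda>u. (max 0 (UU - u))\<^sup>2) has_real_derivative 2 * max 0 (UU - t) * (- 1)) (at t)"
      by (rule DERIV_chain2[OF DERIV_max_sq]) (auto intro!: derivative_eq_intros)
    from DERIV_add[OF DERIV_ident DERIV_cdivide[OF this, of "2 * UU"]]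
    show ?thesis using pos by (simp add: phi_ext_def[abs_def])
  qed
  have "C1_real (\<lambda>w. kap (Re (fst w)))"
  proof (rule C1_real_compose[OF re(1)])
    show "(kap has_real_derivative m / 2 * ((m - 1) * phi_ext t powr (m - 1 - 1) * (1 - max 0 (UU - t) / UU))) (at t)" for t
      unfolding kap_def[abs_def]
      by (intro DERIV_cmult DERIV_chain2[OF has_real_derivative_powr[OF phi_ext_pos] dphi])
    have "continuous_on UNIV phi_ext" unfolding phi_ext_def[abs_def] using pos by (intro continuous_intros) auto
    then show "continuous_on UNIV (\<lambda>t. m / 2 * ((m - 1) * phi_ext t powr (m - 1 - 1) * (1 - max 0 (UU - t) / UU)))"
      using pos phi_ext_pos by (intro continuous_intros) (auto simp: less_imp_neq[symmetric])
  qed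
  then have k: "C1_real (\<lambda>w. Im (snd w) + (-1) * (kap (Re (fst w)) * Im (fst w)))" by (intro C1_real_add sc C1_real_mult re)
  have 1: "C1_real (\<lambda>w. bump ((1 / (UU / 2)) * (Re (fst w) + - (3/2 * UU))))" by (intro C1_real_bump sc C1_real_add re C1_real_const)
  have 2: "C1_real (\<lambda>w. bump ((1 / dl) * Im (fst w)))" by (intro C1_real_bump sc re)
  have 3: "C1_real (\<lambda>w. bump ((1 / (DD / 64)) * (Im (snd w) + (-1) * (kap (Re (fst w)) * Im (fst w)))))" by (intro C1_real_bump sc k)
  have 4: "C1_real (\<lambda>w. bump (2 * (Re (snd w) + 1)))" by (intro C1_real_bump sc C1_real_add re C1_real_const)
  have e: "1 / c * (a + - b) = (a - b) / c" "1 / c * a = a / c" "a + (-1) * b = a - b" for a b c :: real by simp_all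
  show ?thesis
    unfolding test_def[abs_def]
    by (rule C1_real_mult[OF C1_real_mult[OF 1[unfolded e(1)] 2[unfolded e(2)]] C1_real_mult[OF 3[unfolded e(2,3)] 4]])
qed

lemma test_bounds: "0 \<le> test w" "test w \<le> 1"
  unfolding test_def by (auto intro!: mult_nonneg_nonneg mult_le_one bump_bounds)

lemma test_support:
  assumes "test w \<noteq> 0" shows "inT w" "Re (snd w) < - 1/2"
proof -
  have b: "\<bar>(Re (fst w) - 3/2 * UU) / (UU / 2)\<bar> < 1" "\<bar>Im (fst w) / dl\<bar> < 1"
    "\<bar>(Im (snd w) - kap (Re (fst w)) * Im (fst w)) / (DD / 64)\<bar> < 1" "\<bar>2 * (Re (snd w) + 1)\<bar> < 1"
    using assms by (auto simp: test_def dest!: bump_bounds(3))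
  have u: "UU \<le> Re (fst w)" "Re (fst w) \<le> 2 * UU" using b(1) pos by (auto simp: abs_less_iff field_simps)
  show s: "Re (snd w) < - 1/2" using b(4) by (simp add: abs_less_iff)
  have gen: "\<bar>A\<bar> < c" if "\<bar>A / c\<bar> < 1" "0 < c" for A c :: real using that by (simp add: abs_divide)
  have "\<bar>Im (fst w)\<bar> < dl" "\<bar>Im (snd w) - kap (Re (fst w)) * Im (fst w)\<bar> < DD / 64"
    using gen[OF b(2)] gen[OF b(3)] pos dl by auto
  then show "inT w" unfolding inT_def kap_eq[OF u(1), symmetric] using u s by auto
qed

lemma test_measurable: "test \<in> borel_measurable borel"
  by (rule borel_measurable_continuous_onI[OF C1_real_cont[OF C1_real_test]])

lemma test_Phi_measurable: "(\<lambda>x. test (Phi x)) \<in> borel_measurable borel"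
  by (rule measurable_compose[OF Phi_measurable test_measurable])

section \<open>Boundary values on the receiving box\<close>

definition KK :: "c2 \<Rightarrow> (real \<times> real) \<times> real \<Rightarrow> complex" where
  "KK z x = indicator Om x * of_real (NN (fst x)) * of_real (test (Phi x)) / (Delta gg (Phi x) z)\<^sup>2"

lemma KK_bound:
  assumes "\<And>x. x \<in> Om \<Longrightarrow> test (Phi x) \<noteq> 0 \<Longrightarrow> DD / 8 \<le> cmod (Delta gg (Phi x) z)"
  shows "integrable lborel (KK z)" "cmod (KK z x) \<le> 64 / DD\<^sup>2 * cmod (indicator Om x *\<^sub>R complex_of_real (NN (fst x)))"
proof -
  have b: "cmod (of_real (test (Phi x)) / (Delta gg (Phi x) z)\<^sup>2) \<le> 64 / DD\<^sup>2" if "x \<in> Om" for x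
  proof (cases "test (Phi x) = 0")
    case False
    have "cmod (of_real (test (Phi x)) / (Delta gg (Phi x) z)\<^sup>2) \<le> 1 / (DD / 8)\<^sup>2"
      unfolding norm_divide norm_power norm_of_real
      using assms[OF that False] test_bounds[of "Phi x"] pos by (intro frac_le power_mono) auto
    then show ?thesis by (simp add: power_divide)
  qed (use pos in simp)
  have eq: "KK z x = (indicator Om x *\<^sub>R complex_of_real (NN (fst x))) * (of_real (test (Phi x)) / (Delta gg (Phi x) z)\<^sup>2)" for x
    by (simp add: KK_def indicator_def)
  have "integrable lborel (\<lambda>x. (indicator Om x *\<^sub>R complex_of_real (NN (fst x))) * (of_real (test (Phi x)) / (Delta gg (Phi x) z)\<^sup>2))"
  proof (rule integrable_times_bounded[OF integrable_NN_Om, where B="64 / DD\<^sup>2"])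
    show "(\<lambda>x. complex_of_real (test (Phi x)) / (Delta gg (Phi x) z)\<^sup>2) \<in> borel_measurable lborel"
      using test_Phi_measurable Phi_comp_measurable(1)[of z] by simp
    fix x assume "indicator Om x *\<^sub>R complex_of_real (NN (fst x)) \<noteq> 0"
    then show "cmod (of_real (test (Phi x)) / (Delta gg (Phi x) z)\<^sup>2) \<le> 64 / DD\<^sup>2"
      by (intro b) (auto simp: indicator_def split: if_splits)
  qed
  then show "integrable lborel (KK z)" unfolding eq[symmetric] .
  show "cmod (KK z x) \<le> 64 / DD\<^sup>2 * cmod (indicator Om x *\<^sub>R complex_of_real (NN (fst x)))"
  proof (cases "x \<in> Om")
    case True
    have "cmod (KK z x) = cmod (indicator Om x *\<^sub>R complex_of_real (NN (fst x))) * cmod (of_real (test (Phi x)) / (Delta gg (Phi x) z)\<^sup>2)"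
      unfolding eq by (rule norm_mult)
    also have "\<dots> \<le> cmod (indicator Om x *\<^sub>R complex_of_real (NN (fst x))) * (64 / DD\<^sup>2)" by (intro mult_left_mono b True) simp
    finally show ?thesis by (simp only: mult.commute)
  qed (simp add: KK_def)
qed

text \<open>Delta is affine in its second argument with coefficients bounded by 3 and 1, so moving z
  by \<open>DD\<close>/128 changes it by at most \<open>DD\<close>/32, while it is at least
  \<open>DD\<close>/4 at z.\<close>

lemma Delta_lower_near:
  assumes S: "inS z" and x: "x \<in> Om" "test (Phi x) \<noteq> 0" and d: "dist \<zeta> z < DD / 128"
  shows "DD / 8 \<le> cmod (Delta gg (Phi x) \<zeta>)"
proof -
  have p: "gp (fst x) \<le> 1" using x by (simp add: Om_def)
  have g0: "0 \<le> gp (fst x)" using n by (auto simp: gp_def gg_def)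
  have "DD / 4 \<le> cmod (Delta gg (Phi x) z)"
    using Delta_region(1)[OF test_support(1)[OF x(2)] x(1) S] complex_Re_le_cmod[of "Delta gg (Phi x) z"] by linarith
  moreover have "Delta gg (Phi x) z - Delta gg (Phi x) \<zeta> = p0 (Phi x) * (fst \<zeta> - fst z) + cnj (snd (Phi x)) * (snd \<zeta> - snd z)"
    unfolding Delta_eq by (simp add: algebra_simps)
  then have "cmod (Delta gg (Phi x) z - Delta gg (Phi x) \<zeta>) \<le> cmod (p0 (Phi x)) * cmod (fst \<zeta> - fst z) + cmod (snd (Phi x)) * cmod (snd \<zeta> - snd z)"
    by (metis norm_triangle_ineq norm_mult complex_mod_cnj)
  moreover have "cmod (p0 (Phi x)) * cmod (fst \<zeta> - fst z) \<le> 3 * (DD / 128)"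
  proof (rule mult_mono)
    have paf: "p0 (Phi x) = af (fst x)" by (simp add: p0_def af_def Phi_simps(1))
    have le: "\<bar>fst (fst x)\<bar> \<le> 1" "\<bar>snd (fst x)\<bar> \<le> 1" using gg_le_1[of "fst (fst x)" "snd (fst x)"] p by (auto simp: gp_def)
    show "cmod (p0 (Phi x)) \<le> 3" unfolding paf using cmod_le[of "af (fst x)"] da_db_le[OF le] by (simp add: af_def)
    show "cmod (fst \<zeta> - fst z) \<le> DD / 128" using d dist_fst_le[of \<zeta> z] by (simp add: dist_norm)
  qed auto
  moreover have "cmod (snd (Phi x)) * cmod (snd \<zeta> - snd z) \<le> 1 * (DD / 128)"
  proof (rule mult_mono)
    show "cmod (snd (Phi x)) \<le> 1" using p g0 by (simp add: Phi_simps norm_mult)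
    show "cmod (snd \<zeta> - snd z) \<le> DD / 128" using d dist_snd_le[of \<zeta> z] by (simp add: dist_norm)
  qed auto
  moreover have "cmod (Delta gg (Phi x) z) \<le> cmod (Delta gg (Phi x) z - Delta gg (Phi x) \<zeta>) + cmod (Delta gg (Phi x) \<zeta>)"
    using norm_triangle_ineq[of "Delta gg (Phi x) z - Delta gg (Phi x) \<zeta>" "Delta gg (Phi x) \<zeta>"] by simp
  ultimately show ?thesis using pos(5) by linarith
qed

text \<open>Shrinking z towards the origin stays in D: for 0 < t < 1 both g(t z_1) <= t g(z_1) and
  |t z_2|^2 <= t |z_2|^2, so rho(t z) <= t - 1. Thus the filter in \<open>cauchy_leray_bv\<close> is
  nontrivial and \<open>Lim\<close> is determined there.\<close>

lemma inS_islimpt: assumes S: "inS z" shows "z islimpt dom gg"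
  unfolding islimpt_sequential
proof (intro exI conjI allI)
  let ?t = "\<lambda>k. 1 - 1 / real (k + 2)"
  have t: "0 < ?t k" "?t k < 1" for k by auto
  have "(\<lambda>k. 1 / real (k + 2)) \<longlonglongrightarrow> 0" using LIMSEQ_ignore_initial_segment[OF lim_1_over_n, of 2] by simp
  then have "?t \<longlonglongrightarrow> 1 - 0" by (intro tendsto_intros)
  from tendsto_scaleR[OF this tendsto_const[of z]] have "(\<lambda>k. ?t k *\<^sub>R z) \<longlonglongrightarrow> (1 - 0) *\<^sub>R z" .
  then show "(\<lambda>k. ?t k *\<^sub>R z) \<longlonglongrightarrow> z" by simp
  fix k
  have r: "(cmod (snd z))\<^sup>2 = 1 - Gz (fst z)" by (rule S_facts(3)[OF S])
  have G: "Gz (?t k *\<^sub>R fst z) \<le> ?t k * Gz (fst z)"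
  proof -
    have "\<bar>?t k * Re (fst z)\<bar> powr m = ?t k powr m * \<bar>Re (fst z)\<bar> powr m"
      using t(1)[of k] by (simp only: abs_mult powr_mult abs_of_pos)
    also have "\<dots> \<le> ?t k powr 1 * \<bar>Re (fst z)\<bar> powr m" using t[of k] m by (intro mult_right_mono powr_mono') auto
    also have "\<dots> = ?t k * \<bar>Re (fst z)\<bar> powr m" using t(1)[of k] by (simp only: powr_one)
    finally have 1: "\<bar>?t k * Re (fst z)\<bar> powr m \<le> ?t k * \<bar>Re (fst z)\<bar> powr m" .
    have "(?t k * Im (fst z)) ^ n = ?t k ^ n * Im (fst z) ^ n" by (rule power_mult_distrib)
    also have "\<dots> \<le> ?t k ^ 1 * Im (fst z) ^ n"
      using t[of k] n by (intro mult_right_mono power_decreasing) auto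
    finally have "(?t k * Im (fst z)) ^ n \<le> ?t k * Im (fst z) ^ n" by simp
    then show ?thesis using 1 unfolding Gz_def gg_def by (simp only: scaleR_complex.sel distrib_left)
  qed
  have "(cmod (?t k *\<^sub>R snd z))\<^sup>2 = (?t k)\<^sup>2 * (cmod (snd z))\<^sup>2"
    using t[of k] unfolding norm_scaleR by (simp only: power_mult_distrib power2_abs)
  also have "\<dots> \<le> ?t k * (cmod (snd z))\<^sup>2"
  proof (rule mult_right_mono)
    have "?t k * ?t k \<le> ?t k * 1" using t[of k] by (intro mult_left_mono) auto
    then show "(?t k)\<^sup>2 \<le> ?t k" by (simp only: power2_eq_square mult_1_right)
  qed simp
  finally have c: "(cmod (?t k *\<^sub>R snd z))\<^sup>2 \<le> ?t k * (1 - Gz (fst z))" unfolding r .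
  have "rho gg (?t k *\<^sub>R z) = (cmod (?t k *\<^sub>R snd z))\<^sup>2 + Gz (?t k *\<^sub>R fst z) - 1"
    unfolding rho_def Gz_def by (simp only: snd_scaleR fst_scaleR)
  also have "\<dots> \<le> ?t k * (1 - Gz (fst z)) + ?t k * Gz (fst z) - 1" using c G by linarith
  also have "\<dots> = ?t k - 1" unfolding distrib_left[symmetric] by simp
  also have "\<dots> < 0" using t(2)[of k] by linarith
  finally have "?t k *\<^sub>R z \<in> dom gg" unfolding dom_def by simp
  moreover have "?t k *\<^sub>R z \<noteq> z"
  proof
    assume e: "?t k *\<^sub>R z = z"
    have "(?t k - 1) *\<^sub>R z = 0" unfolding scaleR_left_diff_distrib[of "?t k" 1 z] e by simp
    moreover have "?t k - 1 \<noteq> 0" using t(2)[of k] by linarith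
    ultimately have "z = 0" unfolding scaleR_eq_0_iff by blast
    then show False using S pos by (simp add: inS_def)
  qed
  ultimately show "?t k *\<^sub>R z \<in> dom gg - {z}" by simp
qed

text \<open>The source and receiving boxes are disjoint, and Delta stays away from 0 between them
  even though z lies on the boundary. The boundary integral is therefore absolutely convergent and
  is the limit from inside by dominated convergence.\<close>

lemma boundary_value:
  assumes S: "inS z"
  shows "cauchy_leray_bv gg (\<lambda>w. of_real (test w)) z = 1 / (4 * pi\<^sup>2) * (\<integral>x. KK z x \<partial>lborel)"
proof -
  have tm: "(\<lambda>w. complex_of_real (test w)) \<in> borel_measurable borel" using test_measurable by simp
  have cl: "cauchy_leray gg (\<lambda>w. of_real (test w)) \<zeta> = 1 / (4 * pi\<^sup>2) * (\<integral>x. KK \<zeta> x \<partial>lborel)" for \<zeta>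
    unfolding cauchy_leray_eq[OF tm] KK_def ..
  have near: "DD / 8 \<le> cmod (Delta gg (Phi x) \<zeta>)" if "dist \<zeta> z < DD / 128" "x \<in> Om" "test (Phi x) \<noteq> 0" for x \<zeta>
    using Delta_lower_near[OF S that(2,3,1)] .
  have "((\<lambda>\<zeta>. \<integral>x. KK \<zeta> x \<partial>lborel) \<longlongrightarrow> (\<integral>x. KK z x \<partial>lborel)) (at z within dom gg)"
    unfolding tendsto_at_iff_sequentially comp_def
  proof (intro allI impI)
    fix zs assume "\<forall>i. zs i \<in> dom gg - {z}" and zs: "zs \<longlonglongrightarrow> z"
    then obtain M where M: "\<And>i. M \<le> i \<Longrightarrow> dist (zs i) z < DD / 128"
      using pos(5) unfolding lim_sequentially by (metis divide_pos_pos zero_less_numeral)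
    have "(\<lambda>i. \<integral>x. KK (zs (i + M)) x \<partial>lborel) \<longlonglongrightarrow> (\<integral>x. KK z x \<partial>lborel)"
    proof (rule integral_dominated_convergence[where w="\<lambda>x. 64 / DD\<^sup>2 * cmod (indicator Om x *\<^sub>R complex_of_real (NN (fst x)))"])
      show "integrable lborel (\<lambda>x. 64 / DD\<^sup>2 * cmod (indicator Om x *\<^sub>R complex_of_real (NN (fst x))))"
        by (intro integrable_mult_right integrable_norm integrable_NN_Om)
      show "KK z \<in> borel_measurable lborel" "KK (zs (i + M)) \<in> borel_measurable lborel" for i
        using KK_bound(1)[OF near[of z]] KK_bound(1)[OF near[OF M[of "i + M"]]] pos by auto
      show "AE x in lborel. norm (KK (zs (i + M)) x) \<le> 64 / DD\<^sup>2 * cmod (indicator Om x *\<^sub>R complex_of_real (NN (fst x)))" for i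
        by (intro AE_I2 KK_bound(2) near M) auto
      show "AE x in lborel. (\<lambda>i. KK (zs (i + M)) x) \<longlonglongrightarrow> KK z x"
      proof (rule AE_I2)
        fix x
        show "(\<lambda>i. KK (zs (i + M)) x) \<longlonglongrightarrow> KK z x"
        proof (cases "x \<in> Om \<and> test (Phi x) \<noteq> 0")
          case True
          have zM: "(\<lambda>i. zs (i + M)) \<longlonglongrightarrow> z" using zs by (rule LIMSEQ_ignore_initial_segment)
          have "DD / 8 \<le> cmod (Delta gg (Phi x) z)" using True pos by (intro near) auto
          then have D0: "Delta gg (Phi x) z \<noteq> 0" using pos by auto
          have "(\<lambda>i. Delta gg (Phi x) (zs (i + M))) \<longlonglongrightarrow> Delta gg (Phi x) z"
            unfolding Delta_eq by (intro tendsto_intros zM)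
          then show ?thesis unfolding KK_def using D0 by (intro tendsto_intros) auto
        qed (auto simp: KK_def)
      qed
    qed
    then show "(\<lambda>i. \<integral>x. KK (zs i) x \<partial>lborel) \<longlonglongrightarrow> (\<integral>x. KK z x \<partial>lborel)" by (rule LIMSEQ_offset)
  qed
  then have "(cauchy_leray gg (\<lambda>w. of_real (test w)) \<longlongrightarrow> 1 / (4 * pi\<^sup>2) * (\<integral>x. KK z x \<partial>lborel)) (at z within dom gg)"
    unfolding cl[abs_def] by (intro tendsto_intros)
  then show ?thesis unfolding cauchy_leray_bv_def
    using inS_islimpt[OF S] by (intro tendsto_Lim) (auto simp: trivial_limit_within)
qed

text \<open>The singular term \<open>dda\<close>, of size U^(m-2) on the source box, already gives
  the bound; the other contributions to \<open>NN\<close> are nonnegative.\<close>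

lemma NN_lower:
  assumes "inT (Phi x)" "x \<in> Om"
  shows "UU powr (m - 2) / 16 \<le> NN (fst x)" "0 \<le> NN (fst x)"
proof -
  let ?u = "fst (fst x)"
  have T: "UU \<le> ?u" "?u \<le> 2 * UU" using assms(1) by (auto simp: inT_def Phi_simps(1))
  have u0: "0 < ?u" using T pos by linarith
  have g: "gp (fst x) \<le> 1/2" using T_facts(2)[OF assms] small(4) by linarith
  have nb: "0 \<le> NN (fst x)" "(1 - gp (fst x)) / 2 * dda ?u \<le> NN (fst x)" using NN_bounds(1,3)[of "fst x"] g u0 by auto
  then show "0 \<le> NN (fst x)" by simp
  have "3/4 \<le> m * (m - 1)" using m mult_mono[of "3/2" m "1/2" "m - 1"] by simp
  moreover have "1/2 * UU powr (m - 2) \<le> ?u powr (m - 2)"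
  proof -
    have "(1::real)/2 = 2 powr (-1)" by (simp add: powr_minus_divide)
    also have "\<dots> \<le> 2 powr (m - 2)" using m by (intro powr_mono) auto
    finally have "1/2 * UU powr (m - 2) \<le> 2 powr (m - 2) * UU powr (m - 2)" by (intro mult_right_mono) auto
    also have "\<dots> = (2 * UU) powr (m - 2)" by (rule powr_mult[symmetric])
    also have "\<dots> \<le> ?u powr (m - 2)" using powr_mono2'[of "m - 2" ?u "2 * UU"] u0 T(2) m by simp
    finally show ?thesis .
  qed
  ultimately have "3/4 * (1/2 * UU powr (m - 2)) \<le> m * (m - 1) * ?u powr (m - 2)" by (intro mult_mono) auto
  then have d: "3/8 * UU powr (m - 2) \<le> dda ?u" using u0 by (simp add: dda_def)
  have "1/4 * (3/8 * UU powr (m - 2)) \<le> (1 - gp (fst x)) / 2 * dda ?u" using g d by (intro mult_mono) auto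
  then show "UU powr (m - 2) / 16 \<le> NN (fst x)" using nb powr_ge_zero[of UU "m - 2"] by linarith
qed

lemma emeasure_Om_finite: "emeasure lborel Om < \<infinity>"
proof -
  have "Om \<subseteq> cbox ((-1, -1), 0) ((1, 1), 2 * pi)"
  proof
    fix x assume x: "x \<in> Om"
    then show "x \<in> cbox ((-1, -1), 0) ((1, 1), 2 * pi)"
      using gg_le_1[of "fst (fst x)" "snd (fst x)"] by (cases x) (auto simp: Om_def gp_def abs_le_iff)
  qed
  then show ?thesis using emeasure_bounded_finite[OF bounded_subset[OF bounded_cbox]] by blast
qed

lemma integrable_test: "integrable lborel (\<lambda>x. indicator Om x * test (Phi x))"
proof (rule Bochner_Integration.integrable_bound)
  show "integrable lborel (\<lambda>x. indicator Om x :: real)"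
    by (rule integrable_real_indicator) (use Om_measurable emeasure_Om_finite in auto)
  have "(\<lambda>x. indicator Om x :: real) \<in> borel_measurable borel" by (rule Om_indicator_measurable)
  then show "(\<lambda>x. indicator Om x * test (Phi x)) \<in> borel_measurable lborel" using test_Phi_measurable by simp
  show "AE x in lborel. norm (indicator Om x * test (Phi x)) \<le> norm (indicator Om x :: real)"
    by (rule AE_I2) (use test_bounds in \<open>auto simp: indicator_def\<close>)
qed

lemma rr_region: "gp p \<le> 5 * DD \<Longrightarrow> 1/2 \<le> rr p \<and> rr p \<le> 1 \<and> gp p < 1 \<and> 0 \<le> gp p"
proof -
  assume g: "gp p \<le> 5 * DD"
  have g0: "0 \<le> gp p" using n by (auto simp: gp_def gg_def)
  have g1: "gp p \<le> 1/4" using g small(4) by linarith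
  have "sqrt ((1/2)\<^sup>2) \<le> sqrt (1 - gp p)" using g1 by (intro real_sqrt_le_mono) (simp add: power2_eq_square)
  then have "1/2 \<le> sqrt (1 - gp p)" unfolding real_sqrt_abs by simp
  then show ?thesis using g0 g1 by (simp add: rr_def)
qed

lemma box_gp:
  assumes "UU \<le> u" "u \<le> 2 * UU" "\<bar>v\<bar> \<le> dl" shows "gp (u, v) \<le> 2 * DD"
  using UU_lt_XX(3)[of u] pow_n_le(1)[OF assms(3)] assms pos by (simp add: gp_def gg_def)

text \<open>Over each point of the half-size rectangle the angles with \<open>test\<close> >= 1/16
  include an interval about pi - a, where r sin a = alpha'(u) v/2 is the centre of the tilted strip.
  Its length is \<open>DD\<close>/64, and 1/16 is the product of four cut-offs of at least
  1/2.\<close>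

lemma test_slice_lower:
  assumes p: "p \<in> cbox (5/4 * UU, - dl / 2) (7/4 * UU, dl / 2)"
  shows "ennreal (DD / 1024) \<le> (\<integral>\<^sup>+ t. ennreal (indicator Om (p, t) * test (Phi (p, t))) \<partial>lborel)"
proof -
  obtain u v where puv: "p = (u, v)" by (metis surj_pair)
  have uv: "5/4 * UU \<le> u" "u \<le> 7/4 * UU" "\<bar>v\<bar> \<le> dl / 2" using p by (auto simp: puv abs_le_iff)
  have u: "UU \<le> u" "u \<le> 2 * UU" using uv pos by linarith+
  have v: "\<bar>v\<bar> \<le> dl" using uv(3) dl by linarith
  have g: "gp p \<le> 2 * DD" unfolding puv by (rule box_gp[OF u v])
  have r: "1/2 \<le> rr p" "rr p \<le> 1" "gp p < 1" using rr_region[of p] g pos by auto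
  define k where "k = da u / 2 * v"
  have "\<bar>k\<bar> = da u / 2 * \<bar>v\<bar>" using da_bound[OF u] by (simp add: k_def abs_mult)
  also have "\<dots> \<le> (2 * UU powr (m - 1)) * dl" using da_bound[OF u] v by (intro mult_mono) auto
  also have "\<dots> = 2 * (lam * DD)" using UU_dl by simp
  finally have k: "\<bar>k\<bar> \<le> 1/4" using small(2) by linarith
  define a where "a = arcsin (k / rr p)"
  have kr: "\<bar>k / rr p\<bar> \<le> 1/2" using k r(1) by (simp add: abs_divide divide_le_eq)
  have kr2: "- (1/2) \<le> k / rr p" "k / rr p \<le> 1/2" using kr unfolding abs_le_iff by linarith+
  have sa: "sin a = k / rr p" unfolding a_def by (rule sin_arcsin) (use kr2 in linarith)+
  have ab: "\<bar>a\<bar> \<le> pi / 6"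
  proof -
    have "arcsin (k / rr p) \<le> arcsin (1/2)" by (rule arcsin_le_arcsin) (use kr2 in linarith)+
    moreover have "arcsin (- (1/2)) \<le> arcsin (k / rr p)" by (rule arcsin_le_arcsin) (use kr2 in linarith)+
    moreover have "arcsin (1/2) = pi / 6" using arcsin_sin[of "pi/6"] by (simp add: sin_30)
    ultimately show ?thesis by (simp add: a_def arcsin_minus abs_le_iff)
  qed
  let ?I = "{pi - a - DD / 128 .. pi - a + DD / 128}"
  have "ennreal (DD / 1024) = ennreal (1/16) * emeasure lborel ?I" using pos by (simp add: ennreal_mult[symmetric])
  also have "\<dots> = (\<integral>\<^sup>+ t. ennreal (1/16) * indicator ?I t \<partial>lborel)" by (rule nn_integral_cmult_indicator[symmetric]) simp
  also have "\<dots> \<le> (\<integral>\<^sup>+ t. ennreal (indicator Om (p, t) * test (Phi (p, t))) \<partial>lborel)"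
  proof (rule nn_integral_mono)
    fix t
    show "ennreal (1/16) * indicator ?I t \<le> ennreal (indicator Om (p, t) * test (Phi (p, t)))"
    proof (cases "t \<in> ?I")
      case True
      have D1: "DD / 128 \<le> 1/128" using small(4) by simp
      have ta: "\<bar>t - (pi - a)\<bar> \<le> DD / 128" using True unfolding atLeastAtMost_iff abs_le_iff by linarith
      then have tp: "\<bar>t - pi\<bar> < pi / 2" using ab D1 pi_gt3 by linarith
      then have tO: "0 \<le> t" "t < 2 * pi" using pi_gt3 by linarith+
      then have x: "(p, t) \<in> Om" using r(3) by (simp add: Om_def)
      have "0 < cos (t - pi)" using tp by (intro cos_gt_zero_pi) linarith+
      then have ct: "cos t < 0" by simp
      have im: "Im (snd (Phi (p, t))) = rr p * sin t" and re: "Re (snd (Phi (p, t))) = rr p * cos t"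
        by (simp_all add: Phi_simps rr_def)
      have "\<bar>sin t - sin (pi - a)\<bar> \<le> \<bar>t - (pi - a)\<bar>"
      proof -
        have "norm (sin t - sin (pi - a)) \<le> 1 * norm (t - (pi - a))"
          by (rule field_differentiable_bound[of UNIV _ cos]) (auto intro!: derivative_eq_intros)
        then show ?thesis by simp
      qed
      then have "rr p * \<bar>sin t - sin (pi - a)\<bar> \<le> 1 * (DD / 128)" using r ta by (intro mult_mono) auto
      moreover have "rr p * sin t - k = rr p * (sin t - sin (pi - a))" using sa r(1) by (simp add: right_diff_distrib)
      ultimately have sk: "\<bar>rr p * sin t - k\<bar> \<le> DD / 128" using r(1) by (simp add: abs_mult)
      have f1: "fst (Phi (p, t)) = Complex u v" by (simp add: Phi_simps puv)
      have T: "inT (Phi (p, t))"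
        unfolding inT_def f1 im re complex.sel k_def[symmetric] using u v sk r(1) ct pos by (auto simp: mult_pos_neg)
      have b1: "1/2 \<le> bump ((Re (fst (Phi (p, t))) - 3/2 * UU) / (UU / 2))"
        unfolding f1 using uv pos by (intro bump_bounds) (auto simp: abs_le_iff field_simps)
      have b2: "1/2 \<le> bump (Im (fst (Phi (p, t))) / dl)"
        unfolding f1 using uv dl by (intro bump_bounds) (simp add: abs_divide divide_le_eq)
      have "\<bar>(rr p * sin t - k) / (DD / 64)\<bar> \<le> 1/2" unfolding abs_divide using sk pos by (simp add: divide_le_eq)
      then have b3: "1/2 \<le> bump ((Im (snd (Phi (p, t))) - kap (Re (fst (Phi (p, t)))) * Im (fst (Phi (p, t)))) / (DD / 64))"
        unfolding f1 im complex.sel kap_eq[OF u(1)] k_def[symmetric] by (intro bump_bounds(4))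
      have "\<bar>Re (snd (Phi (p, t))) + 1\<bar> \<le> 3 * DD" by (rule T_facts(3)[OF T x])
      then have "\<bar>2 * (Re (snd (Phi (p, t))) + 1)\<bar> \<le> 1/2" using small(4) unfolding abs_le_iff distrib_left by linarith
      then have b4: "1/2 \<le> bump (2 * (Re (snd (Phi (p, t))) + 1))" by (rule bump_bounds(4))
      have "(1/2 * (1/2)) * (1/2 * (1/2)) \<le> test (Phi (p, t))" unfolding test_def
        by (intro mult_mono b1 b2 b3 b4 mult_nonneg_nonneg bump_bounds) auto
      then have "1/16 \<le> test (Phi (p, t))" by simp
      then show ?thesis using True x by (simp add: ennreal_leI)
    qed simp
  qed
  finally show ?thesis .
qed

lemma integral_test_lower: "UU * dl * DD / 2048 \<le> (\<integral>x. indicator Om x * test (Phi x) \<partial>lborel)"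
proof -
  let ?B = "cbox (5/4 * UU, - dl / 2) (7/4 * UU, dl / 2)"
  have pm: "(\<lambda>x. ennreal (indicator Om x * test (Phi x))) \<in> borel_measurable borel"
    using borel_measurable_integrable[OF integrable_test] by simp
  have eB: "emeasure lborel ?B = ennreal (UU / 2 * dl)"
    using pos dl by (subst emeasure_lborel_cbox) (auto simp: Basis_prod_def prod.union_disjoint prod.reindex inj_on_def mult.commute)
  have "ennreal (UU * dl * DD / 2048) = ennreal (DD / 1024) * emeasure lborel ?B"
    unfolding eB using pos dl by (subst ennreal_mult[symmetric]) (auto simp: mult_ac)
  also have "\<dots> = (\<integral>\<^sup>+ p. ennreal (DD / 1024) * indicator ?B p \<partial>lborel)" by (rule nn_integral_cmult_indicator[symmetric]) simp
  also have "\<dots> \<le> (\<integral>\<^sup>+ p. (\<integral>\<^sup>+ t. ennreal (indicator Om (p, t) * test (Phi (p, t))) \<partial>lborel) \<partial>lborel)"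
    by (rule nn_integral_mono) (use test_slice_lower in \<open>auto simp: indicator_def simp del: mem_box\<close>)
  also have "\<dots> = (\<integral>\<^sup>+ x. ennreal (indicator Om x * test (Phi x)) \<partial>lborel)"
    using nn_integral_lborel_pair[of "\<lambda>p t. ennreal (indicator Om (p, t) * test (Phi (p, t)))"] pm by simp
  also have "\<dots> = ennreal (\<integral>x. indicator Om x * test (Phi x) \<partial>lborel)"
    by (rule nn_integral_eq_integral[OF integrable_test]) (use test_bounds in auto)
  finally show ?thesis
    by (subst (asm) ennreal_le_iff) (auto intro!: integral_nonneg_AE AE_I2 mult_nonneg_nonneg test_bounds)
qed

text \<open>The product of the lower bounds for N, for Re(Delta^-2) and for the integral of
  \<open>test\<close> is U^(m-1) dl / (16 * 128 * 2048 \<open>DD\<close>). Here U^(m-1) dl = lam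
  \<open>DD\<close> and the numerical factor is 2^22.\<close>

lemma cauchy_leray_bv_lower:
  assumes S: "inS z"
  shows "lam / (4 * pi\<^sup>2 * 2 ^ 22) \<le> cmod (cauchy_leray_bv gg (\<lambda>w. of_real (test w)) z)"
proof -
  have near: "DD / 8 \<le> cmod (Delta gg (Phi x) z)" if "x \<in> Om" "test (Phi x) \<noteq> 0" for x
    by (rule Delta_lower_near[OF S that]) (use pos in simp)
  note iK = KK_bound(1)[OF near]
  define c where "c = UU powr (m - 2) / 16 * (1 / (128 * DD\<^sup>2))"
  have c0: "0 \<le> c" by (simp add: c_def)
  have pt: "c * (indicator Om x * test (Phi x)) \<le> Re (KK z x)" for x
  proof (cases "x \<in> Om \<and> test (Phi x) \<noteq> 0")
    case True
    then have x: "x \<in> Om" and t: "test (Phi x) \<noteq> 0" by auto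
    note T = test_support(1)[OF t]
    have "KK z x = of_real (NN (fst x) * test (Phi x)) * (1 / (Delta gg (Phi x) z)\<^sup>2)" using x by (simp add: KK_def)
    then have "Re (KK z x) = NN (fst x) * test (Phi x) * Re (1 / (Delta gg (Phi x) z)\<^sup>2)"
      by (simp only: Re_complex_of_real Im_complex_of_real times_complex.sel)
    moreover have "UU powr (m - 2) / 16 * test (Phi x) * (1 / (128 * DD\<^sup>2)) \<le> NN (fst x) * test (Phi x) * Re (1 / (Delta gg (Phi x) z)\<^sup>2)"
      using NN_lower[OF T x] test_bounds Re_inverse_square[OF Delta_region[OF T x S]]
      by (intro mult_mono mult_nonneg_nonneg) auto
    ultimately show ?thesis using x by (simp add: c_def mult_ac)
  qed (auto simp: KK_def)
  have "c * (UU * dl * DD / 2048) \<le> c * (\<integral>x. indicator Om x * test (Phi x) \<partial>lborel)"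
    using integral_test_lower c0 by (rule mult_left_mono)
  also have "\<dots> = (\<integral>x. c * (indicator Om x * test (Phi x)) \<partial>lborel)" by (rule integral_mult_right_zero[symmetric])
  also have "\<dots> \<le> (\<integral>x. Re (KK z x) \<partial>lborel)"
    using pt iK integrable_test by (intro integral_mono integrable_mult_right integrable_Re) auto
  also have "\<dots> = Re (\<integral>x. KK z x \<partial>lborel)" using iK by (rule integral_Re)
  also have "\<dots> \<le> cmod (\<integral>x. KK z x \<partial>lborel)" by (rule complex_Re_le_cmod)
  finally have 1: "c * (UU * dl * DD / 2048) \<le> cmod (\<integral>x. KK z x \<partial>lborel)" .
  have "UU powr (m - 2) * UU powr 1 = UU powr (m - 1)" unfolding powr_add[symmetric] by simp
  then have "UU powr (m - 2) * UU * dl = lam * DD" using UU_dl pos by simp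
  then have "c * (UU * dl * DD / 2048) = lam * DD * DD / (16 * 128 * 2048 * DD\<^sup>2)"
    unfolding c_def by (simp add: mult_ac)
  also have "\<dots> = lam / 2 ^ 22" using pos by (simp add: power2_eq_square)
  finally have eq: "c * (UU * dl * DD / 2048) = lam / 2 ^ 22" .
  have "lam / 2 ^ 22 \<le> cmod (\<integral>x. KK z x \<partial>lborel)" using 1 unfolding eq .
  then have "1 / (4 * pi\<^sup>2) * (lam / 2 ^ 22) \<le> 1 / (4 * pi\<^sup>2) * cmod (\<integral>x. KK z x \<partial>lborel)" by (intro mult_left_mono) auto
  also have "\<dots> = cmod (cauchy_leray_bv gg (\<lambda>w. of_real (test w)) z)"
    unfolding boundary_value[OF S] norm_mult norm_of_real by simp
  finally show ?thesis by (simp add: field_simps)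
qed

end

text \<open>Within pi/3 of pi the cosine is at most -1/2, so the sine decreases with slope at most
  -1/2.\<close>

lemma sin_diff_lower:
  assumes "\<bar>s - pi\<bar> \<le> pi / 3" "\<bar>t - pi\<bar> \<le> pi / 3"
  shows "\<bar>s - t\<bar> / 2 \<le> \<bar>sin s - sin t\<bar>"
proof -
  have le: "(t - s) / 2 \<le> sin s - sin t" if st: "s \<le> t" "pi - pi / 3 \<le> s" "t \<le> pi + pi / 3" for s t
  proof -
    have "- sin s - s / 2 \<le> - sin t - t / 2"
    proof (rule DERIV_nonneg_imp_nondecreasing[OF st(1), of "\<lambda>x. - sin x - x / 2"])
      fix x assume x: "s \<le> x" "x \<le> t"
      have "\<bar>x - pi\<bar> \<le> pi / 3" using x st unfolding abs_le_iff by linarith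
      then have "cos (pi / 3) \<le> cos \<bar>x - pi\<bar>" by (intro cos_monotone_0_pi_le) auto
      then have "1/2 \<le> - cos x" unfolding cos_abs_real by (simp add: cos_60)
      moreover have "((\<lambda>x. - sin x - x / 2) has_real_derivative - cos x - 1/2) (at x)"
        by (auto intro!: derivative_eq_intros)
      ultimately show "\<exists>y. ((\<lambda>x. - sin x - x / 2) has_real_derivative y) (at x) \<and> 0 \<le> y" by (intro exI conjI) auto
    qed
    then show ?thesis by (simp add: field_simps)
  qed
  have a: "pi - pi / 3 \<le> s" "s \<le> pi + pi / 3" "pi - pi / 3 \<le> t" "t \<le> pi + pi / 3" using assms unfolding abs_le_iff by linarith+
  show ?thesis
  proof (cases "s \<le> t")
    case True
    have "\<bar>s - t\<bar> / 2 = (t - s) / 2" using True by simp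
    also have "\<dots> \<le> sin s - sin t" by (rule le[OF True a(1,4)])
    also have "\<dots> \<le> \<bar>sin s - sin t\<bar>" by (rule abs_ge_self)
    finally show ?thesis .
  next
    case False
    then have ts: "t \<le> s" by simp
    have "\<bar>s - t\<bar> / 2 = (s - t) / 2" using ts by simp
    also have "\<dots> \<le> sin t - sin s" by (rule le[OF ts a(3,2)])
    also have "\<dots> \<le> \<bar>sin s - sin t\<bar>" by simp
    finally show ?thesis .
  qed
qed

context egg_scale
begin

section \<open>Measures of the two boxes\<close>

lemma jac_le: "gp p \<le> 1 \<Longrightarrow> jac p \<le> 3"
proof -
  assume g: "gp p \<le> 1"
  have g0: "0 \<le> gp p" using n by (auto simp: gp_def gg_def)
  have le: "\<bar>fst p\<bar> \<le> 1" "\<bar>snd p\<bar> \<le> 1" using gg_le_1[of "fst p" "snd p"] g by (auto simp: gp_def)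
  have "(da (fst p))\<^sup>2 \<le> 4" using da_db_le(1)[OF le] power_mono[of "\<bar>da (fst p)\<bar>" 2 2] by simp
  moreover have "(db (snd p))\<^sup>2 \<le> 16" using da_db_le(2)[OF le] power_mono[of "\<bar>db (snd p)\<bar>" 4 2] by simp
  ultimately have "1 - gp p + grd p / 4 \<le> 3\<^sup>2" using g0 unfolding grd_def add_divide_distrib by simp
  then have "jac p \<le> sqrt (3\<^sup>2)" unfolding jac_def by (rule real_sqrt_le_mono)
  then show ?thesis by simp
qed

text \<open>For fixed p the values r sin t on the support lie in an interval of length
  \<open>DD\<close>/32, and the sheet condition keeps t within pi/3 of pi. With r >= 1/2 and
  \<open>sin_diff_lower\<close>, any two such angles differ by at most \<open>DD\<close>/8; the
  factor 3 bounds \<open>jac\<close>.\<close>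

lemma test_slice_upper:
  "(\<integral>\<^sup>+ t. ennreal (indicator Om (p, t) * jac p) * ennreal (test (Phi (p, t))) \<partial>lborel)
    \<le> ennreal (3 * DD / 4) * indicator (cbox (UU, - dl) (2 * UU, dl)) p"
proof (cases "\<exists>t. (p, t) \<in> Om \<and> test (Phi (p, t)) \<noteq> 0")
  case False
  then have "ennreal (indicator Om (p, t) * jac p) * ennreal (test (Phi (p, t))) = 0" for t
    by (cases "(p, t) \<in> Om") auto
  then show ?thesis by (simp only: nn_integral_const mult_zero_left zero_le)
next
  case True
  then obtain t0 where t0: "(p, t0) \<in> Om" "test (Phi (p, t0)) \<noteq> 0" by blast
  have T: "inT (Phi (p, t0))" by (rule test_support(1)[OF t0(2)])
  have p: "p \<in> cbox (UU, - dl) (2 * UU, dl)"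
    using T by (cases p) (auto simp: inT_def Phi_simps(1) abs_le_iff)
  have "gp p \<le> 2 * DD" using T_facts(2)[OF T t0(1)] by simp
  then have r: "1/2 \<le> rr p" "rr p \<le> 1" "gp p < 1" using rr_region[of p] pos by auto
  have sup: "\<bar>t - pi\<bar> \<le> pi / 3 \<and> \<bar>rr p * sin t - da (fst p) / 2 * snd p\<bar> \<le> DD / 64"
    if t: "(p, t) \<in> Om" "test (Phi (p, t)) \<noteq> 0" for t
  proof
    have im: "Im (snd (Phi (p, t))) = rr p * sin t" and re: "Re (snd (Phi (p, t))) = rr p * cos t"
      by (simp_all add: Phi_simps rr_def)
    have "inT (Phi (p, t))" by (rule test_support(1)[OF t(2)])
    then show "\<bar>rr p * sin t - da (fst p) / 2 * snd p\<bar> \<le> DD / 64" unfolding inT_def im Phi_simps(1) by simp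
    have c: "rr p * cos t < - 1/2" using test_support(2)[OF t(2)] unfolding re .
    have ct: "cos t < - (1/2)"
    proof (rule ccontr)
      assume "\<not> cos t < - (1/2)"
      then have "rr p * (- (1/2)) \<le> rr p * cos t" using r by (intro mult_left_mono) auto
      then show False using c r by linarith
    qed
    have t2: "0 \<le> t" "t < 2 * pi" using t(1) by (auto simp: Om_def)
    show "\<bar>t - pi\<bar> \<le> pi / 3"
    proof (rule ccontr)
      assume "\<not> \<bar>t - pi\<bar> \<le> pi / 3"
      then have "cos \<bar>t - pi\<bar> \<le> cos (pi / 3)" using t2 by (intro cos_monotone_0_pi_le) auto
      then show False using ct unfolding cos_abs_real by (simp add: cos_60)
    qed
  qed
  let ?I = "{t0 - DD / 8 .. t0 + DD / 8}"
  have "(\<integral>\<^sup>+ t. ennreal (indicator Om (p, t) * jac p) * ennreal (test (Phi (p, t))) \<partial>lborel) \<le> (\<integral>\<^sup>+ t. ennreal 3 * indicator ?I t \<partial>lborel)"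
  proof (rule nn_integral_mono)
    fix t
    show "ennreal (indicator Om (p, t) * jac p) * ennreal (test (Phi (p, t))) \<le> ennreal 3 * indicator ?I t"
    proof (cases "(p, t) \<in> Om \<and> test (Phi (p, t)) \<noteq> 0")
      case True
      note a = sup[OF conjunct1[OF True] conjunct2[OF True]] and b = sup[OF t0]
      have "\<bar>t - t0\<bar> / 2 \<le> \<bar>sin t - sin t0\<bar>" using a b by (intro sin_diff_lower) auto
      then have "\<bar>t - t0\<bar> \<le> 4 * (1/2 * \<bar>sin t - sin t0\<bar>)" by simp
      also have "1/2 * \<bar>sin t - sin t0\<bar> \<le> rr p * \<bar>sin t - sin t0\<bar>" using r by (intro mult_right_mono) auto
      also have "rr p * \<bar>sin t - sin t0\<bar> = \<bar>rr p * sin t - rr p * sin t0\<bar>"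
        using r by (simp add: right_diff_distrib[symmetric] abs_mult)
      also have "\<dots> \<le> DD / 32" using a b unfolding abs_le_iff by linarith
      finally have "\<bar>t - t0\<bar> \<le> DD / 8" by simp
      then have I: "t \<in> ?I" unfolding atLeastAtMost_iff abs_le_iff by linarith
      have "jac p * test (Phi (p, t)) \<le> 3 * 1" using jac_le[of p] r test_bounds jac_nonneg[of "(p, t)"] True by (intro mult_mono) auto
      then have "ennreal (jac p * test (Phi (p, t))) \<le> ennreal 3" by (intro ennreal_leI) simp
      then show ?thesis using I True jac_nonneg[of "(p, t)"] by (simp add: ennreal_mult test_bounds)
    qed auto
  qed
  also have "\<dots> = ennreal 3 * emeasure lborel ?I" by (rule nn_integral_cmult_indicator) simp
  also have "emeasure lborel ?I = ennreal (DD / 4)" using pos by simp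
  also have "ennreal 3 * ennreal (DD / 4) = ennreal (3 * (DD / 4))" using pos by (intro ennreal_mult[symmetric]) auto
  also have "3 * (DD / 4) = 3 * DD / 4" by simp
  finally show ?thesis using p by simp
qed

lemma nn_integral_test_upper: "(\<integral>\<^sup>+ w. ennreal (test w) \<partial>sigma gg) \<le> ennreal (3 / 2 * (UU * dl * DD))"
proof -
  let ?B = "cbox (UU, - dl) (2 * UU, dl)"
  let ?F = "\<lambda>p t. ennreal (indicator Om (p, t) * jac p) * ennreal (test (Phi (p, t)))"
  have pm: "(\<lambda>x. ennreal (indicator Om x * jac (fst x)) * ennreal (test (Phi x))) \<in> borel_measurable borel"
    using test_Phi_measurable by simp
  have eB: "emeasure lborel ?B = ennreal (UU * (2 * dl))"
    using pos dl by (subst emeasure_lborel_cbox) (auto simp: Basis_prod_def prod.union_disjoint prod.reindex inj_on_def mult.commute)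
  have "(\<integral>\<^sup>+ w. ennreal (test w) \<partial>sigma gg) = (\<integral>\<^sup>+ x. ?F (fst x) (snd x) \<partial>lborel)"
    by (subst nn_integral_sigma) (use test_measurable in simp_all)
  also have "\<dots> = (\<integral>\<^sup>+ p. (\<integral>\<^sup>+ t. ?F p t \<partial>lborel) \<partial>lborel)"
    by (rule nn_integral_lborel_pair) (use pm in simp)
  also have "\<dots> \<le> (\<integral>\<^sup>+ p. ennreal (3 * DD / 4) * indicator ?B p \<partial>lborel)"
    by (intro nn_integral_mono test_slice_upper)
  also have "\<dots> = ennreal (3 * DD / 4) * emeasure lborel ?B" by (rule nn_integral_cmult_indicator) simp
  also have "\<dots> = ennreal (3 / 2 * (UU * dl * DD))" unfolding eB using pos dl by (subst ennreal_mult[symmetric]) (auto simp: mult_ac)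
  finally show ?thesis .
qed

lemma inS_measurable: "{z. inS z} \<in> sets borel"
proof -
  have "continuous_on UNIV (\<lambda>w::c2. gg (Re (fst w)) (Im (fst w)))"
    by (rule continuous_on_compose2[OF cont_gg, of _ "\<lambda>w. (Re (fst w), Im (fst w))", simplified]) (intro continuous_intros)
  then have "continuous_on UNIV (rho gg)" unfolding rho_def[abs_def] by (intro continuous_intros)
  then have [measurable]: "rho gg \<in> borel_measurable borel" by (rule borel_measurable_continuous_onI)
  have "Measurable.pred borel inS" unfolding inS_def[abs_def] by measurable
  then show ?thesis by (simp add: pred_def)
qed

lemma inS_Phi:
  assumes u: "XX \<le> u" "u \<le> 2 * XX" and v: "\<bar>v\<bar> \<le> YY / 64" and t: "\<bar>t - pi\<bar> \<le> DD / 64"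
  shows "((u, v), t) \<in> Om" "inS (Phi ((u, v), t))" "1/2 \<le> jac (u, v)"
proof -
  have u0: "0 < u" using u pos by linarith
  have "XX \<le> dl / lam" by (rule XX_le)
  also have "\<dots> \<le> dl" using lam dl by (simp add: field_simps)
  finally have u1: "u \<le> 1/8" using u small(1) by linarith
  have "\<bar>u\<bar> powr m \<le> \<bar>u\<bar> powr 1" using u0 u1 m by (intro powr_mono') auto
  then have um: "\<bar>u\<bar> powr m \<le> 1/8" using u0 u1 by simp
  have "\<bar>v\<bar> \<le> dl" using v XX_le(3) pos by linarith
  from pow_n_le(1)[OF this] um have g: "gp (u, v) \<le> 1/2" using small(4) by (simp add: gp_def gg_def)
  have g0: "0 \<le> gp (u, v)" using n by (auto simp: gp_def gg_def)
  have t1: "\<bar>t - pi\<bar> < pi / 2" using t small(4) pi_gt3 by linarith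
  then have "0 \<le> t" "t < 2 * pi" using pi_gt3 by linarith+
  then show x: "((u, v), t) \<in> Om" using g by (simp add: Om_def)
  define r where "r = sqrt (1 - gp (u, v))"
  have r: "0 < r" "r \<le> 1" using g g0 by (auto simp: r_def)
  have f1: "fst (Phi ((u, v), t)) = Complex u v" by (simp add: Phi_simps)
  have im: "Im (snd (Phi ((u, v), t))) = r * sin t" and re: "Re (snd (Phi ((u, v), t))) = r * cos t"
    by (simp_all add: Phi_simps r_def)
  have "\<bar>sin (t - pi)\<bar> \<le> \<bar>t - pi\<bar>" by (rule abs_sin_x_le_abs_x)
  then have "\<bar>sin t\<bar> \<le> DD / 64" using t by simp
  then have "r * \<bar>sin t\<bar> \<le> 1 * (DD / 64)" using r by (intro mult_mono) auto
  then have s: "\<bar>r * sin t\<bar> \<le> DD / 64" using r by (simp add: abs_mult)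
  have "0 < cos (t - pi)" using t1 by (intro cos_gt_zero_pi) linarith+
  then have c: "r * cos t < 0" using r by (simp add: mult_pos_neg)
  have rho0: "rho gg (Phi ((u, v), t)) = 0"
    using g by (simp add: rho_def Phi_simps norm_mult gp_def)
  show "inS (Phi ((u, v), t))" unfolding inS_def f1 im re rho0 complex.sel using u v s c by simp
  have "sqrt ((1/2)\<^sup>2) \<le> sqrt (1 - gp (u, v) + grd (u, v) / 4)"
    using g by (intro real_sqrt_le_mono) (simp add: power2_eq_square grd_def add_increasing2)
  then show "1/2 \<le> jac (u, v)" unfolding real_sqrt_abs jac_def by simp
qed

text \<open>The parameter box has volume \<open>XX\<close> \<open>YY\<close> \<open>DD\<close>/1024
  and \<open>jac\<close> is at least 1/2 on it. By \<open>XX_YY\<close> the result is expressed in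
  the volume U dl \<open>DD\<close> of the source box, which makes the comparison with
  \<open>nn_integral_test_upper\<close> immediate.\<close>

lemma emeasure_inS_lower: "ennreal (UU * dl * DD / 2048) \<le> emeasure (sigma gg) {z. inS z}"
proof -
  let ?B = "cbox ((XX, - YY / 64), pi - DD / 64) ((2 * XX, YY / 64), pi + DD / 64)"
  have eB: "emeasure lborel ?B = ennreal (XX * YY * DD / 1024)"
    using pos dl by (subst emeasure_lborel_cbox) (auto simp: Basis_prod_def prod.union_disjoint prod.reindex inj_on_def mult.commute)
  have pw: "ennreal (1/2) * indicator ?B x \<le> ennreal (indicator Om x * jac (fst x)) * indicator {z. inS z} (Phi x)" for x
  proof (cases "x \<in> ?B")
    case True
    obtain u v t where x: "x = ((u, v), t)" by (metis surj_pair)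
    have "XX \<le> u \<and> u \<le> 2 * XX \<and> - (YY / 64) \<le> v \<and> v \<le> YY / 64 \<and> pi - DD / 64 \<le> t \<and> t \<le> pi + DD / 64"
      using True unfolding x by (simp add: cbox_Pair_eq)
    then have b: "XX \<le> u" "u \<le> 2 * XX" "\<bar>v\<bar> \<le> YY / 64" "\<bar>t - pi\<bar> \<le> DD / 64"
      unfolding abs_le_iff by linarith+
    have "indicator ?B x = (1 :: ennreal)" "indicator Om x = (1 :: real)" "indicator {z. inS z} (Phi x) = (1 :: ennreal)"
      using True inS_Phi(1,2)[OF b] unfolding x by (simp_all del: mem_box)
    moreover have "ennreal (1/2) \<le> ennreal (jac (fst x))" unfolding x fst_conv using inS_Phi(3)[OF b] by (rule ennreal_leI)
    ultimately show ?thesis by (simp only: mult_1_left mult_1_right)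
  qed simp
  have sb: "sets (sigma gg) = sets borel" unfolding sigma_eq by simp
  have "ennreal (UU * dl * DD / 2048) = ennreal (1/2) * emeasure lborel ?B"
    unfolding eB XX_YY using pos dl by (subst ennreal_mult[symmetric]) (auto simp: mult_ac)
  also have "\<dots> = (\<integral>\<^sup>+ x. ennreal (1/2) * indicator ?B x \<partial>lborel)" by (rule nn_integral_cmult_indicator[symmetric]) simp
  also have "\<dots> \<le> (\<integral>\<^sup>+ x. ennreal (indicator Om x * jac (fst x)) * indicator {z. inS z} (Phi x) \<partial>lborel)"
    by (rule nn_integral_mono) (rule pw)
  also have "\<dots> = (\<integral>\<^sup>+ w. indicator {z. inS z} w \<partial>sigma gg)"
    by (rule nn_integral_sigma[symmetric]) (use inS_measurable in simp)
  also have "\<dots> = emeasure (sigma gg) {z. inS z}" by (rule nn_integral_indicator) (use inS_measurable sb in simp)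
  finally show ?thesis .
qed

end

section \<open>From the test functions to unboundedness\<close>

lemma Lp_norm_le:
  assumes "1 \<le> p" "0 \<le> A" "(\<integral>\<^sup>+ x. ennreal (cmod (h x) powr p) \<partial>M) \<le> ennreal A"
  shows "Lp_norm M p h \<le> ennreal (A powr (1 / p))"
proof -
  let ?I = "\<integral>\<^sup>+ x. ennreal (cmod (h x) powr p) \<partial>M"
  have "?I < top" using assms(3) by (rule le_less_trans) simp
  then have fin: "?I \<noteq> \<infinity>" by simp
  have "enn2real ?I \<le> A" using assms(2,3) by (rule enn2real_leI)
  then have "enn2real ?I powr (1 / p) \<le> A powr (1 / p)" using assms(1) by (intro powr_mono2) auto
  then show ?thesis unfolding Lp_norm_def Let_def using fin by (simp add: ennreal_leI)
qed

lemma Lp_norm_ge: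
  assumes "1 \<le> p" "0 \<le> A" "ennreal A \<le> (\<integral>\<^sup>+ x. ennreal (cmod (h x) powr p) \<partial>M)"
  shows "ennreal (A powr (1 / p)) \<le> Lp_norm M p h"
proof (cases "(\<integral>\<^sup>+ x. ennreal (cmod (h x) powr p) \<partial>M) = \<infinity>")
  case False
  let ?I = "\<integral>\<^sup>+ x. ennreal (cmod (h x) powr p) \<partial>M"
  have "ennreal A \<le> ennreal (enn2real ?I)" using assms(3) False by (simp add: less_top)
  then have "A \<le> enn2real ?I" by (subst (asm) ennreal_le_iff) auto
  then have "A powr (1 / p) \<le> enn2real ?I powr (1 / p)" using assms(1,2) by (intro powr_mono2) auto
  then show ?thesis unfolding Lp_norm_def Let_def using False by (simp add: ennreal_leI)
qed (simp add: Lp_norm_def)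

context egg
begin

lemma sets_sigma: "sets (sigma gg) = sets borel" "space (sigma gg) = UNIV"
  unfolding sigma_eq by simp_all

text \<open>The scales enter only through one volume V, which bounds the L^1 norm of f from above
  and the measure of S from below, up to fixed factors. The lower bound K for the boundary values on
  S is arbitrary.\<close>

lemma test_family:
  fixes K :: real
  assumes h: "2 * (real n - m) \<le> m * m"
  obtains f :: "c2 \<Rightarrow> complex" and V S where "C1_fun f" "\<forall>w. cmod (f w) \<le> 1" "0 < V"
    "(\<integral>\<^sup>+ w. ennreal (cmod (f w)) \<partial>sigma gg) \<le> ennreal (3 / 2 * V)"
    "S \<in> sets (sigma gg)" "ennreal (V / 2048) \<le> emeasure (sigma gg) S"
    "\<forall>z\<in>S. K \<le> cmod (cauchy_leray_bv gg f z)"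
proof -
  define L where "L = max 256 (K * (4 * pi\<^sup>2 * 2 ^ 22))"
  have "K * (4 * pi\<^sup>2 * 2 ^ 22) \<le> L" and L: "256 \<le> L" by (auto simp: L_def)
  then have KL: "K \<le> L / (4 * pi\<^sup>2 * 2 ^ 22)" by (simp add: le_divide_eq)
  \<comment> \<open>The solution of \<open>rel\<close> for lam = L. The hypothesis h says that the
    exponent m^2/(n-m) is at least 2, which is the required bound d <= 1/L^2.\<close>
  define d where "d = L powr (- (m * m) / (real n - m))"
  have "d powr (real n - m) = L powr (- (m * m))" using mn by (simp add: d_def powr_powr)
  moreover have "d \<le> 1 / L\<^sup>2"
  proof -
    have "2 \<le> m * m / (real n - m)" using h mn by (simp add: le_divide_eq)
    then have "d \<le> L powr (- 2)" unfolding d_def using L by (intro powr_mono) auto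
    then show ?thesis using L by (simp add: powr_minus powr_numeral inverse_eq_divide)
  qed
  moreover have "0 < d" using L by (simp add: d_def)
  ultimately interpret egg_scale m n L d using L by unfold_locales auto
  show thesis
  proof (rule that[of "\<lambda>w. complex_of_real (test w)" "UU * d * DD" "{z. inS z}"])
    have e: "cmod (complex_of_real (test w)) = test w" for w using test_bounds[of w] by simp
    show "C1_fun (\<lambda>w. complex_of_real (test w))" by (rule C1_fun_of_real[OF C1_real_test])
    show "\<forall>w. cmod (complex_of_real (test w)) \<le> 1" unfolding e by (intro allI test_bounds)
    show "0 < UU * d * DD" using pos dl by simp
    show "(\<integral>\<^sup>+ w. ennreal (cmod (complex_of_real (test w))) \<partial>sigma gg) \<le> ennreal (3 / 2 * (UU * d * DD))"
      unfolding e by (rule nn_integral_test_upper)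
    show "{z. inS z} \<in> sets (sigma gg)" unfolding sets_sigma by (rule inS_measurable)
    show "ennreal (UU * d * DD / 2048) \<le> emeasure (sigma gg) {z. inS z}" by (rule emeasure_inS_lower)
    show "\<forall>z\<in>{z. inS z}. K \<le> cmod (cauchy_leray_bv gg (\<lambda>w. complex_of_real (test w)) z)"
      using order_trans[OF KL cauchy_leray_bv_lower] by simp
  qed
qed

text \<open>Since |f| <= 1, its p-th power is at most |f|, so the L^p norm of f is at most
  (3V/2)^(1/p), while that of its image is at least K (V/2048)^(1/p). V cancels and the ratio is at
  least K/3072, with 3072 = 2048 * 3/2. For p infinite it suffices that S has positive
  measure.\<close>

lemma unbounded:
  assumes h: "2 * (real n - m) \<le> m * m"
  shows Lp_unbounded: "1 \<le> p \<Longrightarrow> \<not> (\<exists>M::real. \<forall>f. C1_fun f \<longrightarrow>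
              Lp_norm (sigma gg) p (cauchy_leray_bv gg f) \<le> ennreal M * Lp_norm (sigma gg) p f)"
    and Linf_unbounded: "\<not> (\<exists>M::real. \<forall>f. C1_fun f \<longrightarrow>
           Linf_norm (sigma gg) (cauchy_leray_bv gg f) \<le> ennreal M * Linf_norm (sigma gg) f)"
proof -
  {
    assume p: "1 \<le> p"
    show "\<not> (\<exists>M::real. \<forall>f. C1_fun f \<longrightarrow>
              Lp_norm (sigma gg) p (cauchy_leray_bv gg f) \<le> ennreal M * Lp_norm (sigma gg) p f)"
    proof
      assume "\<exists>M::real. \<forall>f. C1_fun f \<longrightarrow>
              Lp_norm (sigma gg) p (cauchy_leray_bv gg f) \<le> ennreal M * Lp_norm (sigma gg) p f"
      then obtain M where M: "\<And>f. C1_fun f \<Longrightarrow>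
              Lp_norm (sigma gg) p (cauchy_leray_bv gg f) \<le> ennreal M * Lp_norm (sigma gg) p f" by blast
      define N where "N = max M 0"
      \<comment> \<open>A negative M is mapped to 0 by \<open>ennreal\<close>, so it may be replaced
        by max M 0.\<close>
      have N: "ennreal M = ennreal N" "0 \<le> N" by (auto simp: N_def max_def ennreal_neg)
      \<comment> \<open>Chosen so that K > 3072^(1/p) N for every p >= 1.\<close>
      define K where "K = 3072 * N + 1"
      have K0: "0 < K" using N by (simp add: K_def)
      obtain f V S where f: "C1_fun f" "\<forall>w. cmod (f w) \<le> 1" and V: "0 < V"
        and int: "(\<integral>\<^sup>+ w. ennreal (cmod (f w)) \<partial>sigma gg) \<le> ennreal (3 / 2 * V)"
        and S: "S \<in> sets (sigma gg)" "ennreal (V / 2048) \<le> emeasure (sigma gg) S"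
        and low: "\<forall>z\<in>S. K \<le> cmod (cauchy_leray_bv gg f z)"
        by (rule test_family[OF h, of K])
      have "(\<integral>\<^sup>+ w. ennreal (cmod (f w) powr p) \<partial>sigma gg) \<le> (\<integral>\<^sup>+ w. ennreal (cmod (f w)) \<partial>sigma gg)"
      proof (intro nn_integral_mono ennreal_leI)
        fix w
        have "cmod (f w) powr p \<le> cmod (f w) powr 1" using p f(2)[rule_format, of w] by (intro powr_mono') auto
        then show "cmod (f w) powr p \<le> cmod (f w)" by simp
      qed
      also note int
      finally have up: "Lp_norm (sigma gg) p f \<le> ennreal ((3 / 2 * V) powr (1 / p))"
        using V p by (intro Lp_norm_le) auto
      have "ennreal (K powr p * (V / 2048)) = ennreal (K powr p) * ennreal (V / 2048)" using V by (intro ennreal_mult) auto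
      also have "\<dots> \<le> ennreal (K powr p) * emeasure (sigma gg) S" by (intro mult_left_mono S) simp
      also have "\<dots> = (\<integral>\<^sup>+ z. ennreal (K powr p) * indicator S z \<partial>sigma gg)" by (rule nn_integral_cmult_indicator[symmetric, OF S(1)])
      also have "\<dots> \<le> (\<integral>\<^sup>+ z. ennreal (cmod (cauchy_leray_bv gg f z) powr p) \<partial>sigma gg)"
      proof (rule nn_integral_mono)
        fix z
        show "ennreal (K powr p) * indicator S z \<le> ennreal (cmod (cauchy_leray_bv gg f z) powr p)"
        proof (cases "z \<in> S")
          case True
          have "K powr p \<le> cmod (cauchy_leray_bv gg f z) powr p" using K0 p bspec[OF low True] by (intro powr_mono2) auto
          then show ?thesis using True by (simp add: ennreal_leI)
        qed simp
      qed
      finally have "ennreal ((K powr p * (V / 2048)) powr (1 / p)) \<le> Lp_norm (sigma gg) p (cauchy_leray_bv gg f)"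
        using V p by (intro Lp_norm_ge) auto
      also note M[OF f(1)]
      also have "ennreal M * Lp_norm (sigma gg) p f \<le> ennreal N * ennreal ((3 / 2 * V) powr (1 / p))"
        unfolding N(1) by (intro mult_left_mono up) simp
      also have "\<dots> = ennreal (N * (3 / 2 * V) powr (1 / p))" using N by (simp add: ennreal_mult)
      finally have "(K powr p * (V / 2048)) powr (1 / p) \<le> N * (3 / 2 * V) powr (1 / p)"
        using N by (subst (asm) ennreal_le_iff) auto
      moreover have "(K powr p * (V / 2048)) powr (1 / p) = K * (V / 2048) powr (1 / p)"
        unfolding powr_mult powr_powr using p K0 by simp
      moreover have "(3 / 2 * V) powr (1 / p) = 3072 powr (1 / p) * (V / 2048) powr (1 / p)"
        unfolding powr_mult[symmetric] by simp
      ultimately have "K * (V / 2048) powr (1 / p) \<le> (N * 3072 powr (1 / p)) * (V / 2048) powr (1 / p)" by (simp only: mult.assoc)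
      then have "K \<le> N * 3072 powr (1 / p)" by (rule mult_right_le_imp_le) (use V in simp)
      also have "\<dots> \<le> N * 3072 powr 1" using p N by (intro mult_left_mono powr_mono) auto
      finally show False by (simp add: K_def)
    qed
  }
  show "\<not> (\<exists>M::real. \<forall>f. C1_fun f \<longrightarrow>
           Linf_norm (sigma gg) (cauchy_leray_bv gg f) \<le> ennreal M * Linf_norm (sigma gg) f)"
  proof
    assume "\<exists>M::real. \<forall>f. C1_fun f \<longrightarrow>
           Linf_norm (sigma gg) (cauchy_leray_bv gg f) \<le> ennreal M * Linf_norm (sigma gg) f"
    then obtain M where M: "\<And>f. C1_fun f \<Longrightarrow>
           Linf_norm (sigma gg) (cauchy_leray_bv gg f) \<le> ennreal M * Linf_norm (sigma gg) f" by blast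
    define N where "N = max M 0"
    have N: "ennreal M = ennreal N" "0 \<le> N" by (auto simp: N_def max_def ennreal_neg)
    obtain f V S where f: "C1_fun f" "\<forall>w. cmod (f w) \<le> 1" and V: "0 < V"
      and S: "S \<in> sets (sigma gg)" "ennreal (V / 2048) \<le> emeasure (sigma gg) S"
      and low: "\<forall>z\<in>S. N + 1 \<le> cmod (cauchy_leray_bv gg f z)"
      by (rule test_family[OF h, of "N + 1"])
    have cf: "continuous_on UNIV f"
      using f(1) has_derivative_continuous unfolding C1_fun_def by (blast intro: continuous_at_imp_continuous_on)
    have fm: "f \<in> borel_measurable (sigma gg)"
      unfolding measurable_cong_sets[OF sets_sigma(1) refl] by (rule borel_measurable_continuous_onI[OF cf])
    have "Linf_norm (sigma gg) f \<le> 1" unfolding Linf_norm_def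
      by (rule esssup_I) (use f(2) fm in auto)
    then have "ennreal M * Linf_norm (sigma gg) f \<le> ennreal N * 1" unfolding N(1) by (intro mult_left_mono) auto
    with M[OF f(1)] have le: "Linf_norm (sigma gg) (cauchy_leray_bv gg f) \<le> ennreal N" by simp
    have "AE z in sigma gg. ennreal (cmod (cauchy_leray_bv gg f z)) \<le> Linf_norm (sigma gg) (cauchy_leray_bv gg f)"
      unfolding Linf_norm_def by (rule esssup_AE)
    then have "AE z in sigma gg. z \<notin> S"
    proof eventually_elim
      case (elim z)
      then have "ennreal (cmod (cauchy_leray_bv gg f z)) \<le> ennreal N" using le by (rule order_trans)
      then have "cmod (cauchy_leray_bv gg f z) \<le> N" using N by (simp add: ennreal_le_iff)
      then show ?case using low by force
    qed
    then have "emeasure (sigma gg) {z \<in> space (sigma gg). z \<in> S} = 0" by (rule emeasure_eq_0_AE)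
    then have "emeasure (sigma gg) S = 0" by (simp add: sets_sigma)
    then show False using S(2) V by simp
  qed
qed

lemma CL_conclusion_egg:
  assumes "2 * (real n - m) \<le> m * m"
  shows "CL_conclusion gg"
  unfolding CL_conclusion_def
proof (intro conjI allI impI Lp_unbounded Linf_unbounded assms)
  fix f assume "C1_fun f"
  then obtain F' where "\<And>x. (f has_derivative blinfun_apply (F' x)) (at x)" "continuous_on UNIV F'"
    unfolding C1_fun_def by blast
  then show "\<exists>G. continuous_on (closure (dom gg)) G \<and> (\<forall>z\<in>dom gg. G z = cauchy_leray gg f z)"
    by (rule cauchy_leray_extension)
qed

end

theorem theorem1p1:
  shows "CL_conclusion g_a \<and> (\<forall>m::real. 3/2 < m \<and> m < 2 \<longrightarrow> CL_conclusion (g_b m))"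
proof (intro conjI allI impI)
  interpret egg 2 4 by unfold_locales auto
  have "gg = g_a" by (intro ext) (simp add: gg_def g_a_def)
  \<comment> \<open>For m = 2 and n = 4 the condition 2 (n-m) <= m^2 holds with equality.\<close>
  then show "CL_conclusion g_a" using CL_conclusion_egg by simp
next
  fix m :: real assume m: "3/2 < m \<and> m < 2"
  interpret egg m 2 using m by unfold_locales auto
  have "gg = g_b m" by (intro ext) (simp add: gg_def g_b_def)
  \<comment> \<open>Since m > 3/2, the left side is below 1 and the right side above 9/4.\<close>
  moreover have "2 * (real 2 - m) \<le> m * m"
    using m mult_mono[of "3/2" m "3/2" m] by simp
  ultimately show "CL_conclusion (g_b m)" using CL_conclusion_egg by simp
qed

end
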